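(* For every associative category $(\mathbf B,\otimes,\beta)$ there is a unique strict tensor functor $$P^{\mathbf B}:\ \Big(\overline{\mathbf A}=\coprod_{n\ge 1}\mathbf A_n\Big)\longrightarrow \Big(\overline{\mathbf{It}(\mathbf B)}=\coprod_{n\ge 1}\mathbf{It}(\mathbf B)_n\Big)$$ such that (i) the object $*\in\mathbf A_1$ is sent to $\mathrm{Id}_{\mathbf B}\in\mathbf{It}(\mathbf B)_1$; (ii) the object $*\in\mathbf A_2$ is sent to $\otimes\in\mathbf{It}(\mathbf B)_2$; (iii) the isomorphism $\alpha$ in $\mathbf A_3$ is sent to the isomorphism $\beta$ in $\mathbf{It}(\mathbf B)_3$.
   Context: Associative category: a category $\mathbf B$ with a bifunctor $\otimes:\mathbf B\times\mathbf B\to\mathbf B$ and a natural isomorphism $\beta_{A,B,C}:A\otimes(B\otimes C)\to(A\otimes B)\otimes C$ (no pentagon condition, no unit). A strict tensor functor $F:(\mathbf B,\otimes,\beta)\to(\mathbf B',\otimes',\beta')$ is a functor with $F(A\otimes B)=F(A)\otimes' F(B)$ (on objects and morphisms) and $F(\beta_{A,B,C})=\beta'_{FA,FB,FC}$. Catalan groupoids: let $\mathbf I$ (resp. $\dot{\mathbf I}$) be the indiscrete (resp. discrete) category with two objects $0,1$, and $\iota:0\to1$ the nontrivial isomorphism of $\mathbf I$. Groupoids $\mathbf A_n$ ($n\ge1$) and functors $U_{a,b}:\mathbf A_a\times\mathbf A_b\to\mathbf A_{a+b}$, $V_{i,j,k}:\mathbf A_i\times\mathbf A_j\times\mathbf A_k\times\mathbf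 I\to\mathbf A_{i+j+k}$ are defined inductively (all indices positive integers). $\mathbf A_1=\mathbf 1$ is the trivial category with one object $*$. For $n\ge2$, $\mathbf A_n$ is the pushout (of categories) of $$\coprod_{i+j+k=n}\mathbf A_i\times\mathbf A_j\times\mathbf A_k\times\mathbf I\ \hookleftarrow\ \coprod_{i+j+k=n}\mathbf A_i\times\mathbf A_j\times\mathbf A_k\times\dot{\mathbf I}\ \xrightarrow{W_{i,j,k}}\ \coprod_{a+b=n}\mathbf A_a\times\mathbf A_b,$$ where $W_{i,j,k}(f,g,h,0)=(f,U_{j,k}(g,h))$ and $W_{i,j,k}(f,g,h,1)=(U_{i,j}(f,g),h)$ (similarly on morphisms); $V_{i,j,k}$ and $U_{a,b}$ are the structure maps into the pushout. So $\mathbf A_2=\mathbf 1$ (object $*$), and $\mathbf A_3$ is the indiscrete category with two objects, with $\alpha=V_{1,1,1}(\mathrm{Id},\mathrm{Id},\mathrm{Id},\iota)$. $\overline{\mathbf A}=\coprod_{n\ge1}\mathbf A_n$ is an associative category with $f\otimes_{\overline{\mathbf A}}g=U_{i,j}(f,g)$ for $f$ in $\mathbf A_i$, $g$ in $\mathbf A_j$ (objects or morphisms), and reassociation $\bar\alpha_{f,g,h}=V_{i,j,k}(\mathrm{Id}_f,\mathrm{Id}_g,\mathrm{Id}_h,\iota)$. For an associative category $(\mathbf B,\otimes,\beta)$, let $\overline{\mathbf B}=\coprod_{n\ge1}\mathbf{Hom}_{\mathbf{Cat}}(\mathbf B^n,\mathbf B)$ (functor categories). It is an associative category: for $f:\mathbf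 B^q\to\mathbf B$, $g:\mathbf B^r\to\mathbf B$, $h:\mathbf B^s\to\mathbf B$ set $f\otimes_{\overline{\mathbf B}}g=\otimes\circ(f\times g):\mathbf B^{q+r}\to\mathbf B$ (similarly on natural transformations) and $\bar\beta_{f,g,h}(b_1,\dots,b_{q+r+s})=\beta_{f(b_1,\dots,b_q),\,g(b_{q+1},\dots,b_{q+r}),\,h(b_{q+r+1},\dots,b_{q+r+s})}$. The category of iterates $\overline{\mathbf{It}(\mathbf B)}$ is the associative subcategory of $\overline{\mathbf B}$ generated by $\mathrm{Id}_{\mathbf B}\in\mathbf{Hom}(\mathbf B,\mathbf B)$ (the smallest subcategory containing $\mathrm{Id}_{\mathbf B}$, closed under $\otimes_{\overline{\mathbf B}}$ on objects and morphisms, and containing the components $\bar\beta_{f,g,h}$ and their inverses for its objects); $\mathbf{It}(\mathbf B)_n$ is its part lying in $\mathbf{Hom}_{\mathbf{Cat}}(\mathbf B^n,\mathbf B)$. The isomorphism $\beta$ in $\mathbf{It}(\mathbf B)_3$ is $\bar\beta_{\mathrm{Id},\mathrm{Id},\mathrm{Id}}:\otimes\circ(\mathrm{Id}\times\otimes)\to\otimes\circ(\otimes\times\mathrm{Id})$. *)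

theory Defs
  imports Main "HOL-Library.FuncSet"
begin

section \<open>Categories, functors, natural transformations\<close>

text \<open>
  Only the values of the operations on the carriers \<open>Ob\<close>, \<open>Ar\<close> matter.
  \<open>Cmp C g f\<close> is the composite of \<open>f\<close> followed by \<open>g\<close>.
\<close>

record ('o, 'a) cat =
  Ob :: "'o set"
  Ar :: "'a set"
  Dom :: "'a \<Rightarrow> 'o"
  Cod :: "'a \<Rightarrow> 'o"
  Idn :: "'o \<Rightarrow> 'a"
  Cmp :: "'a \<Rightarrow> 'a \<Rightarrow> 'a"

definition hom :: "('o, 'a, 'e) cat_scheme \<Rightarrow> 'o \<Rightarrow> 'o \<Rightarrow> 'a set" where
  "hom C x y = {f \<in> Ar C. Dom C f = x \<and> Cod C f = y}"

definition category :: "('o, 'a, 'e) cat_scheme \<Rightarrow> bool" where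
  "category C \<longleftrightarrow>
     (\<forall>f\<in>Ar C. Dom C f \<in> Ob C \<and> Cod C f \<in> Ob C) \<and>
     (\<forall>x\<in>Ob C. Idn C x \<in> hom C x x) \<and>
     (\<forall>f\<in>Ar C. \<forall>g\<in>Ar C. Cod C f = Dom C g \<longrightarrow> Cmp C g f \<in> hom C (Dom C f) (Cod C g)) \<and>
     (\<forall>f\<in>Ar C. Cmp C f (Idn C (Dom C f)) = f \<and> Cmp C (Idn C (Cod C f)) f = f) \<and>
     (\<forall>f\<in>Ar C. \<forall>g\<in>Ar C. \<forall>h\<in>Ar C. Cod C f = Dom C g \<longrightarrow> Cod C g = Dom C h \<longrightarrow>
        Cmp C h (Cmp C g f) = Cmp C (Cmp C h g) f)"

definition inverse_arrows :: "('o, 'a, 'e) cat_scheme \<Rightarrow> 'a \<Rightarrow> 'a \<Rightarrow> bool" where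
  "inverse_arrows C f g \<longleftrightarrow> f \<in> Ar C \<and> g \<in> hom C (Cod C f) (Dom C f) \<and>
     Cmp C g f = Idn C (Dom C f) \<and> Cmp C f g = Idn C (Cod C f)"

definition iso :: "('o, 'a, 'e) cat_scheme \<Rightarrow> 'a \<Rightarrow> bool" where
  "iso C f \<longleftrightarrow> (\<exists>g. inverse_arrows C f g)"

text \<open>
  Functors and natural transformations are required to be \<^const>\<open>undefined\<close> off the carriers,
  so that HOL equality of functors (transformations) is equality on objects and arrows.
\<close>

record ('o, 'a, 'p, 'b) fctr =
  om :: "'o \<Rightarrow> 'p"
  am :: "'a \<Rightarrow> 'b"

definition mk_fctr ::
  "('o, 'a, 'e) cat_scheme \<Rightarrow> ('o \<Rightarrow> 'p) \<Rightarrow> ('a \<Rightarrow> 'b) \<Rightarrow> ('o, 'a, 'p, 'b) fctr" where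
  "mk_fctr C f g = \<lparr>om = restrict f (Ob C), am = restrict g (Ar C)\<rparr>"

definition is_functor ::
  "('o, 'a, 'e) cat_scheme \<Rightarrow> ('p, 'b, 'e2) cat_scheme \<Rightarrow> ('o, 'a, 'p, 'b) fctr \<Rightarrow> bool" where
  "is_functor C D F \<longleftrightarrow> category C \<and> category D \<and>
     om F \<in> Ob C \<rightarrow>\<^sub>E Ob D \<and> am F \<in> Ar C \<rightarrow>\<^sub>E Ar D \<and>
     (\<forall>f\<in>Ar C. am F f \<in> hom D (om F (Dom C f)) (om F (Cod C f))) \<and>
     (\<forall>x\<in>Ob C. am F (Idn C x) = Idn D (om F x)) \<and>
     (\<forall>f\<in>Ar C. \<forall>g\<in>Ar C. Cod C f = Dom C g \<longrightarrow>
        am F (Cmp C g f) = Cmp D (am F g) (am F f))"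

definition nat_trans ::
  "('o, 'a, 'e) cat_scheme \<Rightarrow> ('p, 'b, 'e2) cat_scheme \<Rightarrow>
   ('o, 'a, 'p, 'b) fctr \<Rightarrow> ('o, 'a, 'p, 'b) fctr \<Rightarrow> ('o \<Rightarrow> 'b) \<Rightarrow> bool" where
  "nat_trans C D F G t \<longleftrightarrow> is_functor C D F \<and> is_functor C D G \<and>
     t \<in> extensional (Ob C) \<and>
     (\<forall>x\<in>Ob C. t x \<in> hom D (om F x) (om G x)) \<and>
     (\<forall>f\<in>Ar C. Cmp D (t (Cod C f)) (am F f) = Cmp D (am G f) (t (Dom C f)))"

definition nat_iso ::
  "('o, 'a, 'e) cat_scheme \<Rightarrow> ('p, 'b, 'e2) cat_scheme \<Rightarrow>
   ('o, 'a, 'p, 'b) fctr \<Rightarrow> ('o, 'a, 'p, 'b) fctr \<Rightarrow> ('o \<Rightarrow> 'b) \<Rightarrow> bool" where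
  "nat_iso C D F G t \<longleftrightarrow> nat_trans C D F G t \<and> (\<forall>x\<in>Ob C. iso D (t x))"


lemma functor_ob: "is_functor C D F \<Longrightarrow> x \<in> Ob C \<Longrightarrow> om F x \<in> Ob D"
  by (auto simp: is_functor_def PiE_iff)

lemma functor_ar:
  assumes "is_functor C D F" "f \<in> Ar C"
  shows "am F f \<in> Ar D" "Dom D (am F f) = om F (Dom C f)" "Cod D (am F f) = om F (Cod C f)"
  using assms by (auto simp: is_functor_def hom_def)

lemma cat_ob:
  assumes "category C" "f \<in> Ar C"
  shows "Dom C f \<in> Ob C" "Cod C f \<in> Ob C"
  using assms by (auto simp: category_def)

lemma cat_idn:
  assumes "category C" "x \<in> Ob C"
  shows "Idn C x \<in> Ar C" "Dom C (Idn C x) = x" "Cod C (Idn C x) = x"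
  using assms by (auto simp: category_def hom_def)

lemma cat_cmp:
  assumes "category C" "f \<in> Ar C" "g \<in> Ar C" "Cod C f = Dom C g"
  shows "Cmp C g f \<in> Ar C" "Dom C (Cmp C g f) = Dom C f" "Cod C (Cmp C g f) = Cod C g"
  using assms by (auto simp: category_def hom_def)

lemma cat_unit:
  assumes "category C" "f \<in> Ar C"
  shows "Cmp C f (Idn C (Dom C f)) = f" "Cmp C (Idn C (Cod C f)) f = f"
  using assms by (auto simp: category_def)

lemma cat_assoc:
  assumes "category C" "f \<in> Ar C" "g \<in> Ar C" "h \<in> Ar C" "Cod C f = Dom C g" "Cod C g = Dom C h"
  shows "Cmp C h (Cmp C g f) = Cmp C (Cmp C h g) f"
  using assms by (auto simp: category_def)



section \<open>Constructions on categories\<close>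

definition prod_cat ::
  "('o, 'a, 'e) cat_scheme \<Rightarrow> ('p, 'b, 'e2) cat_scheme \<Rightarrow> ('o \<times> 'p, 'a \<times> 'b) cat" where
  "prod_cat C D =
     \<lparr>Ob = Ob C \<times> Ob D, Ar = Ar C \<times> Ar D,
      Dom = (\<lambda>(f, g). (Dom C f, Dom D g)), Cod = (\<lambda>(f, g). (Cod C f, Cod D g)),
      Idn = (\<lambda>(x, y). (Idn C x, Idn D y)),
      Cmp = (\<lambda>(f', g') (f, g). (Cmp C f' f, Cmp D g' g))\<rparr>"

definition power_cat :: "('o, 'a, 'e) cat_scheme \<Rightarrow> nat \<Rightarrow> ('o list, 'a list) cat" where
  "power_cat C n =
     \<lparr>Ob = {xs. length xs = n \<and> set xs \<subseteq> Ob C}, Ar = {fs. length fs = n \<and> set fs \<subseteq> Ar C},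
      Dom = map (Dom C), Cod = map (Cod C), Idn = map (Idn C), Cmp = map2 (Cmp C)\<rparr>"

text \<open>
  Restricting the family to the index set makes the record depend only on the members of
  the family indexed by \<open>I\<close>.
\<close>

definition coprod_cat ::
  "'i set \<Rightarrow> ('i \<Rightarrow> ('o, 'a, 'e) cat_scheme) \<Rightarrow> ('i \<times> 'o, 'i \<times> 'a) cat" where
  "coprod_cat I C0 = (let C = restrict C0 I in
     \<lparr>Ob = (SIGMA i:I. Ob (C i)), Ar = (SIGMA i:I. Ar (C i)),
      Dom = (\<lambda>(i, f). (i, Dom (C i) f)), Cod = (\<lambda>(i, f). (i, Cod (C i) f)),
      Idn = (\<lambda>(i, x). (i, Idn (C i) x)),
      Cmp = (\<lambda>(i, g) (j, f). (i, Cmp (C i) g f))\<rparr>)"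

definition indiscrete :: "'o set \<Rightarrow> ('o, 'o \<times> 'o) cat" where
  "indiscrete S =
     \<lparr>Ob = S, Ar = S \<times> S, Dom = fst, Cod = snd, Idn = (\<lambda>x. (x, x)),
      Cmp = (\<lambda>g f. (fst f, snd g))\<rparr>"

definition discrete :: "'o set \<Rightarrow> ('o, 'o \<times> 'o) cat" where
  "discrete S = (indiscrete S)\<lparr>Ar := (\<lambda>x. (x, x)) ` S\<rparr>"

definition functor_cat ::
  "('o, 'a, 'e) cat_scheme \<Rightarrow> ('p, 'b, 'e2) cat_scheme \<Rightarrow>
   (('o, 'a, 'p, 'b) fctr,
    ('o, 'a, 'p, 'b) fctr \<times> ('o, 'a, 'p, 'b) fctr \<times> ('o \<Rightarrow> 'b)) cat" where
  "functor_cat C D =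
     \<lparr>Ob = {F. is_functor C D F}, Ar = {(F, G, t). nat_trans C D F G t},
      Dom = (\<lambda>(F, G, t). F), Cod = (\<lambda>(F, G, t). G),
      Idn = (\<lambda>F. (F, F, \<lambda>x\<in>Ob C. Idn D (om F x))),
      Cmp = (\<lambda>(G', H, s) (F, G, t). (F, H, \<lambda>x\<in>Ob C. Cmp D (s x) (t x)))\<rparr>"

text \<open>Transport of a category along injections of its objects and arrows into other types.\<close>

definition relabel_cat ::
  "('o \<Rightarrow> 'p) \<Rightarrow> ('a \<Rightarrow> 'b) \<Rightarrow> ('o, 'a, 'e) cat_scheme \<Rightarrow> ('p, 'b) cat" where
  "relabel_cat p q C =
     \<lparr>Ob = p ` Ob C, Ar = q ` Ar C,
      Dom = (\<lambda>f. p (Dom C (inv q f))), Cod = (\<lambda>f. p (Cod C (inv q f))),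
      Idn = (\<lambda>x. q (Idn C (inv p x))),
      Cmp = (\<lambda>g f. q (Cmp C (inv q g) (inv q f)))\<rparr>"


section \<open>Pushouts of categories\<close>

text \<open>
  The pushout of \<open>X \<longleftarrow>I\<midarrow> Z \<midarrow>W\<longrightarrow> Y\<close>.  Its objects are the objects of \<open>X\<close> and \<open>Y\<close> modulo the
  equivalence generated by identifying \<open>I z\<close> with \<open>W z\<close>; its arrows are the composable words
  (in diagrammatic order) in the arrows of \<open>X\<close> and \<open>Y\<close>, modulo the congruence generated by the
  identities and composites of \<open>X\<close> and \<open>Y\<close> and by identifying \<open>I h\<close> with \<open>W h\<close>.
  A class is represented by a chosen member rather than by a set, so that the
  construction can be iterated inside a datatype.
\<close>

definition po_glue ::
  "('z, 'za) cat \<Rightarrow> ('z, 'za, 'x, 'xa) fctr \<Rightarrow> ('z, 'za, 'y, 'ya) fctr \<Rightarrow>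
   'x + 'y \<Rightarrow> 'x + 'y \<Rightarrow> bool" where
  "po_glue Z I W u v \<longleftrightarrow> (\<exists>z\<in>Ob Z. u = Inl (om I z) \<and> v = Inr (om W z))"

definition po_ob ::
  "('z, 'za) cat \<Rightarrow> ('z, 'za, 'x, 'xa) fctr \<Rightarrow> ('z, 'za, 'y, 'ya) fctr \<Rightarrow> 'x + 'y \<Rightarrow> 'x + 'y" where
  "po_ob Z I W u = (SOME v. equivclp (po_glue Z I W) u v)"

inductive po_path ::
  "('x, 'xa) cat \<Rightarrow> ('y, 'ya) cat \<Rightarrow> ('z, 'za) cat \<Rightarrow>
   ('z, 'za, 'x, 'xa) fctr \<Rightarrow> ('z, 'za, 'y, 'ya) fctr \<Rightarrow>
   'x + 'y \<Rightarrow> ('xa + 'ya) list \<Rightarrow> 'x + 'y \<Rightarrow> bool"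
  for X Y Z I W where
  Nil: "u \<in> Ob X <+> Ob Y \<Longrightarrow> po_path X Y Z I W (po_ob Z I W u) [] (po_ob Z I W u)"
| ConsX: "\<lbrakk>f \<in> Ar X; po_path X Y Z I W (po_ob Z I W (Inl (Cod X f))) es v\<rbrakk> \<Longrightarrow>
    po_path X Y Z I W (po_ob Z I W (Inl (Dom X f))) (Inl f # es) v"
| ConsY: "\<lbrakk>f \<in> Ar Y; po_path X Y Z I W (po_ob Z I W (Inr (Cod Y f))) es v\<rbrakk> \<Longrightarrow>
    po_path X Y Z I W (po_ob Z I W (Inr (Dom Y f))) (Inr f # es) v"

inductive po_rel ::
  "('x, 'xa) cat \<Rightarrow> ('y, 'ya) cat \<Rightarrow> ('z, 'za) cat \<Rightarrow>
   ('z, 'za, 'x, 'xa) fctr \<Rightarrow> ('z, 'za, 'y, 'ya) fctr \<Rightarrow>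
   ('xa + 'ya) list \<Rightarrow> ('xa + 'ya) list \<Rightarrow> bool"
  for X Y Z I W where
  idX: "x \<in> Ob X \<Longrightarrow> po_rel X Y Z I W [Inl (Idn X x)] []"
| idY: "y \<in> Ob Y \<Longrightarrow> po_rel X Y Z I W [Inr (Idn Y y)] []"
| cmpX: "\<lbrakk>f \<in> Ar X; g \<in> Ar X; Cod X f = Dom X g\<rbrakk> \<Longrightarrow>
    po_rel X Y Z I W [Inl f, Inl g] [Inl (Cmp X g f)]"
| cmpY: "\<lbrakk>f \<in> Ar Y; g \<in> Ar Y; Cod Y f = Dom Y g\<rbrakk> \<Longrightarrow>
    po_rel X Y Z I W [Inr f, Inr g] [Inr (Cmp Y g f)]"
| glue: "h \<in> Ar Z \<Longrightarrow> po_rel X Y Z I W [Inl (am I h)] [Inr (am W h)]"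

inductive po_step ::
  "('x, 'xa) cat \<Rightarrow> ('y, 'ya) cat \<Rightarrow> ('z, 'za) cat \<Rightarrow>
   ('z, 'za, 'x, 'xa) fctr \<Rightarrow> ('z, 'za, 'y, 'ya) fctr \<Rightarrow>
   ('x + 'y) \<times> ('xa + 'ya) list \<times> ('x + 'y) \<Rightarrow> ('x + 'y) \<times> ('xa + 'ya) list \<times> ('x + 'y) \<Rightarrow> bool"
  for X Y Z I W where
  "\<lbrakk>po_rel X Y Z I W es es';
    po_path X Y Z I W u (as @ es @ bs) v; po_path X Y Z I W u (as @ es' @ bs) v\<rbrakk> \<Longrightarrow>
   po_step X Y Z I W (u, as @ es @ bs, v) (u, as @ es' @ bs, v)"

definition po_ar ::
  "('x, 'xa) cat \<Rightarrow> ('y, 'ya) cat \<Rightarrow> ('z, 'za) cat \<Rightarrow>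
   ('z, 'za, 'x, 'xa) fctr \<Rightarrow> ('z, 'za, 'y, 'ya) fctr \<Rightarrow>
   ('x + 'y) \<times> ('xa + 'ya) list \<times> ('x + 'y) \<Rightarrow> ('x + 'y) \<times> ('xa + 'ya) list \<times> ('x + 'y)" where
  "po_ar X Y Z I W p = (SOME q. equivclp (po_step X Y Z I W) p q)"

definition pushout_cat ::
  "('x, 'xa) cat \<Rightarrow> ('y, 'ya) cat \<Rightarrow> ('z, 'za) cat \<Rightarrow>
   ('z, 'za, 'x, 'xa) fctr \<Rightarrow> ('z, 'za, 'y, 'ya) fctr \<Rightarrow>
   ('x + 'y, ('x + 'y) \<times> ('xa + 'ya) list \<times> ('x + 'y)) cat" where
  "pushout_cat X Y Z I W =
     \<lparr>Ob = po_ob Z I W ` (Ob X <+> Ob Y),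
      Ar = {po_ar X Y Z I W (u, es, v) | u es v. po_path X Y Z I W u es v},
      Dom = (\<lambda>(u, es, v). u), Cod = (\<lambda>(u, es, v). v),
      Idn = (\<lambda>u. po_ar X Y Z I W (u, [], u)),
      Cmp = (\<lambda>(v', es', w) (u, es, v). po_ar X Y Z I W (u, es @ es', w))\<rparr>"

definition po_inl ::
  "('x, 'xa) cat \<Rightarrow> ('y, 'ya) cat \<Rightarrow> ('z, 'za) cat \<Rightarrow>
   ('z, 'za, 'x, 'xa) fctr \<Rightarrow> ('z, 'za, 'y, 'ya) fctr \<Rightarrow>
   ('x, 'xa, 'x + 'y, ('x + 'y) \<times> ('xa + 'ya) list \<times> ('x + 'y)) fctr" where
  "po_inl X Y Z I W = mk_fctr X (\<lambda>x. po_ob Z I W (Inl x))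
     (\<lambda>f. po_ar X Y Z I W
        (po_ob Z I W (Inl (Dom X f)), [Inl f], po_ob Z I W (Inl (Cod X f))))"

definition po_inr ::
  "('x, 'xa) cat \<Rightarrow> ('y, 'ya) cat \<Rightarrow> ('z, 'za) cat \<Rightarrow>
   ('z, 'za, 'x, 'xa) fctr \<Rightarrow> ('z, 'za, 'y, 'ya) fctr \<Rightarrow>
   ('y, 'ya, 'x + 'y, ('x + 'y) \<times> ('xa + 'ya) list \<times> ('x + 'y)) fctr" where
  "po_inr X Y Z I W = mk_fctr Y (\<lambda>y. po_ob Z I W (Inr y))
     (\<lambda>f. po_ar X Y Z I W
        (po_ob Z I W (Inr (Dom Y f)), [Inr f], po_ob Z I W (Inr (Cod Y f))))"


text \<open>The construction has the universal property of the pushout.\<close>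

locale pushout_span =
  fixes X :: "('x, 'xa) cat" and Y :: "('y, 'ya) cat" and Z :: "('z, 'za) cat"
    and I :: "('z, 'za, 'x, 'xa) fctr" and W :: "('z, 'za, 'y, 'ya) fctr"
  assumes I: "is_functor Z X I" and W: "is_functor Z Y W"
begin

abbreviation "oeq \<equiv> equivclp (po_glue Z I W)"
abbreviation "ob \<equiv> po_ob Z I W"
abbreviation "path \<equiv> po_path X Y Z I W"
abbreviation "aeq \<equiv> equivclp (po_step X Y Z I W)"
abbreviation "ar \<equiv> po_ar X Y Z I W"
abbreviation "P \<equiv> pushout_cat X Y Z I W"
abbreviation "inl \<equiv> po_inl X Y Z I W"
abbreviation "inr \<equiv> po_inr X Y Z I W"

lemma cats: "category X" "category Y" "category Z"
  using I W by (auto simp: is_functor_def)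

lemma oeq_mem: "oeq u v \<Longrightarrow> u \<in> Ob X <+> Ob Y \<Longrightarrow> v \<in> Ob X <+> Ob Y"
  by (induction rule: equivclp_induct)
    (auto simp: po_glue_def functor_ob[OF I] functor_ob[OF W])

lemma oeq_ob: "oeq u (ob u)"
  unfolding po_ob_def by (rule someI[of _ u]) simp

lemma ob_eqI: "oeq u v \<Longrightarrow> ob u = ob v"
proof -
  assume "oeq u v"
  then have "oeq u = oeq v"
    by (metis equivp_def equivp_evquivclp)
  then show ?thesis by (simp add: po_ob_def)
qed

lemma ob_ob [simp]: "ob (ob u) = ob u"
  using ob_eqI[OF oeq_ob] by metis

lemma ob_mem: "u \<in> Ob X <+> Ob Y \<Longrightarrow> ob u \<in> Ob X <+> Ob Y"
  using oeq_mem[OF oeq_ob] .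

lemma ob_glue: "z \<in> Ob Z \<Longrightarrow> ob (Inl (om I z)) = ob (Inr (om W z))"
  by (rule ob_eqI, rule r_into_equivclp) (auto simp: po_glue_def)

lemma path_ends: "path u es v \<Longrightarrow> u \<in> ob ` (Ob X <+> Ob Y) \<and> v \<in> ob ` (Ob X <+> Ob Y)"
  by (induction rule: po_path.induct) (auto dest: cat_ob[OF cats(1)] cat_ob[OF cats(2)])

lemma path_nil: "u \<in> ob ` (Ob X <+> Ob Y) \<Longrightarrow> path u [] u"
  by (auto simp del: Plus_def intro: po_path.Nil)

lemma path_nilD: "path u [] v \<Longrightarrow> u = v"
  by (auto elim: po_path.cases)

lemma path_append: "path u (es @ fs) w \<longleftrightarrow> (\<exists>v. path u es v \<and> path v fs w)"
proof (induction es arbitrary: u)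
  case Nil
  then show ?case using path_nil path_nilD path_ends by (metis append_Nil)
next
  case (Cons e es)
  show ?case
  proof
    assume "path u ((e # es) @ fs) w"
    then show "\<exists>v. path u (e # es) v \<and> path v fs w"
      by cases (use Cons.IH in \<open>auto intro: po_path.intros\<close>)
  next
    assume "\<exists>v. path u (e # es) v \<and> path v fs w"
    then obtain v where v: "path u (e # es) v" "path v fs w" by blast
    from v(1) show "path u ((e # es) @ fs) w"
      by cases (use Cons.IH v(2) in \<open>auto intro: po_path.intros\<close>)
  qed
qed

lemma path_inl: "f \<in> Ar X \<Longrightarrow> path (ob (Inl (Dom X f))) [Inl f] (ob (Inl (Cod X f)))"
  by (intro po_path.ConsX po_path.Nil) (auto dest: cat_ob[OF cats(1)])

lemma path_inr: "f \<in> Ar Y \<Longrightarrow> path (ob (Inr (Dom Y f))) [Inr f] (ob (Inr (Cod Y f)))"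
  by (intro po_path.ConsY po_path.Nil) (auto dest: cat_ob[OF cats(2)])

lemma aeq_path:
  "aeq p q \<Longrightarrow> p = (u, es, v) \<Longrightarrow> path u es v \<Longrightarrow> \<exists>es'. q = (u, es', v) \<and> path u es' v"
  by (induction rule: equivclp_induct) (auto elim!: po_step.cases)

lemma step_ends: "po_step X Y Z I W p q \<Longrightarrow> fst q = fst p \<and> snd (snd q) = snd (snd p)"
  by (erule po_step.cases) simp

lemma aeq_append:
  assumes "aeq p q" "p = (u, es, v)" "path u es v" "path t as u" "path v bs w"
  shows "\<exists>es'. q = (u, es', v) \<and> aeq (t, as @ es @ bs, w) (t, as @ es' @ bs, w)"
  using assms
proof (induction rule: equivclp_induct)
  case base
  then show ?case by simp
next
  case (step q r)
  then obtain es' where q: "q = (u, es', v)" "aeq (t, as @ es @ bs, w) (t, as @ es' @ bs, w)"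
    by blast
  have aux: "po_step X Y Z I W (t, as @ a @ bs, w) (t, as @ b @ bs, w)"
    if "po_step X Y Z I W (u, a, v) (u, b, v)" for a b
    using that
  proof cases
    case (1 c d as' bs')
    have m: "path t (as @ x @ bs) w" if "path u x v" for x
      unfolding path_append using that step.prems(3,4) by blast
    have "po_step X Y Z I W (t, (as @ as') @ c @ (bs' @ bs), w) (t, (as @ as') @ d @ (bs' @ bs), w)"
      using m[OF 1(4)] m[OF 1(5)] by (intro po_step.intros[OF 1(3)]) simp_all
    then show ?thesis by (simp add: 1(1,2))
  qed
  have r: "r = (u, fst (snd r), v)"
    using step.hyps(2) q(1) step_ends[of q r] step_ends[of r q] by (auto simp: prod_eq_iff)
  define b where "b = fst (snd r)"
  then have r: "r = (u, b, v)" using r by simp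
  have "po_step X Y Z I W (u, es', v) (u, b, v) \<or> po_step X Y Z I W (u, b, v) (u, es', v)"
    using step.hyps(2) unfolding q(1) r .
  then have "aeq (t, as @ es' @ bs, w) (t, as @ b @ bs, w)"
    using aux by (meson r_into_equivclp equivclp_sym)
  then have "aeq (t, as @ es @ bs, w) (t, as @ b @ bs, w)"
    by (rule equivclp_trans[OF q(2)])
  then show ?case using r by blast
qed

lemma aeq_ar: "aeq p (ar p)"
  unfolding po_ar_def by (rule someI[of _ p]) simp

lemma ar_eqI: "aeq p q \<Longrightarrow> ar p = ar q"
proof -
  assume "aeq p q"
  then have "aeq p = aeq q"
    by (metis equivp_def equivp_evquivclp)
  then show ?thesis by (simp add: po_ar_def)
qed

lemma ar_rep:
  assumes "path u es v"
  obtains es' where "ar (u, es, v) = (u, es', v)" "path u es' v" "aeq (u, es, v) (u, es', v)"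
  using aeq_path[OF aeq_ar refl assms] aeq_ar by metis

lemma ar_ar: "path u es v \<Longrightarrow> ar (ar (u, es, v)) = ar (u, es, v)"
  using ar_eqI[OF aeq_ar] by metis

lemma Ar_P: "Ar P = {ar (u, es, v) | u es v. path u es v}"
  and Ob_P: "Ob P = ob ` (Ob X <+> Ob Y)"
  and Idn_P: "Idn P u = ar (u, [], u)"
  by (simp_all add: pushout_cat_def)

lemma Ar_PE:
  assumes "f \<in> Ar P"
  obtains u es v where "f = ar (u, es, v)" "path u es v"
  using assms by (auto simp: Ar_P)

lemma Dom_P: "path u es v \<Longrightarrow> Dom P (ar (u, es, v)) = u"
  and Cod_P: "path u es v \<Longrightarrow> Cod P (ar (u, es, v)) = v"
  by (erule ar_rep; simp add: pushout_cat_def)+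

lemma Cmp_P:
  assumes "path u es v" "path v fs w"
  shows "Cmp P (ar (v, fs, w)) (ar (u, es, v)) = ar (u, es @ fs, w)"
proof -
  obtain es' where e: "ar (u, es, v) = (u, es', v)" "path u es' v" "aeq (u, es, v) (u, es', v)"
    using assms(1) by (rule ar_rep)
  obtain fs' where f: "ar (v, fs, w) = (v, fs', w)" "path v fs' w" "aeq (v, fs, w) (v, fs', w)"
    using assms(2) by (rule ar_rep)
  have n: "path u [] u" "path w [] w"
    using assms by (auto dest: path_ends intro: path_nil)
  have "aeq (u, es @ fs, w) (u, es' @ fs, w)"
    using aeq_append[OF e(3) refl assms(1) n(1) assms(2)] by simp
  moreover have "aeq (u, es' @ fs, w) (u, es' @ fs', w)"
    using aeq_append[OF f(3) refl assms(2) e(2) n(2)] by simp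
  ultimately have "ar (u, es @ fs, w) = ar (u, es' @ fs', w)"
    by (intro ar_eqI) (rule equivclp_trans)
  then show ?thesis
    using e f by (simp add: pushout_cat_def)
qed

lemma category_P: "category P"
  unfolding category_def hom_def
proof (intro conjI ballI impI)
  show "Dom P f \<in> Ob P" "Cod P f \<in> Ob P" if "f \<in> Ar P" for f
    using that path_ends by (auto elim!: Ar_PE simp: Dom_P Cod_P Ob_P)
  show "Idn P x \<in> {f \<in> Ar P. Dom P f = x \<and> Cod P f = x}" if "x \<in> Ob P" for x
  proof -
    have "path x [] x" using that by (intro path_nil) (simp add: Ob_P)
    then show ?thesis by (auto simp: Idn_P Dom_P Cod_P Ar_P)
  qed
next
  fix f g assume "f \<in> Ar P" "g \<in> Ar P" and fg: "Cod P f = Dom P g"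
  then obtain u es v v' fs w where f: "f = ar (u, es, v)" "path u es v"
    and g: "g = ar (v', fs, w)" "path v' fs w" by (elim Ar_PE)
  then have [simp]: "v' = v" using fg by (simp add: Dom_P Cod_P)
  have "path u (es @ fs) w" using f g by (auto simp: path_append)
  then show "Cmp P g f \<in> {h \<in> Ar P. Dom P h = Dom P f \<and> Cod P h = Cod P g}"
    using f g by (auto simp: Cmp_P Dom_P Cod_P Ar_P)
next
  fix f assume "f \<in> Ar P"
  then obtain u es v where f: "f = ar (u, es, v)" "path u es v" by (elim Ar_PE)
  have n: "path u [] u" "path v [] v"
    using f by (auto dest: path_ends intro: path_nil)
  show "Cmp P f (Idn P (Dom P f)) = f" "Cmp P (Idn P (Cod P f)) f = f"
    using f n Cmp_P[OF n(1) f(2)] Cmp_P[OF f(2) n(2)] by (simp_all add: Dom_P Cod_P Idn_P)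
next
  fix f g h assume "f \<in> Ar P" "g \<in> Ar P" "h \<in> Ar P"
    and fg: "Cod P f = Dom P g" and gh: "Cod P g = Dom P h"
  then obtain u es v v' fs w w' gs t where f: "f = ar (u, es, v)" "path u es v"
    and g: "g = ar (v', fs, w)" "path v' fs w"
    and h: "h = ar (w', gs, t)" "path w' gs t" by (elim Ar_PE)
  then have [simp]: "v' = v" "w' = w" using fg gh by (simp_all add: Dom_P Cod_P)
  have "path u (es @ fs) w" "path v (fs @ gs) t" using f g h by (auto simp: path_append)
  then show "Cmp P h (Cmp P g f) = Cmp P (Cmp P h g) f"
    using f g h by (simp add: Cmp_P)
qed

lemma step_ar:
  assumes "po_rel X Y Z I W es es'" "path u es v" "path u es' v"
  shows "ar (u, es, v) = ar (u, es', v)"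
  using po_step.intros[of X Y Z I W es es' u "[]" "[]" v] assms
  by (intro ar_eqI r_into_equivclp) simp

lemma om_inl: "x \<in> Ob X \<Longrightarrow> om inl x = ob (Inl x)"
  and am_inl: "f \<in> Ar X \<Longrightarrow> am inl f = ar (ob (Inl (Dom X f)), [Inl f], ob (Inl (Cod X f)))"
  and om_inr: "y \<in> Ob Y \<Longrightarrow> om inr y = ob (Inr y)"
  and am_inr: "g \<in> Ar Y \<Longrightarrow> am inr g = ar (ob (Inr (Dom Y g)), [Inr g], ob (Inr (Cod Y g)))"
  by (simp_all add: po_inl_def po_inr_def mk_fctr_def)

lemma functor_inl: "is_functor X P inl"
  unfolding is_functor_def
proof (intro conjI ballI impI)
  have ar: "am inl f \<in> hom P (om inl (Dom X f)) (om inl (Cod X f))" if "f \<in> Ar X" for f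
    using path_inl[OF that] that cat_ob[OF cats(1) that]
    by (auto simp: hom_def om_inl am_inl Ar_P Dom_P Cod_P)
  then show "am inl f \<in> hom P (om inl (Dom X f)) (om inl (Cod X f))" if "f \<in> Ar X" for f
    using that .
  show "am inl \<in> Ar X \<rightarrow>\<^sub>E Ar P"
    using ar by (auto simp: hom_def) (simp add: po_inl_def mk_fctr_def)
  show "om inl \<in> Ob X \<rightarrow>\<^sub>E Ob P"
    by (auto simp: om_inl Ob_P) (simp add: po_inl_def mk_fctr_def)
  show "am inl (Idn X x) = Idn P (om inl x)" if x: "x \<in> Ob X" for x
    using step_ar[OF po_rel.idX[OF x], of "ob (Inl x)" "ob (Inl x)"]
      path_inl[OF cat_idn(1)[OF cats(1) x]] path_nil[of "ob (Inl x)"] x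
    by (auto simp: am_inl om_inl cat_idn[OF cats(1) x] Idn_P)
  show "am inl (Cmp X g f) = Cmp P (am inl g) (am inl f)"
    if "f \<in> Ar X" "g \<in> Ar X" "Cod X f = Dom X g" for f g
  proof -
    note c = cat_cmp[OF cats(1) that]
    have p: "path (ob (Inl (Dom X f))) [Inl f, Inl g] (ob (Inl (Cod X g)))"
      using path_inl[OF that(1)] path_inl[OF that(2)] that(3)
        path_append[of _ "[Inl f]" "[Inl g]"] by auto
    show ?thesis
      using step_ar[OF po_rel.cmpX[OF that] p] path_inl[OF c(1)] c
        Cmp_P[OF path_inl[OF that(1)], of "[Inl g]" "ob (Inl (Cod X g))"]
        path_inl[OF that(2)] that
      by (simp add: am_inl)
  qed
qed (use cats category_P in auto)

lemma functor_inr: "is_functor Y P inr"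
  unfolding is_functor_def
proof (intro conjI ballI impI)
  have ar: "am inr f \<in> hom P (om inr (Dom Y f)) (om inr (Cod Y f))" if "f \<in> Ar Y" for f
    using path_inr[OF that] that cat_ob[OF cats(2) that]
    by (auto simp: hom_def om_inr am_inr Ar_P Dom_P Cod_P)
  then show "am inr f \<in> hom P (om inr (Dom Y f)) (om inr (Cod Y f))" if "f \<in> Ar Y" for f
    using that .
  show "am inr \<in> Ar Y \<rightarrow>\<^sub>E Ar P"
    using ar by (auto simp: hom_def) (simp add: po_inr_def mk_fctr_def)
  show "om inr \<in> Ob Y \<rightarrow>\<^sub>E Ob P"
    by (auto simp: om_inr Ob_P) (simp add: po_inr_def mk_fctr_def)
  show "am inr (Idn Y x) = Idn P (om inr x)" if x: "x \<in> Ob Y" for x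
    using step_ar[OF po_rel.idY[OF x], of "ob (Inr x)" "ob (Inr x)"]
      path_inr[OF cat_idn(1)[OF cats(2) x]] path_nil[of "ob (Inr x)"] x
    by (auto simp: am_inr om_inr cat_idn[OF cats(2) x] Idn_P)
  show "am inr (Cmp Y g f) = Cmp P (am inr g) (am inr f)"
    if "f \<in> Ar Y" "g \<in> Ar Y" "Cod Y f = Dom Y g" for f g
  proof -
    note c = cat_cmp[OF cats(2) that]
    have p: "path (ob (Inr (Dom Y f))) [Inr f, Inr g] (ob (Inr (Cod Y g)))"
      using path_inr[OF that(1)] path_inr[OF that(2)] that(3)
        path_append[of _ "[Inr f]" "[Inr g]"] by auto
    show ?thesis
      using step_ar[OF po_rel.cmpY[OF that] p] path_inr[OF c(1)] c
        Cmp_P[OF path_inr[OF that(1)], of "[Inr g]" "ob (Inr (Cod Y g))"]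
        path_inr[OF that(2)] that
      by (simp add: am_inr)
  qed
qed (use cats category_P in auto)

lemma commutes_ob: "z \<in> Ob Z \<Longrightarrow> om inl (om I z) = om inr (om W z)"
  by (simp add: om_inl om_inr functor_ob[OF I] functor_ob[OF W] ob_glue)

lemma commutes_ar:
  assumes h: "h \<in> Ar Z"
  shows "am inl (am I h) = am inr (am W h)"
proof -
  note i = functor_ar[OF I h] and w = functor_ar[OF W h] and d = cat_ob[OF cats(3) h]
  show ?thesis
    using step_ar[OF po_rel.glue[OF h] path_inl[OF i(1)]] path_inr[OF w(1)]
    by (simp add: am_inl am_inr i w ob_glue d)
qed

lemma universal:
  fixes T :: "('t, 'ta) cat"
  assumes F: "is_functor X T F" and G: "is_functor Y T G"
    and ob_agree: "\<And>z. z \<in> Ob Z \<Longrightarrow> om F (om I z) = om G (om W z)"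
    and ar_agree: "\<And>h. h \<in> Ar Z \<Longrightarrow> am F (am I h) = am G (am W h)"
  shows "\<exists>!H. is_functor P T H \<and>
    (\<forall>x\<in>Ob X. om H (om inl x) = om F x) \<and> (\<forall>f\<in>Ar X. am H (am inl f) = am F f) \<and>
    (\<forall>y\<in>Ob Y. om H (om inr y) = om G y) \<and> (\<forall>g\<in>Ar Y. am H (am inr g) = am G g)"
proof -
  have T: "category T" using F by (simp add: is_functor_def)
  define k where "k = case_sum (om F) (om G)"
  define ke where "ke = case_sum (am F) (am G)"
  define ev where "ev v es = foldr (\<lambda>e t. Cmp T t (ke e)) es (Idn T (k v))" for v es
  have ev_simps: "ev v [] = Idn T (k v)" "ev v (e # es) = Cmp T (ev v es) (ke e)" for v e es
    by (simp_all add: ev_def)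
  have k_oeq: "oeq u v \<Longrightarrow> k u = k v" for u v
    by (induction rule: equivclp_induct) (auto simp: po_glue_def k_def ob_agree)
  then have k_ob: "k (ob u) = k u" for u
    using oeq_ob by metis
  have k_mem: "u \<in> Ob X <+> Ob Y \<Longrightarrow> k u \<in> Ob T" for u
    by (auto simp: k_def functor_ob[OF F] functor_ob[OF G])
  have k_mem': "u \<in> ob ` (Ob X <+> Ob Y) \<Longrightarrow> k u \<in> Ob T" for u
    using k_mem k_ob by (metis imageE)
  have kl: "ke (Inl f) \<in> Ar T" "Dom T (ke (Inl f)) = k (Inl (Dom X f))"
    "Cod T (ke (Inl f)) = k (Inl (Cod X f))" if "f \<in> Ar X" for f
    using functor_ar[OF F that] by (simp_all add: k_def ke_def)
  have kr: "ke (Inr f) \<in> Ar T" "Dom T (ke (Inr f)) = k (Inr (Dom Y f))"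
    "Cod T (ke (Inr f)) = k (Inr (Cod Y f))" if "f \<in> Ar Y" for f
    using functor_ar[OF G that] by (simp_all add: k_def ke_def)
  have ev_hom: "path u es v \<Longrightarrow> ev v es \<in> hom T (k u) (k v)" for u es v
  proof (induction rule: po_path.induct)
    case (Nil u)
    then show ?case using cat_idn[OF T k_mem[OF Nil]] by (simp add: ev_simps k_ob hom_def)
  next
    case (ConsX f es v)
    then show ?case using cat_cmp[OF T kl(1)[OF ConsX(1)], of "ev v es"] kl[OF ConsX(1)]
      by (auto simp: ev_simps k_ob hom_def)
  next
    case (ConsY f es v)
    then show ?case using cat_cmp[OF T kr(1)[OF ConsY(1)], of "ev v es"] kr[OF ConsY(1)]
      by (auto simp: ev_simps k_ob hom_def)
  qed
  have ev_append: "path u es v \<Longrightarrow> path v fs w \<Longrightarrow> ev w (es @ fs) = Cmp T (ev w fs) (ev v es)"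
    for u es v fs w
  proof (induction rule: po_path.induct)
    case (Nil u)
    then show ?case using ev_hom[OF Nil(2)] cat_unit(1)[OF T, of "ev w fs"]
      by (simp add: ev_simps k_ob hom_def)
  next
    case (ConsX f es v)
    then show ?case
      using ev_hom[OF ConsX(4)] ev_hom[OF ConsX(2)] kl[OF ConsX(1)]
        cat_assoc[OF T kl(1)[OF ConsX(1)], of "ev v es" "ev w fs"]
      by (simp add: ev_simps k_ob hom_def)
  next
    case (ConsY f es v)
    then show ?case
      using ev_hom[OF ConsY(4)] ev_hom[OF ConsY(2)] kr[OF ConsY(1)]
        cat_assoc[OF T kr(1)[OF ConsY(1)], of "ev v es" "ev w fs"]
      by (simp add: ev_simps k_ob hom_def)
  qed
  have ev_one: "e \<in> Ar X <+> Ar Y \<Longrightarrow> path u [e] v \<Longrightarrow> ev v [e] = ke e" for u e v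
  proof -
    assume e: "e \<in> Ar X <+> Ar Y" and p: "path u [e] v"
    have "k v = Cod T (ke e)"
      using p by (auto elim!: po_path.cases[of _ _ _ _ _ u "[e]"] dest!: path_nilD simp: kl kr k_ob)
    moreover have "ke e \<in> Ar T" using e kl kr by auto
    ultimately show ?thesis using cat_unit(2)[OF T] by (simp add: ev_simps)
  qed
  have path_mem: "path u es v \<Longrightarrow> set es \<subseteq> Ar X <+> Ar Y" for u es v
    by (induction rule: po_path.induct) auto
  have ev_rel: "ev v es = ev v es'" if r: "po_rel X Y Z I W es es'" and p: "path u es v" "path u es' v"
    for u v es es'
    using r
  proof cases
    case (idX x)
    have "ke (Inl (Idn X x)) = Idn T (k (Inl x))"
      using F idX(3) by (simp add: is_functor_def ke_def k_def)
    moreover have "k v = k (Inl x)"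
      using p(1) idX cat_idn[OF cats(1) idX(3)]
      by (auto elim!: po_path.cases[of _ _ _ _ _ u "[_]"] dest!: path_nilD simp: k_ob)
    moreover have "Inl (Idn X x) \<in> Ar X <+> Ar Y" using cat_idn[OF cats(1) idX(3)] by auto
    ultimately show ?thesis using ev_one p idX by (metis ev_simps(1))
  next
    case (idY y)
    have "ke (Inr (Idn Y y)) = Idn T (k (Inr y))"
      using G idY(3) by (simp add: is_functor_def ke_def k_def)
    moreover have "k v = k (Inr y)"
      using p(1) idY cat_idn[OF cats(2) idY(3)]
      by (auto elim!: po_path.cases[of _ _ _ _ _ u "[_]"] dest!: path_nilD simp: k_ob)
    moreover have "Inr (Idn Y y) \<in> Ar X <+> Ar Y" using cat_idn[OF cats(2) idY(3)] by auto
    ultimately show ?thesis using ev_one p idY by (metis ev_simps(1))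
  next
    case (cmpX f g)
    obtain w where w: "path u [Inl f] w" "path w [Inl g] v"
      using p(1) cmpX path_append[of u "[Inl f]" "[Inl g]" v] by auto
    have "ev v [Inl f, Inl g] = Cmp T (ke (Inl g)) (ke (Inl f))"
      using ev_append[OF w] ev_one w cmpX by (metis append.simps InlI)
    moreover have "\<dots> = ke (Inl (Cmp X g f))"
      using F cmpX by (simp add: is_functor_def ke_def)
    moreover have "Inl (Cmp X g f) \<in> Ar X <+> Ar Y" using cat_cmp(1)[OF cats(1)] cmpX by auto
    ultimately show ?thesis using ev_one p cmpX by metis
  next
    case (cmpY f g)
    obtain w where w: "path u [Inr f] w" "path w [Inr g] v"
      using p(1) cmpY path_append[of u "[Inr f]" "[Inr g]" v] by auto
    have "ev v [Inr f, Inr g] = Cmp T (ke (Inr g)) (ke (Inr f))"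
      using ev_append[OF w] ev_one w cmpY by (metis append.simps InrI)
    moreover have "\<dots> = ke (Inr (Cmp Y g f))"
      using G cmpY by (simp add: is_functor_def ke_def)
    moreover have "Inr (Cmp Y g f) \<in> Ar X <+> Ar Y" using cat_cmp(1)[OF cats(2)] cmpY by auto
    ultimately show ?thesis using ev_one p cmpY by metis
  next
    case (glue h)
    have "ke (Inl (am I h)) = ke (Inr (am W h))"
      using ar_agree[OF glue(3)] by (simp add: ke_def)
    moreover have "Inl (am I h) \<in> Ar X <+> Ar Y" "Inr (am W h) \<in> Ar X <+> Ar Y"
      using functor_ar(1)[OF I glue(3)] functor_ar(1)[OF W glue(3)] by auto
    ultimately show ?thesis using ev_one p glue by metis
  qed
  have ev_step: "ev v es = ev v es'" if "po_step X Y Z I W (u, es, v) (u', es', v')" for u es v u' es' v'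
    using that
  proof cases
    case (1 a b as bs)
    obtain m n where p: "path u as m" "path m a n" "path n bs v"
      using 1 by (auto simp: path_append)
    obtain m' n' where p': "path u as m'" "path m' b n'" "path n' bs v"
      using 1 by (auto simp: path_append)
    have det: "path s es t \<Longrightarrow> path s es t' \<Longrightarrow> t = t'" for s es t t'
    proof (induction arbitrary: t' rule: po_path.induct)
      case (Nil u) then show ?case by (auto dest: path_nilD)
    next
      case (ConsX f es v) show ?case using ConsX(4) by cases (auto intro: ConsX.IH)
    next
      case (ConsY f es v) show ?case using ConsY(4) by cases (auto intro: ConsY.IH)
    qed
    have codet: "path s es t \<Longrightarrow> path s' es t \<Longrightarrow> s = s'" for s s' es t
    proof (induction arbitrary: s' rule: po_path.induct)
      case (Nil u) then show ?case by (auto dest: path_nilD)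
    next
      case (ConsX f es v) show ?case using ConsX(4) by cases auto
    next
      case (ConsY f es v) show ?case using ConsY(4) by cases auto
    qed
    have [simp]: "m' = m" "n' = n" using det[OF p(1) p'(1)] codet[OF p(3) p'(3)] by auto
    have "ev n a = ev n b" using ev_rel 1(5) p p' by auto
    then have "ev v (a @ bs) = ev v (b @ bs)"
      using ev_append[OF p(2,3)] ev_append[OF p'(2)] p'(3) by simp
    moreover have "path m (a @ bs) v" "path m (b @ bs) v" using p p' by (auto simp: path_append)
    ultimately show ?thesis using ev_append[OF p(1)] 1 by metis
  qed
  have ev_step': "ev (snd (snd p)) (fst (snd p)) = ev (snd (snd q)) (fst (snd q))"
    if "po_step X Y Z I W p q" for p q
  proof -
    obtain u a v u' b v' where pq: "p = (u, a, v)" "q = (u', b, v')"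
      by (metis prod.exhaust)
    then show ?thesis
      using ev_step[OF that[unfolded pq]] step_ends[OF that] by simp
  qed
  have ev_aeq: "aeq p q \<Longrightarrow> ev (snd (snd q)) (fst (snd q)) = ev (snd (snd p)) (fst (snd p))" for p q
    by (induction rule: equivclp_induct) (simp, metis ev_step')
  define H where "H = mk_fctr P k (\<lambda>(u, es, v). ev v es)"
  have om_H: "om H u = k u" if "u \<in> Ob P" for u
    using that by (simp add: H_def mk_fctr_def)
  have am_H: "am H (ar (u, es, v)) = ev v es" if "path u es v" for u es v
    using ev_aeq[OF aeq_ar[of "(u, es, v)"]] that
    by (auto simp: H_def mk_fctr_def Ar_P split_beta)
  have ends: "u \<in> Ob P" "v \<in> Ob P" if "path u es v" for u es v
    using path_ends[OF that] by (auto simp: Ob_P)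
  have HF: "is_functor P T H"
    unfolding is_functor_def
  proof (intro conjI ballI impI)
    show "om H \<in> Ob P \<rightarrow>\<^sub>E Ob T"
      using k_mem' by (auto simp: om_H Ob_P simp del: Plus_def) (auto simp: H_def mk_fctr_def Ob_P)
    show hm: "am H f \<in> hom T (om H (Dom P f)) (om H (Cod P f))" if "f \<in> Ar P" for f
      using that
    proof (rule Ar_PE)
      fix u es v assume f: "f = ar (u, es, v)" "path u es v"
      then show ?thesis using ev_hom[OF f(2)] ends[OF f(2)] by (simp add: am_H Dom_P Cod_P om_H)
    qed
    show "am H \<in> Ar P \<rightarrow>\<^sub>E Ar T"
      using hm by (auto simp: hom_def) (simp add: H_def mk_fctr_def)
    show "am H (Idn P x) = Idn T (om H x)" if "x \<in> Ob P" for x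
    proof -
      have "path x [] x" using that by (intro path_nil) (simp add: Ob_P)
      then show ?thesis using that by (simp add: Idn_P am_H om_H ev_simps)
    qed
    show "am H (Cmp P g f) = Cmp T (am H g) (am H f)"
      if fg: "f \<in> Ar P" "g \<in> Ar P" "Cod P f = Dom P g" for f g
    proof -
      obtain u es v v' fs w where f: "f = ar (u, es, v)" "path u es v"
        and g: "g = ar (v', fs, w)" "path v' fs w" using fg by (elim Ar_PE)
      then have [simp]: "v' = v" using fg(3) by (simp add: Dom_P Cod_P)
      have "path u (es @ fs) w" using f g by (auto simp: path_append)
      then show ?thesis using f g ev_append[OF f(2)] by (simp add: Cmp_P am_H)
    qed
  qed (use T category_P in auto)
  have Hl: "om H (om inl x) = om F x" if "x \<in> Ob X" for x
    using that om_H[of "ob (Inl x)"] InlI[OF that, THEN imageI, of ob]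
    by (simp add: om_inl k_ob Ob_P) (simp add: k_def)
  have Hr: "om H (om inr x) = om G x" if "x \<in> Ob Y" for x
    using that om_H[of "ob (Inr x)"] InrI[OF that, THEN imageI, of ob]
    by (simp add: om_inr k_ob Ob_P) (simp add: k_def)
  have Hal: "am H (am inl f) = am F f" if "f \<in> Ar X" for f
    using that ev_one[OF _ path_inl[OF that]] by (simp add: am_inl am_H path_inl InlI) (simp add: ke_def)
  have Har: "am H (am inr f) = am G f" if "f \<in> Ar Y" for f
    using that ev_one[OF _ path_inr[OF that]] by (simp add: am_inr am_H path_inr InrI) (simp add: ke_def)
  show ?thesis
  proof (rule ex1I[of _ H])
    show "is_functor P T H \<and>
      (\<forall>x\<in>Ob X. om H (om inl x) = om F x) \<and> (\<forall>f\<in>Ar X. am H (am inl f) = am F f) \<and>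
      (\<forall>y\<in>Ob Y. om H (om inr y) = om G y) \<and> (\<forall>g\<in>Ar Y. am H (am inr g) = am G g)"
      using HF Hl Hr Hal Har by blast
  next
    fix K assume "is_functor P T K \<and>
      (\<forall>x\<in>Ob X. om K (om inl x) = om F x) \<and> (\<forall>f\<in>Ar X. am K (am inl f) = am F f) \<and>
      (\<forall>y\<in>Ob Y. om K (om inr y) = om G y) \<and> (\<forall>g\<in>Ar Y. am K (am inr g) = am G g)"
    then have K: "is_functor P T K"
      and kx: "\<And>x. x \<in> Ob X \<Longrightarrow> om K (om inl x) = om F x" "\<And>f. f \<in> Ar X \<Longrightarrow> am K (am inl f) = am F f"
      and ky: "\<And>y. y \<in> Ob Y \<Longrightarrow> om K (om inr y) = om G y" "\<And>g. g \<in> Ar Y \<Longrightarrow> am K (am inr g) = am G g"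
      by auto
    have ob: "om K u = om H u" if "u \<in> Ob P" for u
      using that by (auto simp: Ob_P kx(1) ky(1) Hl Hr simp flip: om_inl om_inr)
    have ar: "path u es v \<Longrightarrow> am K (ar (u, es, v)) = am H (ar (u, es, v))" for u es v
    proof (induction rule: po_path.induct)
      case (Nil u)
      then have "ob u \<in> Ob P" by (simp add: Ob_P)
      then have "am K (Idn P (ob u)) = am H (Idn P (ob u))"
        using K HF ob by (simp add: is_functor_def)
      then show ?case by (simp add: Idn_P)
    next
      case (ConsX f es v)
      note p = path_inl[OF ConsX(1)]
      have c: "Inl f # es = [Inl f] @ es" by simp
      have a: "ar (ob (Inl (Dom X f)), [Inl f], ob (Inl (Cod X f))) \<in> Ar P"
        "ar (ob (Inl (Cod X f)), es, v) \<in> Ar P" using p ConsX(2) by (auto simp: Ar_P)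
      show ?case
        unfolding c Cmp_P[OF p ConsX(2), symmetric]
        using a K HF ConsX kx(2)[OF ConsX(1)] Hal[OF ConsX(1)] p
        by (simp add: is_functor_def am_inl Dom_P Cod_P)
    next
      case (ConsY f es v)
      note p = path_inr[OF ConsY(1)]
      have c: "Inr f # es = [Inr f] @ es" by simp
      have a: "ar (ob (Inr (Dom Y f)), [Inr f], ob (Inr (Cod Y f))) \<in> Ar P"
        "ar (ob (Inr (Cod Y f)), es, v) \<in> Ar P" using p ConsY(2) by (auto simp: Ar_P)
      show ?case
        unfolding c Cmp_P[OF p ConsY(2), symmetric]
        using a K HF ConsY ky(2)[OF ConsY(1)] Har[OF ConsY(1)] p
        by (simp add: is_functor_def am_inr Dom_P Cod_P)
    qed
    have "om K = om H"
      by (rule extensionalityI[of _ "Ob P"]) (use K HF ob in \<open>auto simp: is_functor_def PiE_def\<close>)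
    moreover have "am K = am H"
      by (rule extensionalityI[of _ "Ar P"])
        (use K HF ar in \<open>auto simp: is_functor_def PiE_def elim!: Ar_PE\<close>)
    ultimately show "K = H" by simp
  qed
qed

end


section \<open>Associative categories\<close>

record ('o, 'a) acat = "('o, 'a) cat" +
  tensor :: "('o \<times> 'o, 'a \<times> 'a, 'o, 'a) fctr"
  asc :: "'o \<times> 'o \<times> 'o \<Rightarrow> 'a"

definition tensor_r ::
  "('o, 'a) acat \<Rightarrow> ('o \<times> 'o \<times> 'o, 'a \<times> 'a \<times> 'a, 'o, 'a) fctr" where
  "tensor_r B = mk_fctr (prod_cat B (prod_cat B B))
     (\<lambda>(x, y, z). om (tensor B) (x, om (tensor B) (y, z)))
     (\<lambda>(f, g, h). am (tensor B) (f, am (tensor B) (g, h)))"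

definition tensor_l ::
  "('o, 'a) acat \<Rightarrow> ('o \<times> 'o \<times> 'o, 'a \<times> 'a \<times> 'a, 'o, 'a) fctr" where
  "tensor_l B = mk_fctr (prod_cat B (prod_cat B B))
     (\<lambda>(x, y, z). om (tensor B) (om (tensor B) (x, y), z))
     (\<lambda>(f, g, h). am (tensor B) (am (tensor B) (f, g), h))"

definition associative_category :: "('o, 'a) acat \<Rightarrow> bool" where
  "associative_category B \<longleftrightarrow> category B \<and>
     is_functor (prod_cat B B) B (tensor B) \<and>
     nat_iso (prod_cat B (prod_cat B B)) B (tensor_r B) (tensor_l B) (asc B)"

definition strict_tensor_functor ::
  "('o, 'a) acat \<Rightarrow> ('p, 'b) acat \<Rightarrow> ('o, 'a, 'p, 'b) fctr \<Rightarrow> bool" where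
  "strict_tensor_functor B B' F \<longleftrightarrow>
     associative_category B \<and> associative_category B' \<and> is_functor B B' F \<and>
     (\<forall>x\<in>Ob B. \<forall>y\<in>Ob B. om F (om (tensor B) (x, y)) = om (tensor B') (om F x, om F y)) \<and>
     (\<forall>f\<in>Ar B. \<forall>g\<in>Ar B. am F (am (tensor B) (f, g)) = am (tensor B') (am F f, am F g)) \<and>
     (\<forall>x\<in>Ob B. \<forall>y\<in>Ob B. \<forall>z\<in>Ob B.
        am F (asc B (x, y, z)) = asc B' (om F x, om F y, om F z))"

text \<open>The smallest associative subcategory containing a given object.\<close>

inductive_set gen_ob :: "('o, 'a) acat \<Rightarrow> 'o \<Rightarrow> 'o set" for E :: "('o, 'a) acat" and x0 :: 'o where
  base: "x0 \<in> gen_ob E x0"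
| tensor: "\<lbrakk>x \<in> gen_ob E x0; y \<in> gen_ob E x0\<rbrakk> \<Longrightarrow> om (tensor E) (x, y) \<in> gen_ob E x0"

inductive_set gen_ar :: "('o, 'a) acat \<Rightarrow> 'o \<Rightarrow> 'a set" for E :: "('o, 'a) acat" and x0 :: 'o where
  idn: "x \<in> gen_ob E x0 \<Longrightarrow> Idn E x \<in> gen_ar E x0"
| cmp: "\<lbrakk>f \<in> gen_ar E x0; g \<in> gen_ar E x0; Cod E f = Dom E g\<rbrakk> \<Longrightarrow> Cmp E g f \<in> gen_ar E x0"
| tensor: "\<lbrakk>f \<in> gen_ar E x0; g \<in> gen_ar E x0\<rbrakk> \<Longrightarrow> am (tensor E) (f, g) \<in> gen_ar E x0"
| asc: "\<lbrakk>x \<in> gen_ob E x0; y \<in> gen_ob E x0; z \<in> gen_ob E x0\<rbrakk> \<Longrightarrow> asc E (x, y, z) \<in> gen_ar E x0"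
| asc_inv: "\<lbrakk>x \<in> gen_ob E x0; y \<in> gen_ob E x0; z \<in> gen_ob E x0;
    inverse_arrows E (asc E (x, y, z)) g\<rbrakk> \<Longrightarrow> g \<in> gen_ar E x0"

definition generated_acat :: "('o, 'a) acat \<Rightarrow> 'o \<Rightarrow> ('o, 'a) acat" where
  "generated_acat E x0 =
     \<lparr>Ob = gen_ob E x0, Ar = gen_ar E x0, Dom = Dom E, Cod = Cod E, Idn = Idn E, Cmp = Cmp E,
      tensor = \<lparr>om = restrict (om (tensor E)) (gen_ob E x0 \<times> gen_ob E x0),
                am = restrict (am (tensor E)) (gen_ar E x0 \<times> gen_ar E x0)\<rparr>,
      asc = restrict (asc E) (gen_ob E x0 \<times> gen_ob E x0 \<times> gen_ob E x0)\<rparr>"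


section \<open>The Catalan groupoids\<close>

text \<open>
  \<open>Cell\<close> and \<open>Word\<close> close the object and arrow types of the pushout up under the recursion.
\<close>

datatype ct_ob =
  Star
| Cell "(nat \<times> nat \<times> nat) \<times> ct_ob \<times> ct_ob \<times> ct_ob \<times> nat + (nat \<times> nat) \<times> ct_ob \<times> ct_ob"

datatype ct_ar =
  IdStar
| Word "((nat \<times> nat \<times> nat) \<times> ct_ob \<times> ct_ob \<times> ct_ob \<times> nat + (nat \<times> nat) \<times> ct_ob \<times> ct_ob) \<times>
    ((nat \<times> nat \<times> nat) \<times> ct_ar \<times> ct_ar \<times> ct_ar \<times> nat \<times> nat + (nat \<times> nat) \<times> ct_ar \<times> ct_ar) list \<times>
    ((nat \<times> nat \<times> nat) \<times> ct_ob \<times> ct_ob \<times> ct_ob \<times> nat + (nat \<times> nat) \<times> ct_ob \<times> ct_ob)"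

type_synonym ct_cat = "(ct_ob, ct_ar) cat"

text \<open>
  One stage of the induction: the groupoid \<open>A\<^sub>n\<close> together with the functors \<open>U\<^sub>a\<^sub>,\<^sub>b\<close> for
  \<open>a + b = n\<close> and \<open>V\<^sub>i\<^sub>,\<^sub>j\<^sub>,\<^sub>k\<close> for \<open>i + j + k = n\<close>.
\<close>

record stage =
  grpd :: ct_cat
  Ufun :: "nat \<Rightarrow> nat \<Rightarrow> (ct_ob \<times> ct_ob, ct_ar \<times> ct_ar, ct_ob, ct_ar) fctr"
  Vfun :: "nat \<Rightarrow> nat \<Rightarrow> nat \<Rightarrow>
    (ct_ob \<times> ct_ob \<times> ct_ob \<times> nat, ct_ar \<times> ct_ar \<times> ct_ar \<times> nat \<times> nat, ct_ob, ct_ar) fctr"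

definition pairs :: "nat \<Rightarrow> (nat \<times> nat) set" where
  "pairs n = {(a, b). 1 \<le> a \<and> 1 \<le> b \<and> a + b = n}"

definition triples :: "nat \<Rightarrow> (nat \<times> nat \<times> nat) set" where
  "triples n = {(i, j, k). 1 \<le> i \<and> 1 \<le> j \<and> 1 \<le> k \<and> i + j + k = n}"

definition span_X where
  "span_X S n = coprod_cat (triples n) (\<lambda>(i, j, k).
     prod_cat (grpd (S i)) (prod_cat (grpd (S j)) (prod_cat (grpd (S k)) (indiscrete {0, 1 :: nat}))))"

definition span_Z where
  "span_Z S n = coprod_cat (triples n) (\<lambda>(i, j, k).
     prod_cat (grpd (S i)) (prod_cat (grpd (S j)) (prod_cat (grpd (S k)) (discrete {0, 1 :: nat}))))"

definition span_Y where
  "span_Y S n = coprod_cat (pairs n) (\<lambda>(a, b). prod_cat (grpd (S a)) (grpd (S b)))"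

definition span_I where
  "span_I S n = mk_fctr (span_Z S n) (\<lambda>x. x) (\<lambda>f. f)"

definition span_W where
  "span_W S n = mk_fctr (span_Z S n)
     (\<lambda>((i, j, k), (x, y, z, e)).
        if e = 0 then ((i, j + k), (x, om (Ufun (S (j + k)) j k) (y, z)))
        else ((i + j, k), (om (Ufun (S (i + j)) i j) (x, y), z)))
     (\<lambda>((i, j, k), (f, g, h, d)).
        if d = (0, 0) then ((i, j + k), (f, am (Ufun (S (j + k)) j k) (g, h)))
        else ((i + j, k), (am (Ufun (S (i + j)) i j) (f, g), h)))"

definition catalan_pushout where
  "catalan_pushout S n =
     pushout_cat (span_X S n) (span_Y S n) (span_Z S n) (span_I S n) (span_W S n)"

definition catalan_step :: "nat \<Rightarrow> (nat \<Rightarrow> stage) \<Rightarrow> stage" where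
  "catalan_step n S =
     (let inX = po_inl (span_X S n) (span_Y S n) (span_Z S n) (span_I S n) (span_W S n);
          inY = po_inr (span_X S n) (span_Y S n) (span_Z S n) (span_I S n) (span_W S n)
      in \<lparr>grpd = relabel_cat Cell Word (catalan_pushout S n),
          Ufun = (\<lambda>a b. mk_fctr (prod_cat (grpd (S a)) (grpd (S b)))
             (\<lambda>x. Cell (om inY ((a, b), x))) (\<lambda>f. Word (am inY ((a, b), f)))),
          Vfun = (\<lambda>i j k. mk_fctr
             (prod_cat (grpd (S i)) (prod_cat (grpd (S j)) (prod_cat (grpd (S k)) (indiscrete {0, 1}))))
             (\<lambda>x. Cell (om inX ((i, j, k), x))) (\<lambda>f. Word (am inX ((i, j, k), f))))\<rparr>)"

definition stage_one :: stage where
  "stage_one =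
     \<lparr>grpd = \<lparr>Ob = {Star}, Ar = {IdStar}, Dom = (\<lambda>_. Star), Cod = (\<lambda>_. Star),
              Idn = (\<lambda>_. IdStar), Cmp = (\<lambda>_ _. IdStar)\<rparr>,
      Ufun = undefined, Vfun = undefined\<rparr>"

fun catalan :: "nat \<Rightarrow> stage" where
  "catalan n = (if n = 1 then stage_one
     else catalan_step n (\<lambda>m. if m < n then catalan m else undefined))"

declare catalan.simps [simp del]

definition catA :: "nat \<Rightarrow> ct_cat" where
  "catA n = grpd (catalan n)"

definition funU :: "nat \<Rightarrow> nat \<Rightarrow> (ct_ob \<times> ct_ob, ct_ar \<times> ct_ar, ct_ob, ct_ar) fctr" where
  "funU a b = Ufun (catalan (a + b)) a b"

definition funV :: "nat \<Rightarrow> nat \<Rightarrow> nat \<Rightarrow>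
    (ct_ob \<times> ct_ob \<times> ct_ob \<times> nat, ct_ar \<times> ct_ar \<times> ct_ar \<times> nat \<times> nat, ct_ob, ct_ar) fctr" where
  "funV i j k = Vfun (catalan (i + j + k)) i j k"

text \<open>
  The recursion is well-founded as intended: for \<open>n \<ge> 2\<close> the two legs of the span are functors,
  hence \<open>catA n\<close> is their pushout, and \<open>funU\<close>, \<open>funV\<close> are functors.
\<close>

lemma coprod_cat_cong: "(\<And>i. i \<in> I \<Longrightarrow> C i = D i) \<Longrightarrow> coprod_cat I C = coprod_cat I D"
  by (simp add: coprod_cat_def cong: restrict_cong)

lemma coprod_cat_simps:
  "Ob (coprod_cat I C) = (SIGMA i:I. Ob (C i))"
  "Ar (coprod_cat I C) = (SIGMA i:I. Ar (C i))"
  "i \<in> I \<Longrightarrow> Dom (coprod_cat I C) (i, f) = (i, Dom (C i) f)"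
  "i \<in> I \<Longrightarrow> Cod (coprod_cat I C) (i, f) = (i, Cod (C i) f)"
  "i \<in> I \<Longrightarrow> Idn (coprod_cat I C) (i, x) = (i, Idn (C i) x)"
  "i \<in> I \<Longrightarrow> Cmp (coprod_cat I C) (i, g) (i, f) = (i, Cmp (C i) g f)"
  by (auto simp: coprod_cat_def Let_def)

lemma span_cong:
  assumes "\<And>m. m < n \<Longrightarrow> S m = S' m"
  shows "span_X S n = span_X S' n" "span_Y S n = span_Y S' n" "span_Z S n = span_Z S' n"
    "span_I S n = span_I S' n" "span_W S n = span_W S' n"
proof -
  show X: "span_X S n = span_X S' n" and Y: "span_Y S n = span_Y S' n" and Z: "span_Z S n = span_Z S' n"
    unfolding span_X_def span_Y_def span_Z_def
    by (intro coprod_cat_cong; auto simp: triples_def pairs_def assms)+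
  then show "span_I S n = span_I S' n"
    by (simp add: span_I_def)
  show "span_W S n = span_W S' n"
    unfolding span_W_def Z mk_fctr_def
    by (intro fctr.equality ext)
      (auto simp: restrict_def span_Z_def coprod_cat_simps triples_def assms)
qed

lemma catalan_eq_step:
  assumes "n \<noteq> 1"
  shows "catA n = relabel_cat Cell Word (catalan_pushout catalan n)"
proof -
  have "catalan n = catalan_step n (\<lambda>m. if m < n then catalan m else undefined)"
    using assms by (subst catalan.simps) simp
  moreover have "catalan_pushout (\<lambda>m. if m < n then catalan m else undefined) n
    = catalan_pushout catalan n"
    unfolding catalan_pushout_def
    using span_cong[of n "\<lambda>m. if m < n then catalan m else undefined" catalan] by simp
  ultimately show ?thesis
    by (simp add: catA_def catalan_step_def Let_def)
qed

lemma funU_eq: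
  assumes "1 \<le> a" "1 \<le> b" "n = a + b"
  shows "funU a b = mk_fctr (prod_cat (catA a) (catA b))
    (\<lambda>x. Cell (om (po_inr (span_X catalan n) (span_Y catalan n) (span_Z catalan n)
      (span_I catalan n) (span_W catalan n)) ((a, b), x)))
    (\<lambda>f. Word (am (po_inr (span_X catalan n) (span_Y catalan n) (span_Z catalan n)
      (span_I catalan n) (span_W catalan n)) ((a, b), f)))"
proof -
  have "catalan n = catalan_step n (\<lambda>m. if m < n then catalan m else undefined)"
    using assms by (subst catalan.simps) simp
  then show ?thesis
    using assms span_cong[of n "\<lambda>m. if m < n then catalan m else undefined" catalan]
    by (simp add: funU_def catA_def catalan_step_def Let_def)
qed

lemma funV_eq:
  assumes "1 \<le> i" "1 \<le> j" "1 \<le> k" "n = i + j + k"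
  shows "funV i j k = mk_fctr
    (prod_cat (catA i) (prod_cat (catA j) (prod_cat (catA k) (indiscrete {0, 1}))))
    (\<lambda>x. Cell (om (po_inl (span_X catalan n) (span_Y catalan n) (span_Z catalan n)
      (span_I catalan n) (span_W catalan n)) ((i, j, k), x)))
    (\<lambda>f. Word (am (po_inl (span_X catalan n) (span_Y catalan n) (span_Z catalan n)
      (span_I catalan n) (span_W catalan n)) ((i, j, k), f)))"
proof -
  have "catalan n = catalan_step n (\<lambda>m. if m < n then catalan m else undefined)"
    using assms by (subst catalan.simps) simp
  then show ?thesis
    using assms span_cong[of n "\<lambda>m. if m < n then catalan m else undefined" catalan]
    by (simp add: funV_def catA_def catalan_step_def Let_def)
qed

lemma category_prod: "category C \<Longrightarrow> category D \<Longrightarrow> category (prod_cat C D)"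
  by (auto simp: category_def prod_cat_def hom_def)

lemma category_coprod: "(\<And>i. i \<in> I \<Longrightarrow> category (C i)) \<Longrightarrow> category (coprod_cat I C)"
  by (auto simp: category_def coprod_cat_simps hom_def)

lemma category_indiscrete: "category (indiscrete S)"
  and category_discrete: "category (discrete S)"
  by (auto simp: category_def indiscrete_def discrete_def hom_def)

lemma relabel_simps:
  assumes "inj p" "inj q"
  shows "Ob (relabel_cat p q C) = p ` Ob C" "Ar (relabel_cat p q C) = q ` Ar C"
    "Dom (relabel_cat p q C) (q f) = p (Dom C f)" "Cod (relabel_cat p q C) (q f) = p (Cod C f)"
    "Idn (relabel_cat p q C) (p x) = q (Idn C x)"
    "Cmp (relabel_cat p q C) (q g) (q f) = q (Cmp C g f)"
  using assms by (simp_all add: relabel_cat_def)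

lemma category_relabel:
  assumes C: "category C" and pq: "inj p" "inj q"
  shows "category (relabel_cat p q C)"
  using C unfolding category_def hom_def
  by (simp add: relabel_simps[OF pq] inj_eq[OF pq(1)] inj_image_mem_iff[OF pq(1)]
      inj_image_mem_iff[OF pq(2)])

lemma functor_relabel:
  assumes F: "is_functor B C F" and pq: "inj p" "inj q"
  shows "is_functor B (relabel_cat p q C) (mk_fctr B (\<lambda>x. p (om F x)) (\<lambda>f. q (am F f)))"
proof -
  have B: "category B" and C: "category C" using F by (auto simp: is_functor_def)
  show ?thesis
    unfolding is_functor_def
    using category_relabel[OF C pq] B F cat_ob[OF B] cat_idn[OF B] cat_cmp[OF B]
      functor_ob[OF F] functor_ar[OF F]
    by (auto simp: relabel_simps[OF pq] mk_fctr_def hom_def is_functor_def)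
qed

lemma functor_component:
  assumes F: "is_functor (coprod_cat I C) D F" and i: "i \<in> I" and C: "category (C i)"
  shows "is_functor (C i) D (mk_fctr (C i) (\<lambda>x. om F (i, x)) (\<lambda>f. am F (i, f)))"
proof -
  note c = cat_ob[OF C] cat_idn[OF C] cat_cmp[OF C]
  show ?thesis
    unfolding is_functor_def
  proof (intro conjI ballI impI)
    show "am (mk_fctr (C i) (\<lambda>x. om F (i, x)) (\<lambda>f. am F (i, f))) (Cmp (C i) g f) =
        Cmp D (am (mk_fctr (C i) (\<lambda>x. om F (i, x)) (\<lambda>f. am F (i, f))) g)
          (am (mk_fctr (C i) (\<lambda>x. om F (i, x)) (\<lambda>f. am F (i, f))) f)"
      if fg: "f \<in> Ar (C i)" "g \<in> Ar (C i)" "Cod (C i) f = Dom (C i) g" for f g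
    proof -
      have "am F (Cmp (coprod_cat I C) (i, g) (i, f)) = Cmp D (am F (i, g)) (am F (i, f))"
        using F fg i by (simp add: is_functor_def coprod_cat_simps)
      then show ?thesis using fg i c by (simp add: mk_fctr_def coprod_cat_simps)
    qed
    show "am (mk_fctr (C i) (\<lambda>x. om F (i, x)) (\<lambda>f. am F (i, f))) (Idn (C i) x) =
        Idn D (om (mk_fctr (C i) (\<lambda>x. om F (i, x)) (\<lambda>f. am F (i, f))) x)"
      if x: "x \<in> Ob (C i)" for x
    proof -
      have "am F (Idn (coprod_cat I C) (i, x)) = Idn D (om F (i, x))"
        using F x i by (simp add: is_functor_def coprod_cat_simps)
      then show ?thesis using x i c by (simp add: mk_fctr_def coprod_cat_simps)
    qed
  qed (use functor_ob[OF F] functor_ar[OF F] F C c i in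
      \<open>auto simp: is_functor_def mk_fctr_def coprod_cat_simps hom_def\<close>)
qed

lemma inj_Cell: "inj Cell" and inj_Word: "inj Word"
  by (auto simp: inj_def)

lemma functor_span:
  assumes cat: "\<And>m. 1 \<le> m \<Longrightarrow> m < n \<Longrightarrow> category (catA m)"
    and fU: "\<And>a b. 1 \<le> a \<Longrightarrow> 1 \<le> b \<Longrightarrow> a + b < n \<Longrightarrow>
      is_functor (prod_cat (catA a) (catA b)) (catA (a + b)) (funU a b)"
  shows "is_functor (span_Z catalan n) (span_X catalan n) (span_I catalan n)"
    "is_functor (span_Z catalan n) (span_Y catalan n) (span_W catalan n)"
proof -
  have c: "category (span_X catalan n)" "category (span_Y catalan n)" "category (span_Z catalan n)"
    unfolding span_X_def span_Y_def span_Z_def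
    by (rule category_coprod; auto simp: triples_def pairs_def simp flip: catA_def
      intro!: category_prod category_indiscrete category_discrete cat)+
  show "is_functor (span_Z catalan n) (span_X catalan n) (span_I catalan n)"
    unfolding is_functor_def
  proof (intro conjI ballI impI)
    note c3 = cat_ob[OF c(3)] cat_idn[OF c(3)] cat_cmp[OF c(3)]
    note d = span_Z_def span_X_def coprod_cat_simps prod_cat_def indiscrete_def discrete_def
    have id: "x \<in> Ob (span_Z catalan n) \<Longrightarrow> om (span_I catalan n) x = x"
      "f \<in> Ar (span_Z catalan n) \<Longrightarrow> am (span_I catalan n) f = f" for x f
      by (simp_all add: span_I_def mk_fctr_def)
    show "om (span_I catalan n) \<in> Ob (span_Z catalan n) \<rightarrow>\<^sub>E Ob (span_X catalan n)"
      "am (span_I catalan n) \<in> Ar (span_Z catalan n) \<rightarrow>\<^sub>E Ar (span_X catalan n)"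
      by (auto simp: span_I_def mk_fctr_def) (auto simp: d)
    show "am (span_I catalan n) f \<in> hom (span_X catalan n)
        (om (span_I catalan n) (Dom (span_Z catalan n) f)) (om (span_I catalan n) (Cod (span_Z catalan n) f))"
      if f: "f \<in> Ar (span_Z catalan n)" for f
      unfolding id(2)[OF f] id(1)[OF c3(1)[OF f]] id(1)[OF c3(2)[OF f]]
      using f by (auto simp: hom_def d)
    show "am (span_I catalan n) (Idn (span_Z catalan n) x) = Idn (span_X catalan n) (om (span_I catalan n) x)"
      if x: "x \<in> Ob (span_Z catalan n)" for x
      unfolding id(1)[OF x] id(2)[OF c3(3)[OF x]] using x by (auto simp: d)
    show "am (span_I catalan n) (Cmp (span_Z catalan n) g f) =
        Cmp (span_X catalan n) (am (span_I catalan n) g) (am (span_I catalan n) f)"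
      if fg: "f \<in> Ar (span_Z catalan n)" "g \<in> Ar (span_Z catalan n)"
        "Cod (span_Z catalan n) f = Dom (span_Z catalan n) g" for f g
      unfolding id(2)[OF fg(1)] id(2)[OF fg(2)] id(2)[OF c3(6)[OF fg]]
      using fg by (auto simp: d)
  qed (use c in auto)
  show "is_functor (span_Z catalan n) (span_Y catalan n) (span_W catalan n)"
    unfolding is_functor_def
  proof (intro conjI ballI impI)
    have U: "om (funU a b) (x, y) \<in> Ob (catA (a + b))"
      if "1 \<le> a" "1 \<le> b" "a + b < n" "x \<in> Ob (catA a)" "y \<in> Ob (catA b)" for a b x y
      using functor_ob[OF fU[OF that(1-3)]] that by (simp add: prod_cat_def)
    have UA: "am (funU a b) (f, g) \<in> Ar (catA (a + b))"
      "Dom (catA (a + b)) (am (funU a b) (f, g)) = om (funU a b) (Dom (catA a) f, Dom (catA b) g)"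
      "Cod (catA (a + b)) (am (funU a b) (f, g)) = om (funU a b) (Cod (catA a) f, Cod (catA b) g)"
      if "1 \<le> a" "1 \<le> b" "a + b < n" "f \<in> Ar (catA a)" "g \<in> Ar (catA b)" for a b f g
      using functor_ar[OF fU[OF that(1-3)]] that by (simp_all add: prod_cat_def)
    have UI: "am (funU a b) (Idn (catA a) x, Idn (catA b) y) = Idn (catA (a + b)) (om (funU a b) (x, y))"
      if "1 \<le> a" "1 \<le> b" "a + b < n" "x \<in> Ob (catA a)" "y \<in> Ob (catA b)" for a b x y
      using fU[OF that(1-3)] that by (auto simp: is_functor_def prod_cat_def)
    have UC: "am (funU a b) (Cmp (catA a) f' f, Cmp (catA b) g' g) =
        Cmp (catA (a + b)) (am (funU a b) (f', g')) (am (funU a b) (f, g))"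
      if "1 \<le> a" "1 \<le> b" "a + b < n" "f \<in> Ar (catA a)" "g \<in> Ar (catA b)"
        "f' \<in> Ar (catA a)" "g' \<in> Ar (catA b)"
        "Cod (catA a) f = Dom (catA a) f'" "Cod (catA b) g = Dom (catA b) g'" for a b f g f' g'
      using fU[OF that(1-3)] that by (auto simp: is_functor_def prod_cat_def)
    note d = span_Z_def span_Y_def coprod_cat_simps prod_cat_def indiscrete_def discrete_def
      span_W_def mk_fctr_def triples_def pairs_def hom_def
    note cat' = cat_ob[OF cat] cat_idn[OF cat] cat_cmp[OF cat]
    show "om (span_W catalan n) \<in> Ob (span_Z catalan n) \<rightarrow>\<^sub>E Ob (span_Y catalan n)"
      by (auto simp: d U simp flip: catA_def funU_def)
    show ar: "am (span_W catalan n) f \<in> hom (span_Y catalan n)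
        (om (span_W catalan n) (Dom (span_Z catalan n) f)) (om (span_W catalan n) (Cod (span_Z catalan n) f))"
      if "f \<in> Ar (span_Z catalan n)" for f
      using that by (auto simp: d U UA cat' simp flip: catA_def funU_def)
    show "am (span_W catalan n) \<in> Ar (span_Z catalan n) \<rightarrow>\<^sub>E Ar (span_Y catalan n)"
      by (auto simp: d UA simp flip: catA_def funU_def)
    show "am (span_W catalan n) (Idn (span_Z catalan n) x) = Idn (span_Y catalan n) (om (span_W catalan n) x)"
      if "x \<in> Ob (span_Z catalan n)" for x
      using that by (auto simp: d U UI cat' simp flip: catA_def funU_def)
    show "am (span_W catalan n) (Cmp (span_Z catalan n) g f) =
        Cmp (span_Y catalan n) (am (span_W catalan n) g) (am (span_W catalan n) f)"
      if fg: "f \<in> Ar (span_Z catalan n)" "g \<in> Ar (span_Z catalan n)"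
        "Cod (span_Z catalan n) f = Dom (span_Z catalan n) g" for f g
    proof -
      obtain i j k f1 f2 f3 e where f: "f = ((i, j, k), (f1, f2, f3, (e, e)))"
        and t: "(i, j, k) \<in> triples n" and e: "e = 0 \<or> e = 1"
        and fA: "f1 \<in> Ar (catA i)" "f2 \<in> Ar (catA j)" "f3 \<in> Ar (catA k)"
        using fg(1) by (auto simp: span_Z_def coprod_cat_simps prod_cat_def discrete_def simp flip: catA_def)
      obtain i' j' k' g1 g2 g3 e' where g: "g = ((i', j', k'), (g1, g2, g3, (e', e')))"
        and t': "(i', j', k') \<in> triples n"
        and gA: "g1 \<in> Ar (catA i')" "g2 \<in> Ar (catA j')" "g3 \<in> Ar (catA k')"
        using fg(2) by (auto simp: span_Z_def coprod_cat_simps prod_cat_def discrete_def simp flip: catA_def)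
      have [simp]: "i' = i" "j' = j" "k' = k" "e' = e"
        and cod: "Cod (catA i) f1 = Dom (catA i) g1" "Cod (catA j) f2 = Dom (catA j) g2"
          "Cod (catA k) f3 = Dom (catA k) g3"
        using fg(3) t t' unfolding f g
        by (auto simp: span_Z_def coprod_cat_simps prod_cat_def discrete_def indiscrete_def simp flip: catA_def)
      have n: "1 \<le> i" "1 \<le> j" "1 \<le> k" "i < n" "j < n" "k < n" "i + j < n" "j + k < n" "i + j + k = n"
        using t by (auto simp: triples_def)
      have p: "(i, j + k) \<in> pairs n" "(i + j, k) \<in> pairs n"
        using n by (auto simp: pairs_def)
      have gA': "g1 \<in> Ar (catA i)" "g2 \<in> Ar (catA j)" "g3 \<in> Ar (catA k)" using gA by simp_all
      have Cmp_Z: "Cmp (span_Z catalan n) g f =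
          ((i, j, k), (Cmp (catA i) g1 f1, Cmp (catA j) g2 f2, Cmp (catA k) g3 f3, (e, e)))"
        unfolding f g using t
        by (simp add: span_Z_def coprod_cat_simps prod_cat_def discrete_def indiscrete_def catA_def)
      have W: "am (span_W catalan n) ((i, j, k), (h1, h2, h3, (e, e))) =
          (if e = 0 then ((i, j + k), (h1, am (funU j k) (h2, h3)))
           else ((i + j, k), (am (funU i j) (h1, h2), h3)))"
        if "h1 \<in> Ar (catA i)" "h2 \<in> Ar (catA j)" "h3 \<in> Ar (catA k)" for h1 h2 h3
        using that t e
        by (auto simp: span_W_def mk_fctr_def span_Z_def coprod_cat_simps prod_cat_def discrete_def
            funU_def catA_def)
      have Y: "Cmp (span_Y catalan n) ((a, b), (h1, h2)) ((a, b), (h3, h4)) =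
          ((a, b), (Cmp (catA a) h1 h3, Cmp (catA b) h2 h4))" if "(a, b) \<in> pairs n" for a b h1 h2 h3 h4
        using that by (simp add: span_Y_def coprod_cat_simps prod_cat_def catA_def)
      have cA: "Cmp (catA i) g1 f1 \<in> Ar (catA i)" "Cmp (catA j) g2 f2 \<in> Ar (catA j)"
          "Cmp (catA k) g3 f3 \<in> Ar (catA k)"
        using cat_cmp(1)[OF cat] n fA gA' cod by simp_all
      show ?thesis
        unfolding Cmp_Z W[OF cA] unfolding f g
        using W[OF fA] W[OF gA'] Y[OF p(1)] Y[OF p(2)] UC n fA gA' cod by simp
    qed
  qed (use c in auto)
qed

lemma catalan_functors:
  "(1 \<le> n \<longrightarrow> category (catA n)) \<and>
   (\<forall>a b. 1 \<le> a \<longrightarrow> 1 \<le> b \<longrightarrow> a + b = n \<longrightarrow>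
     is_functor (prod_cat (catA a) (catA b)) (catA n) (funU a b)) \<and>
   (\<forall>i j k. 1 \<le> i \<longrightarrow> 1 \<le> j \<longrightarrow> 1 \<le> k \<longrightarrow> i + j + k = n \<longrightarrow>
     is_functor (prod_cat (catA i) (prod_cat (catA j) (prod_cat (catA k) (indiscrete {0, 1}))))
       (catA n) (funV i j k))"
proof (induction n rule: less_induct)
  case (less n)
  consider "n = 0" | "n = 1" | "n \<ge> 2" by linarith
  then show ?case
  proof cases
    case 2
    then show ?thesis
      by (auto simp: catA_def catalan.simps[of "Suc 0"] stage_one_def category_def hom_def)
  next
    case 3
    interpret pushout_span "span_X catalan n" "span_Y catalan n" "span_Z catalan n" "span_I catalan n" "span_W catalan n"
      using functor_span[of n] less.IH by unfold_locales auto
    have eq: "catA n = relabel_cat Cell Word P"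
      using catalan_eq_step[of n] 3 by (simp add: catalan_pushout_def)
    have c: "category (catA n)"
      unfolding eq by (rule category_relabel[OF category_P inj_Cell inj_Word])
    have X: "is_functor (span_X catalan n) (catA n)
        (mk_fctr (span_X catalan n) (\<lambda>x. Cell (om inl x)) (\<lambda>f. Word (am inl f)))"
      unfolding eq by (rule functor_relabel[OF functor_inl inj_Cell inj_Word])
    have Y: "is_functor (span_Y catalan n) (catA n)
        (mk_fctr (span_Y catalan n) (\<lambda>x. Cell (om inr x)) (\<lambda>f. Word (am inr f)))"
      unfolding eq by (rule functor_relabel[OF functor_inr inj_Cell inj_Word])
    have "is_functor (prod_cat (catA a) (catA b)) (catA n) (funU a b)"
      if ab: "1 \<le> a" "1 \<le> b" "a + b = n" for a b
    proof -
      have m: "(a, b) \<in> pairs n" using ab by (simp add: pairs_def)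
      have cc: "category (prod_cat (catA a) (catA b))"
        using less.IH ab by (intro category_prod) auto
      have "mk_fctr (prod_cat (catA a) (catA b))
          (\<lambda>x. om (mk_fctr (span_Y catalan n) (\<lambda>x. Cell (om inr x)) (\<lambda>f. Word (am inr f))) ((a, b), x))
          (\<lambda>f. am (mk_fctr (span_Y catalan n) (\<lambda>x. Cell (om inr x)) (\<lambda>f. Word (am inr f))) ((a, b), f))
        = funU a b"
        unfolding funU_eq[OF ab(1,2) ab(3)[symmetric]]
        using m by (auto simp: mk_fctr_def span_Y_def coprod_cat_simps restrict_def catA_def intro!: ext)
      then show ?thesis
        using functor_component[OF Y[unfolded span_Y_def] m, folded span_Y_def] cc
        by (simp add: catA_def)
    qed
    moreover have "is_functor (prod_cat (catA i) (prod_cat (catA j) (prod_cat (catA k) (indiscrete {0, 1}))))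
        (catA n) (funV i j k)"
      if ijk: "1 \<le> i" "1 \<le> j" "1 \<le> k" "i + j + k = n" for i j k
    proof -
      have m: "(i, j, k) \<in> triples n" using ijk by (simp add: triples_def)
      have cc: "category (prod_cat (catA i) (prod_cat (catA j) (prod_cat (catA k) (indiscrete {0, 1::nat}))))"
        using less.IH ijk by (intro category_prod category_indiscrete) auto
      have "mk_fctr (prod_cat (catA i) (prod_cat (catA j) (prod_cat (catA k) (indiscrete {0, 1}))))
          (\<lambda>x. om (mk_fctr (span_X catalan n) (\<lambda>x. Cell (om inl x)) (\<lambda>f. Word (am inl f))) ((i, j, k), x))
          (\<lambda>f. am (mk_fctr (span_X catalan n) (\<lambda>x. Cell (om inl x)) (\<lambda>f. Word (am inl f))) ((i, j, k), f))
        = funV i j k"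
        unfolding funV_eq[OF ijk(1-3) ijk(4)[symmetric]]
        using m by (auto simp: mk_fctr_def span_X_def coprod_cat_simps restrict_def catA_def intro!: ext)
      then show ?thesis
        using functor_component[OF X[unfolded span_X_def] m, folded span_X_def] cc
        by (simp add: catA_def)
    qed
    ultimately show ?thesis using c by blast
  qed simp
qed

definition iota :: "nat \<times> nat" where
  "iota = (0, 1)"

definition A_base :: "(nat \<times> ct_ob, nat \<times> ct_ar) cat" where
  "A_base = coprod_cat {1..} catA"

definition A_bar :: "(nat \<times> ct_ob, nat \<times> ct_ar) acat" where
  "A_bar = cat.extend A_base
     \<lparr>tensor = mk_fctr (prod_cat A_base A_base)
        (\<lambda>((i, x), (j, y)). (i + j, om (funU i j) (x, y)))
        (\<lambda>((i, f), (j, g)). (i + j, am (funU i j) (f, g))),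
      asc = restrict
        (\<lambda>((i, x), (j, y), (k, z)).
           (i + j + k, am (funV i j k) (Idn (catA i) x, Idn (catA j) y, Idn (catA k) z, iota)))
        (Ob A_base \<times> Ob A_base \<times> Ob A_base)\<rparr>"

definition star1 :: ct_ob where
  "star1 = Star"

definition star2 :: ct_ob where
  "star2 = om (funU 1 1) (star1, star1)"

lemma Ob_catA_2: "Ob (catA 2) = {star2}"
proof -
  interpret pushout_span "span_X catalan 2" "span_Y catalan 2" "span_Z catalan 2"
      "span_I catalan 2" "span_W catalan 2"
    using functor_span[of 2] catalan_functors by unfold_locales blast+
  have 1: "catA 1 = grpd stage_one"
    by (simp add: catA_def catalan.simps[of "Suc 0"])
  have "triples 2 = {}" "pairs 2 = {(1, 1)}"
    by (auto simp: triples_def pairs_def)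
  then have X: "Ob (span_X catalan 2) = {}" and Y: "Ob (span_Y catalan 2) = {((1, 1), (Star, Star))}"
    using 1 by (auto simp: span_X_def span_Y_def coprod_cat_simps prod_cat_def stage_one_def
        simp flip: catA_def)
  have "star2 = Cell (om inr ((1, 1), (Star, Star)))"
    unfolding star2_def star1_def
    by (subst funU_eq[where n = 2]) (use 1 in \<open>simp_all add: mk_fctr_def prod_cat_def stage_one_def\<close>)
  moreover have "Ob (catA 2) = Cell ` Ob P"
    using catalan_eq_step[of 2] by (simp add: catalan_pushout_def relabel_simps inj_Cell inj_Word)
  ultimately show ?thesis
    using om_inr[of "((1, 1), (Star, Star))"] X Y by (simp add: Ob_P Plus_def)
qed

definition alpha :: ct_ar where
  "alpha = am (funV 1 1 1) (Idn (catA 1) star1, Idn (catA 1) star1, Idn (catA 1) star1, iota)"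


section \<open>The category of iterates\<close>

type_synonym ('o, 'a) opn = "('o list, 'a list, 'o, 'a) fctr"

type_synonym ('o, 'a) opn_tr = "('o, 'a) opn \<times> ('o, 'a) opn \<times> ('o list \<Rightarrow> 'a)"

definition opn_tensor ::
  "('o, 'a) acat \<Rightarrow> nat \<times> ('o, 'a) opn \<Rightarrow> nat \<times> ('o, 'a) opn \<Rightarrow> nat \<times> ('o, 'a) opn" where
  "opn_tensor B = (\<lambda>(q, f) (r, g). (q + r, mk_fctr (power_cat B (q + r))
     (\<lambda>xs. om (tensor B) (om f (take q xs), om g (drop q xs)))
     (\<lambda>us. am (tensor B) (am f (take q us), am g (drop q us)))))"

definition opn_tr_tensor ::
  "('o, 'a) acat \<Rightarrow> nat \<times> ('o, 'a) opn_tr \<Rightarrow> nat \<times> ('o, 'a) opn_tr \<Rightarrow> nat \<times> ('o, 'a) opn_tr" where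
  "opn_tr_tensor B = (\<lambda>(q, (f, f', s)) (r, (g, g', t)). (q + r,
     snd (opn_tensor B (q, f) (r, g)), snd (opn_tensor B (q, f') (r, g')),
     \<lambda>xs\<in>Ob (power_cat B (q + r)). am (tensor B) (s (take q xs), t (drop q xs))))"

definition opn_asc ::
  "('o, 'a) acat \<Rightarrow> nat \<times> ('o, 'a) opn \<Rightarrow> nat \<times> ('o, 'a) opn \<Rightarrow> nat \<times> ('o, 'a) opn \<Rightarrow>
   nat \<times> ('o, 'a) opn_tr" where
  "opn_asc B = (\<lambda>(q, f) (r, g) (s, h). (q + r + s,
     snd (opn_tensor B (q, f) (opn_tensor B (r, g) (s, h))),
     snd (opn_tensor B (opn_tensor B (q, f) (r, g)) (s, h)),
     \<lambda>xs\<in>Ob (power_cat B (q + r + s)).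
       asc B (om f (take q xs), om g (take r (drop q xs)), om h (drop (q + r) xs))))"

definition B_bar_base :: "('o, 'a) acat \<Rightarrow> (nat \<times> ('o, 'a) opn, nat \<times> ('o, 'a) opn_tr) cat" where
  "B_bar_base B = coprod_cat {1..} (\<lambda>n. functor_cat (power_cat B n) B)"

definition B_bar :: "('o, 'a) acat \<Rightarrow> (nat \<times> ('o, 'a) opn, nat \<times> ('o, 'a) opn_tr) acat" where
  "B_bar B = cat.extend (B_bar_base B)
     \<lparr>tensor = mk_fctr (prod_cat (B_bar_base B) (B_bar_base B))
        (\<lambda>(f, g). opn_tensor B f g) (\<lambda>(s, t). opn_tr_tensor B s t),
      asc = restrict (\<lambda>(f, g, h). opn_asc B f g h)
        (Ob (B_bar_base B) \<times> Ob (B_bar_base B) \<times> Ob (B_bar_base B))\<rparr>"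

text \<open>\<open>B\<close> is identified with \<open>B\<^sup>1\<close> and \<open>B \<times> B\<close> with \<open>B\<^sup>2\<close>.\<close>

definition id_opn :: "('o, 'a) acat \<Rightarrow> ('o, 'a) opn" where
  "id_opn B = mk_fctr (power_cat B 1) (\<lambda>xs. xs ! 0) (\<lambda>us. us ! 0)"

definition tensor_opn :: "('o, 'a) acat \<Rightarrow> ('o, 'a) opn" where
  "tensor_opn B = mk_fctr (power_cat B 2)
     (\<lambda>xs. om (tensor B) (xs ! 0, xs ! 1)) (\<lambda>us. am (tensor B) (us ! 0, us ! 1))"

definition It_bar :: "('o, 'a) acat \<Rightarrow> (nat \<times> ('o, 'a) opn, nat \<times> ('o, 'a) opn_tr) acat" where
  "It_bar B = generated_acat (B_bar B) (1, id_opn B)"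

definition beta :: "('o, 'a) acat \<Rightarrow> nat \<times> ('o, 'a) opn_tr" where
  "beta B = asc (B_bar B) ((1, id_opn B), (1, id_opn B), (1, id_opn B))"

end

theory Submission
  imports Defs
begin

text \<open>
  \<open>A_bar\<close> is the free associative category on the object \<open>*\<close> of \<open>A\<^sub>1\<close>: for every associative
  category \<open>E\<close> and object \<open>e\<close> of \<open>E\<close> there is exactly one strict tensor functor sending \<open>*\<close> to \<open>e\<close>.
  Existence is by recursion on \<open>n\<close>.  On the summands \<open>A\<^sub>a \<times> A\<^sub>b\<close> the functor is forced to be
  \<open>(x, y) \<mapsto> H\<^sub>a x \<otimes> H\<^sub>b y\<close>; on \<open>A\<^sub>i \<times> A\<^sub>j \<times> A\<^sub>k \<times> I\<close> it is the natural isomorphism of \<open>E\<close>,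
  read as a functor out of a cylinder.  The two agree on the glued part, so the universal property
  of the pushout gives \<open>H\<^sub>n\<close>.  Uniqueness holds because \<open>*\<close> generates all objects and arrows of
  \<open>A_bar\<close> as an associative category.  Taking \<open>E\<close> to be the category of iterates and
  \<open>e = Id\<close>, the conditions on \<open>\<otimes>\<close> and \<open>\<beta>\<close> follow from strictness.
\<close>

section \<open>Functors and associative categories by components\<close>

text \<open>The universal property of the pushout asks for functors out of
  \<open>A_i \<times> A_j \<times> A_k \<times> I\<close>, whereas \<beta> is only a family of
  arrows. To make a functor of it one also needs the inverses, since I has an arrow from 1 to 0, and
  naturality to see that composites are respected. Agreement on the glued part requires H to send
  U(y, z) to the tensor of its values, at the indices j + k and i + j. So strictness on U must be
  carried through the recursion together with the functors, which is the role of
  \<open>extends_A\<close>. Uniqueness is an induction over \<open>gen_ob\<close> and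
  \<open>gen_ar\<close>, the same inductive sets that define the iterates. It rests on a
  factorisation: V(f, g, h, \<iota>) is the associator at the codomains after V(f, g, h, Id), and
  the gluing turns the latter into an iterated U. The target of the free functor is the category of
  iterates itself. It is associative in two steps: operations inherit the structure of B pointwise,
  and a generated subcategory keeps its associators invertible because their inverses are among the
  generators.\<close>

lemma is_functor_mkI:
  assumes "category C" "category D"
    and "\<And>x. x \<in> Ob C \<Longrightarrow> \<phi> x \<in> Ob D"
    and "\<And>f. f \<in> Ar C \<Longrightarrow> \<psi> f \<in> Ar D"
    and "\<And>f. f \<in> Ar C \<Longrightarrow> Dom D (\<psi> f) = \<phi> (Dom C f)"
    and "\<And>f. f \<in> Ar C \<Longrightarrow> Cod D (\<psi> f) = \<phi> (Cod C f)"
    and "\<And>x. x \<in> Ob C \<Longrightarrow> \<psi> (Idn C x) = Idn D (\<phi> x)"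
    and "\<And>f g. f \<in> Ar C \<Longrightarrow> g \<in> Ar C \<Longrightarrow> Cod C f = Dom C g \<Longrightarrow>
      \<psi> (Cmp C g f) = Cmp D (\<psi> g) (\<psi> f)"
  shows "is_functor C D (mk_fctr C \<phi> \<psi>)"
  using assms cat_ob[OF assms(1)] cat_idn[OF assms(1)] cat_cmp[OF assms(1)]
  by (auto simp: is_functor_def mk_fctr_def hom_def)

lemma is_functor_eq_mk: "is_functor C D F \<Longrightarrow> F = mk_fctr C (om F) (am F)"
  by (auto simp: is_functor_def mk_fctr_def PiE_iff extensional_restrict)

lemma functor_idn: "is_functor C D F \<Longrightarrow> x \<in> Ob C \<Longrightarrow> am F (Idn C x) = Idn D (om F x)"
  by (simp add: is_functor_def)

lemma functor_cmp:
  "is_functor C D F \<Longrightarrow> f \<in> Ar C \<Longrightarrow> g \<in> Ar C \<Longrightarrow> Cod C f = Dom C g \<Longrightarrow>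
    am F (Cmp C g f) = Cmp D (am F g) (am F f)"
  by (simp add: is_functor_def)

text \<open>Functors are undefined off the carriers of their source, so agreement on the carriers
  determines them; the targets enter only through functoriality and may differ.\<close>

lemma functor_eqI:
  assumes "is_functor C D F" "is_functor C D' G"
    and "\<And>x. x \<in> Ob C \<Longrightarrow> om F x = om G x" "\<And>f. f \<in> Ar C \<Longrightarrow> am F f = am G f"
  shows "F = G"
  using assms(3,4) is_functor_eq_mk[OF assms(1)] is_functor_eq_mk[OF assms(2)]
  by (metis mk_fctr_def restrict_ext)

lemma prod_cat_simps [simp]:
  "Ob (prod_cat C D) = Ob C \<times> Ob D" "Ar (prod_cat C D) = Ar C \<times> Ar D"
  "Dom (prod_cat C D) (f, g) = (Dom C f, Dom D g)" "Cod (prod_cat C D) (f, g) = (Cod C f, Cod D g)"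
  "Idn (prod_cat C D) (x, y) = (Idn C x, Idn D y)"
  "Cmp (prod_cat C D) (f', g') (f, g) = (Cmp C f' f, Cmp D g' g)"
  by (simp_all add: prod_cat_def)

lemma indiscrete_simps [simp]:
  "Ob (indiscrete S) = S" "Ar (indiscrete S) = S \<times> S"
  "Dom (indiscrete S) d = fst d" "Cod (indiscrete S) d = snd d"
  "Idn (indiscrete S) s = (s, s)" "Cmp (indiscrete S) d' d = (fst d, snd d')"
  by (simp_all add: indiscrete_def)

section \<open>Inverse arrows and their preservation by functors\<close>

lemma inverse_arrows_ar:
  assumes "inverse_arrows C f g"
  shows "f \<in> Ar C" "g \<in> Ar C" "Dom C g = Cod C f" "Cod C g = Dom C f"
    "Cmp C g f = Idn C (Dom C f)" "Cmp C f g = Idn C (Cod C f)"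
  using assms by (auto simp: inverse_arrows_def hom_def)

lemma inverse_arrows_unique:
  assumes C: "category C" and g: "inverse_arrows C f g" and h: "inverse_arrows C f h"
  shows "g = h"
proof -
  note gs = inverse_arrows_ar[OF g] and hs = inverse_arrows_ar[OF h]
  have "g = Cmp C (Cmp C h f) g"
    using cat_unit(2)[OF C gs(2)] gs hs by simp
  also have "\<dots> = Cmp C h (Cmp C f g)"
    using cat_assoc[OF C gs(2) gs(1) hs(2)] gs hs by simp
  also have "\<dots> = h"
    using cat_unit(1)[OF C hs(2)] gs hs by simp
  finally show ?thesis .
qed

lemma functor_inverse_arrows:
  assumes F: "is_functor C D F" and fg: "inverse_arrows C f g"
  shows "inverse_arrows D (am F f) (am F g)"
proof -
  have C: "category C" using F by (simp add: is_functor_def)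
  note s = inverse_arrows_ar[OF fg]
  show ?thesis
    unfolding inverse_arrows_def hom_def
    using functor_ar[OF F s(1)] functor_ar[OF F s(2)] s functor_cmp[OF F s(1,2)]
      functor_cmp[OF F s(2,1)] functor_idn[OF F] cat_ob[OF C s(1)]
    by simp
qed

text \<open>The functors in three variables and the naturality square are unfolded into equations
  between elements, so that each associative category below is verified by computing in its
  carriers. Extensionality is assumed separately because functors and transformations must be
  undefined off the carriers, which no equation on elements expresses.\<close>

lemma associative_categoryI:
  fixes B :: "('o, 'a) acat"
  assumes cat: "category B"
    and ext: "om (tensor B) \<in> extensional (Ob B \<times> Ob B)" "am (tensor B) \<in> extensional (Ar B \<times> Ar B)"
      "asc B \<in> extensional (Ob B \<times> Ob B \<times> Ob B)"
    and ob: "\<And>x y. x \<in> Ob B \<Longrightarrow> y \<in> Ob B \<Longrightarrow> om (tensor B) (x, y) \<in> Ob B"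
    and ar: "\<And>f g. f \<in> Ar B \<Longrightarrow> g \<in> Ar B \<Longrightarrow> am (tensor B) (f, g) \<in>
      hom B (om (tensor B) (Dom B f, Dom B g)) (om (tensor B) (Cod B f, Cod B g))"
    and idn: "\<And>x y. x \<in> Ob B \<Longrightarrow> y \<in> Ob B \<Longrightarrow>
      am (tensor B) (Idn B x, Idn B y) = Idn B (om (tensor B) (x, y))"
    and cmp: "\<And>f g f' g'. f \<in> Ar B \<Longrightarrow> g \<in> Ar B \<Longrightarrow> f' \<in> Ar B \<Longrightarrow> g' \<in> Ar B \<Longrightarrow>
      Cod B f = Dom B f' \<Longrightarrow> Cod B g = Dom B g' \<Longrightarrow>
      am (tensor B) (Cmp B f' f, Cmp B g' g) = Cmp B (am (tensor B) (f', g')) (am (tensor B) (f, g))"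
    and asc: "\<And>x y z. x \<in> Ob B \<Longrightarrow> y \<in> Ob B \<Longrightarrow> z \<in> Ob B \<Longrightarrow> asc B (x, y, z) \<in>
      hom B (om (tensor B) (x, om (tensor B) (y, z))) (om (tensor B) (om (tensor B) (x, y), z))"
    and iso: "\<And>x y z. x \<in> Ob B \<Longrightarrow> y \<in> Ob B \<Longrightarrow> z \<in> Ob B \<Longrightarrow> iso B (asc B (x, y, z))"
    and nat: "\<And>f g h. f \<in> Ar B \<Longrightarrow> g \<in> Ar B \<Longrightarrow> h \<in> Ar B \<Longrightarrow>
      Cmp B (asc B (Cod B f, Cod B g, Cod B h)) (am (tensor B) (f, am (tensor B) (g, h))) =
      Cmp B (am (tensor B) (am (tensor B) (f, g), h)) (asc B (Dom B f, Dom B g, Dom B h))"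
  shows "associative_category B"
proof -
  have arD: "am (tensor B) (f, g) \<in> Ar B"
    "Dom B (am (tensor B) (f, g)) = om (tensor B) (Dom B f, Dom B g)"
    "Cod B (am (tensor B) (f, g)) = om (tensor B) (Cod B f, Cod B g)"
    if "f \<in> Ar B" "g \<in> Ar B" for f g
    using ar[OF that] by (auto simp: hom_def)
  note facts = cat ob arD idn cmp cat_ob[OF cat] cat_idn[OF cat] cat_cmp[OF cat]
  have T: "is_functor (prod_cat B B) B (tensor B)"
    using facts ext category_prod[OF cat cat]
    by (auto simp: is_functor_def hom_def PiE_iff)
  have c3: "category (prod_cat B (prod_cat B B))"
    by (intro category_prod cat)
  have r: "is_functor (prod_cat B (prod_cat B B)) B (tensor_r B)"
    unfolding tensor_r_def by (rule is_functor_mkI) (use facts c3 in auto)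
  have l: "is_functor (prod_cat B (prod_cat B B)) B (tensor_l B)"
    unfolding tensor_l_def by (rule is_functor_mkI) (use facts c3 in auto)
  have "nat_iso (prod_cat B (prod_cat B B)) B (tensor_r B) (tensor_l B) (asc B)"
    unfolding nat_iso_def nat_trans_def
    using r l asc iso nat ext by (auto simp: tensor_r_def tensor_l_def mk_fctr_def)
  then show ?thesis
    using cat T by (simp add: associative_category_def)
qed

locale assoc_cat =
  fixes B :: "('o, 'a) acat"
  assumes assoc: "associative_category B"
begin

lemma cat: "category B"
  and functor_tensor: "is_functor (prod_cat B B) B (tensor B)"
  and nat_iso_asc: "nat_iso (prod_cat B (prod_cat B B)) B (tensor_r B) (tensor_l B) (asc B)"
  using assoc by (auto simp: associative_category_def)

lemma tensor_ob: "x \<in> Ob B \<Longrightarrow> y \<in> Ob B \<Longrightarrow> om (tensor B) (x, y) \<in> Ob B"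
  using functor_ob[OF functor_tensor] by simp

lemma tensor_ar:
  assumes "f \<in> Ar B" "g \<in> Ar B"
  shows "am (tensor B) (f, g) \<in> Ar B"
    "Dom B (am (tensor B) (f, g)) = om (tensor B) (Dom B f, Dom B g)"
    "Cod B (am (tensor B) (f, g)) = om (tensor B) (Cod B f, Cod B g)"
  using functor_ar[OF functor_tensor, of "(f, g)"] assms by simp_all

lemma tensor_idn:
  "x \<in> Ob B \<Longrightarrow> y \<in> Ob B \<Longrightarrow> am (tensor B) (Idn B x, Idn B y) = Idn B (om (tensor B) (x, y))"
  using functor_idn[OF functor_tensor, of "(x, y)"] by simp

lemma tensor_cmp:
  "f \<in> Ar B \<Longrightarrow> g \<in> Ar B \<Longrightarrow> f' \<in> Ar B \<Longrightarrow> g' \<in> Ar B \<Longrightarrow> Cod B f = Dom B f' \<Longrightarrow>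
    Cod B g = Dom B g' \<Longrightarrow>
    am (tensor B) (Cmp B f' f, Cmp B g' g) = Cmp B (am (tensor B) (f', g')) (am (tensor B) (f, g))"
  using functor_cmp[OF functor_tensor, of "(f, g)" "(f', g')"] by simp

lemma asc_ar:
  assumes "x \<in> Ob B" "y \<in> Ob B" "z \<in> Ob B"
  shows "asc B (x, y, z) \<in> Ar B"
    "Dom B (asc B (x, y, z)) = om (tensor B) (x, om (tensor B) (y, z))"
    "Cod B (asc B (x, y, z)) = om (tensor B) (om (tensor B) (x, y), z)"
    "iso B (asc B (x, y, z))"
  using nat_iso_asc assms
  by (auto simp: nat_iso_def nat_trans_def hom_def tensor_r_def tensor_l_def mk_fctr_def)

lemma asc_nat:
  assumes "f \<in> Ar B" "g \<in> Ar B" "h \<in> Ar B"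
  shows "Cmp B (asc B (Cod B f, Cod B g, Cod B h)) (am (tensor B) (f, am (tensor B) (g, h))) =
    Cmp B (am (tensor B) (am (tensor B) (f, g), h)) (asc B (Dom B f, Dom B g, Dom B h))"
proof -
  have "\<forall>f\<in>Ar (prod_cat B (prod_cat B B)).
      Cmp B (asc B (Cod (prod_cat B (prod_cat B B)) f)) (am (tensor_r B) f) =
      Cmp B (am (tensor_l B) f) (asc B (Dom (prod_cat B (prod_cat B B)) f))"
    using nat_iso_asc by (simp add: nat_iso_def nat_trans_def)
  from bspec[OF this, of "(f, g, h)"] show ?thesis
    using assms by (simp add: tensor_r_def tensor_l_def mk_fctr_def)
qed

end

section \<open>The associative category of Catalan groupoids\<close>

lemma category_catA: "1 \<le> n \<Longrightarrow> category (catA n)"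
  using catalan_functors by blast

lemma functor_funU:
  "1 \<le> a \<Longrightarrow> 1 \<le> b \<Longrightarrow> is_functor (prod_cat (catA a) (catA b)) (catA (a + b)) (funU a b)"
  using catalan_functors by blast

lemma functor_funV:
  "1 \<le> i \<Longrightarrow> 1 \<le> j \<Longrightarrow> 1 \<le> k \<Longrightarrow>
    is_functor (prod_cat (catA i) (prod_cat (catA j) (prod_cat (catA k) (indiscrete {0, 1}))))
      (catA (i + j + k)) (funV i j k)"
  using catalan_functors by blast

lemma catA_1:
  "Ob (catA 1) = {Star}" "Ar (catA 1) = {IdStar}" "Dom (catA 1) f = Star" "Cod (catA 1) f = Star"
  "Idn (catA 1) x = IdStar" "Cmp (catA 1) g f = IdStar"
  by (simp_all add: catA_def catalan.simps[of "Suc 0"] stage_one_def)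

lemma funU_ob:
  "1 \<le> a \<Longrightarrow> 1 \<le> b \<Longrightarrow> x \<in> Ob (catA a) \<Longrightarrow> y \<in> Ob (catA b) \<Longrightarrow> om (funU a b) (x, y) \<in> Ob (catA (a + b))"
  using functor_ob[OF functor_funU] by simp

lemma funU_ar:
  assumes "1 \<le> a" "1 \<le> b" "f \<in> Ar (catA a)" "g \<in> Ar (catA b)"
  shows "am (funU a b) (f, g) \<in> Ar (catA (a + b))"
    "Dom (catA (a + b)) (am (funU a b) (f, g)) = om (funU a b) (Dom (catA a) f, Dom (catA b) g)"
    "Cod (catA (a + b)) (am (funU a b) (f, g)) = om (funU a b) (Cod (catA a) f, Cod (catA b) g)"
  using functor_ar[OF functor_funU[OF assms(1,2)], of "(f, g)"] assms by simp_all

lemma funU_idn: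
  "1 \<le> a \<Longrightarrow> 1 \<le> b \<Longrightarrow> x \<in> Ob (catA a) \<Longrightarrow> y \<in> Ob (catA b) \<Longrightarrow>
    am (funU a b) (Idn (catA a) x, Idn (catA b) y) = Idn (catA (a + b)) (om (funU a b) (x, y))"
  using functor_idn[OF functor_funU, of a b "(x, y)"] by simp

lemma funU_cmp:
  "1 \<le> a \<Longrightarrow> 1 \<le> b \<Longrightarrow> f \<in> Ar (catA a) \<Longrightarrow> g \<in> Ar (catA b) \<Longrightarrow> f' \<in> Ar (catA a) \<Longrightarrow> g' \<in> Ar (catA b) \<Longrightarrow>
    Cod (catA a) f = Dom (catA a) f' \<Longrightarrow> Cod (catA b) g = Dom (catA b) g' \<Longrightarrow>
    am (funU a b) (Cmp (catA a) f' f, Cmp (catA b) g' g) =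
    Cmp (catA (a + b)) (am (funU a b) (f', g')) (am (funU a b) (f, g))"
  using functor_cmp[OF functor_funU, of a b "(f, g)" "(f', g')"] by simp

lemma funV_ar:
  assumes "1 \<le> i" "1 \<le> j" "1 \<le> k" "f \<in> Ar (catA i)" "g \<in> Ar (catA j)" "h \<in> Ar (catA k)"
    "d \<in> {0, 1}" "c \<in> {0, 1}"
  shows "am (funV i j k) (f, g, h, (d, c)) \<in> Ar (catA (i + j + k))"
    "Dom (catA (i + j + k)) (am (funV i j k) (f, g, h, (d, c))) =
      om (funV i j k) (Dom (catA i) f, Dom (catA j) g, Dom (catA k) h, d)"
    "Cod (catA (i + j + k)) (am (funV i j k) (f, g, h, (d, c))) =
      om (funV i j k) (Cod (catA i) f, Cod (catA j) g, Cod (catA k) h, c)"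
  using functor_ar[OF functor_funV[OF assms(1-3)], of "(f, g, h, (d, c))"] assms(4-8)
  by auto

lemma funV_cmp:
  assumes "1 \<le> i" "1 \<le> j" "1 \<le> k" "f \<in> Ar (catA i)" "g \<in> Ar (catA j)" "h \<in> Ar (catA k)"
    "f' \<in> Ar (catA i)" "g' \<in> Ar (catA j)" "h' \<in> Ar (catA k)"
    "Cod (catA i) f = Dom (catA i) f'" "Cod (catA j) g = Dom (catA j) g'"
    "Cod (catA k) h = Dom (catA k) h'" "d \<in> {0, 1}" "c \<in> {0, 1}" "e \<in> {0, 1}"
  shows "Cmp (catA (i + j + k)) (am (funV i j k) (f', g', h', (c, e)))
      (am (funV i j k) (f, g, h, (d, c))) =
    am (funV i j k) (Cmp (catA i) f' f, Cmp (catA j) g' g, Cmp (catA k) h' h, (d, e))"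
  using functor_cmp[OF functor_funV[OF assms(1-3)], of "(f, g, h, (d, c))" "(f', g', h', (c, e))"]
    assms(4-15) by auto

lemma funV_idn:
  assumes "1 \<le> i" "1 \<le> j" "1 \<le> k" "x \<in> Ob (catA i)" "y \<in> Ob (catA j)" "z \<in> Ob (catA k)" "e \<in> {0, 1}"
  shows "am (funV i j k) (Idn (catA i) x, Idn (catA j) y, Idn (catA k) z, (e, e)) =
    Idn (catA (i + j + k)) (om (funV i j k) (x, y, z, e))"
  using functor_idn[OF functor_funV[OF assms(1-3)], of "(x, y, z, e)"] assms(4-7) by simp

text \<open>Makes the whole theory of \<open>pushout_span\<close> available by interpretation. It
  holds for every n, but the pushout is \<open>catA n\<close> up to renaming only for n distinct
  from 1.\<close>

lemma pushout_span_catalan: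
  "pushout_span (span_X catalan n) (span_Y catalan n) (span_Z catalan n)
    (span_I catalan n) (span_W catalan n)"
  using functor_span[of n] catalan_functors by unfold_locales blast+

lemma span_simps:
  "Ob (span_X catalan n) = (SIGMA (i, j, k):triples n. Ob (catA i) \<times> Ob (catA j) \<times> Ob (catA k) \<times> {0, 1})"
  "Ar (span_X catalan n) =
    (SIGMA (i, j, k):triples n. Ar (catA i) \<times> Ar (catA j) \<times> Ar (catA k) \<times> {0, 1} \<times> {0, 1})"
  "Ob (span_Y catalan n) = (SIGMA (a, b):pairs n. Ob (catA a) \<times> Ob (catA b))"
  "Ar (span_Y catalan n) = (SIGMA (a, b):pairs n. Ar (catA a) \<times> Ar (catA b))"
  "Ob (span_Z catalan n) = (SIGMA (i, j, k):triples n. Ob (catA i) \<times> Ob (catA j) \<times> Ob (catA k) \<times> {0, 1})"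
  "Ar (span_Z catalan n) =
    (SIGMA (i, j, k):triples n. Ar (catA i) \<times> Ar (catA j) \<times> Ar (catA k) \<times> {(0, 0), (1, 1)})"
  by (auto simp: span_X_def span_Y_def span_Z_def coprod_cat_simps catA_def discrete_def)

text \<open>For these n the groupoid \<open>catA n\<close> is the pushout renamed by
  \<open>Cell\<close> and \<open>Word\<close>, so facts about the coprojection of the pushout pass
  to U.\<close>

lemma funU_eq_inr:
  fixes n
  defines "inY \<equiv> po_inr (span_X catalan n) (span_Y catalan n) (span_Z catalan n)
    (span_I catalan n) (span_W catalan n)"
  assumes "(a, b) \<in> pairs n"
  shows "x \<in> Ob (catA a) \<Longrightarrow> y \<in> Ob (catA b) \<Longrightarrow>
      om (funU a b) (x, y) = Cell (om inY ((a, b), (x, y)))"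
    "f \<in> Ar (catA a) \<Longrightarrow> g \<in> Ar (catA b) \<Longrightarrow>
      am (funU a b) (f, g) = Word (am inY ((a, b), (f, g)))"
  using assms(2) funU_eq[of a b n] by (auto simp: pairs_def mk_fctr_def inY_def)

lemma funV_eq_inl:
  fixes n
  defines "inX \<equiv> po_inl (span_X catalan n) (span_Y catalan n) (span_Z catalan n)
    (span_I catalan n) (span_W catalan n)"
  assumes "(i, j, k) \<in> triples n"
  shows "x \<in> Ob (catA i) \<Longrightarrow> y \<in> Ob (catA j) \<Longrightarrow> z \<in> Ob (catA k) \<Longrightarrow> e \<in> {0, 1} \<Longrightarrow>
      om (funV i j k) (x, y, z, e) = Cell (om inX ((i, j, k), (x, y, z, e)))"
    "f \<in> Ar (catA i) \<Longrightarrow> g \<in> Ar (catA j) \<Longrightarrow> h \<in> Ar (catA k) \<Longrightarrow> d \<in> {0, 1} \<times> {0, 1} \<Longrightarrow>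
      am (funV i j k) (f, g, h, d) = Word (am inX ((i, j, k), (f, g, h, d)))"
  using assms(2) funV_eq[of i j k n] by (auto simp: triples_def mk_fctr_def inX_def)

lemma span_W_simps:
  "((i, j, k), (x, y, z, e)) \<in> Ob (span_Z catalan n) \<Longrightarrow> om (span_W catalan n) ((i, j, k), (x, y, z, e)) =
    (if e = 0 then ((i, j + k), (x, om (funU j k) (y, z))) else ((i + j, k), (om (funU i j) (x, y), z)))"
  "((i, j, k), (f, g, h, d)) \<in> Ar (span_Z catalan n) \<Longrightarrow> am (span_W catalan n) ((i, j, k), (f, g, h, d)) =
    (if d = (0, 0) then ((i, j + k), (f, am (funU j k) (g, h))) else ((i + j, k), (am (funU i j) (f, g), h)))"
  by (simp_all add: span_W_def mk_fctr_def funU_def)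

lemma span_I_simps:
  "x \<in> Ob (span_Z catalan n) \<Longrightarrow> om (span_I catalan n) x = x"
  "f \<in> Ar (span_Z catalan n) \<Longrightarrow> am (span_I catalan n) f = f"
  by (simp_all add: span_I_def mk_fctr_def)

text \<open>This is the commuting square of the pushout at an object of its apex: the left leg keeps
  the object, and the right leg W turns the end 0 or 1 into one of the two bracketings.\<close>

lemma funV_ob_ends:
  assumes "1 \<le> i" "1 \<le> j" "1 \<le> k" "x \<in> Ob (catA i)" "y \<in> Ob (catA j)" "z \<in> Ob (catA k)"
  shows "om (funV i j k) (x, y, z, 0) = om (funU i (j + k)) (x, om (funU j k) (y, z))"
    "om (funV i j k) (x, y, z, 1) = om (funU (i + j) k) (om (funU i j) (x, y), z)"
proof -
  define n where "n = i + j + k"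
  interpret pushout_span "span_X catalan n" "span_Y catalan n" "span_Z catalan n"
    "span_I catalan n" "span_W catalan n" by (rule pushout_span_catalan)
  have m: "(i, j, k) \<in> triples n" "(i, j + k) \<in> pairs n" "(i + j, k) \<in> pairs n"
    using assms by (auto simp: triples_def pairs_def n_def)
  have Z: "((i, j, k), (x, y, z, e)) \<in> Ob (span_Z catalan n)" if "e \<in> {0, 1}" for e
    using that m assms by (simp add: span_simps)
  show "om (funV i j k) (x, y, z, 0) = om (funU i (j + k)) (x, om (funU j k) (y, z))"
    using commutes_ob[OF Z[of 0]] Z[of 0] m assms
    by (simp add: funV_eq_inl[where n = n] funU_eq_inr(1)[where n = n and b = "j + k"]
        span_I_simps span_W_simps funU_ob)
  show "om (funV i j k) (x, y, z, 1) = om (funU (i + j) k) (om (funU i j) (x, y), z)"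
    using commutes_ob[OF Z[of 1]] Z[of 1] m assms
    by (simp add: funV_eq_inl[where n = n] funU_eq_inr(1)[where n = n and a = "i + j"]
        span_I_simps span_W_simps funU_ob)
qed

text \<open>The same square on arrows. Only the identities of 0 and 1 are available, since the apex
  contains the discrete category.\<close>

lemma funV_ar_ends:
  assumes "1 \<le> i" "1 \<le> j" "1 \<le> k" "f \<in> Ar (catA i)" "g \<in> Ar (catA j)" "h \<in> Ar (catA k)"
  shows "am (funV i j k) (f, g, h, (0, 0)) = am (funU i (j + k)) (f, am (funU j k) (g, h))"
    "am (funV i j k) (f, g, h, (1, 1)) = am (funU (i + j) k) (am (funU i j) (f, g), h)"
proof -
  define n where "n = i + j + k"
  interpret pushout_span "span_X catalan n" "span_Y catalan n" "span_Z catalan n"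
    "span_I catalan n" "span_W catalan n" by (rule pushout_span_catalan)
  have m: "(i, j, k) \<in> triples n" "(i, j + k) \<in> pairs n" "(i + j, k) \<in> pairs n"
    using assms by (auto simp: triples_def pairs_def n_def)
  have Z: "((i, j, k), (f, g, h, d)) \<in> Ar (span_Z catalan n)" if "d \<in> {(0, 0), (1, 1)}" for d
    using that m assms by (simp add: span_simps)
  show "am (funV i j k) (f, g, h, (0, 0)) = am (funU i (j + k)) (f, am (funU j k) (g, h))"
    using commutes_ar[OF Z[of "(0, 0)"]] Z[of "(0, 0)"] m assms
    by (simp add: funV_eq_inl[where n = n] funU_eq_inr(2)[where n = n and b = "j + k"]
        span_I_simps span_W_simps funU_ar)
  show "am (funV i j k) (f, g, h, (1, 1)) = am (funU (i + j) k) (am (funU i j) (f, g), h)"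
    using commutes_ar[OF Z[of "(1, 1)"]] Z[of "(1, 1)"] m assms
    by (simp add: funV_eq_inl[where n = n] funU_eq_inr(2)[where n = n and a = "i + j"]
        span_I_simps span_W_simps funU_ar)
qed

section \<open>Tensor and associator of \<open>A_bar\<close>\<close>

lemma A_bar_simps:
  "Ob A_bar = (SIGMA n:{1..}. Ob (catA n))" "Ar A_bar = (SIGMA n:{1..}. Ar (catA n))"
  "1 \<le> n \<Longrightarrow> Dom A_bar (n, f) = (n, Dom (catA n) f)"
  "1 \<le> n \<Longrightarrow> Cod A_bar (n, f) = (n, Cod (catA n) f)"
  "1 \<le> n \<Longrightarrow> Idn A_bar (n, x) = (n, Idn (catA n) x)"
  "1 \<le> n \<Longrightarrow> Cmp A_bar (n, g) (n, f) = (n, Cmp (catA n) g f)"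
  by (simp_all add: A_bar_def A_base_def cat.defs coprod_cat_simps)

lemma A_bar_tensor:
  "1 \<le> i \<Longrightarrow> 1 \<le> j \<Longrightarrow> x \<in> Ob (catA i) \<Longrightarrow> y \<in> Ob (catA j) \<Longrightarrow>
    om (tensor A_bar) ((i, x), (j, y)) = (i + j, om (funU i j) (x, y))"
  "1 \<le> i \<Longrightarrow> 1 \<le> j \<Longrightarrow> f \<in> Ar (catA i) \<Longrightarrow> g \<in> Ar (catA j) \<Longrightarrow>
    am (tensor A_bar) ((i, f), (j, g)) = (i + j, am (funU i j) (f, g))"
  by (simp_all add: A_bar_def A_base_def cat.defs coprod_cat_simps mk_fctr_def)

lemma A_bar_asc:
  "1 \<le> i \<Longrightarrow> 1 \<le> j \<Longrightarrow> 1 \<le> k \<Longrightarrow> x \<in> Ob (catA i) \<Longrightarrow> y \<in> Ob (catA j) \<Longrightarrow> z \<in> Ob (catA k) \<Longrightarrow>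
    asc A_bar ((i, x), (j, y), (k, z)) =
      (i + j + k, am (funV i j k) (Idn (catA i) x, Idn (catA j) y, Idn (catA k) z, (0, 1)))"
  by (simp add: A_bar_def A_base_def cat.defs coprod_cat_simps iota_def)

lemma category_cong:
  assumes "category C" "Ob D = Ob C" "Ar D = Ar C" "Dom D = Dom C" "Cod D = Cod C"
    "Idn D = Idn C" "Cmp D = Cmp C"
  shows "category D"
  using assms by (simp add: category_def hom_def)

text \<open>V is functorial in its last variable, so the inverse of \<iota>, the pair (1, 0), gives
  the inverse of the associator.\<close>

lemma A_bar_asc_inverse:
  assumes "1 \<le> i" "1 \<le> j" "1 \<le> k" "x \<in> Ob (catA i)" "y \<in> Ob (catA j)" "z \<in> Ob (catA k)"
  shows "inverse_arrows A_bar (asc A_bar ((i, x), (j, y), (k, z)))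
    (i + j + k, am (funV i j k) (Idn (catA i) x, Idn (catA j) y, Idn (catA k) z, (1, 0)))"
proof -
  note c = category_catA[OF assms(1)] category_catA[OF assms(2)] category_catA[OF assms(3)]
  note I = cat_idn[OF c(1) assms(4)] cat_idn[OF c(2) assms(5)] cat_idn[OF c(3) assms(6)]
  have u: "Cmp (catA i) (Idn (catA i) x) (Idn (catA i) x) = Idn (catA i) x"
      "Cmp (catA j) (Idn (catA j) y) (Idn (catA j) y) = Idn (catA j) y"
      "Cmp (catA k) (Idn (catA k) z) (Idn (catA k) z) = Idn (catA k) z"
    using cat_unit(1)[OF c(1) I(1)] cat_unit(1)[OF c(2) I(4)] cat_unit(1)[OF c(3) I(7)] I by simp_all
  show ?thesis
    using assms I u
    by (simp add: inverse_arrows_def hom_def A_bar_asc A_bar_simps funV_ar funV_cmp funV_idn)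
qed

lemma associative_A_bar: "associative_category A_bar"
proof (rule associative_categoryI)
  have "category A_base"
    unfolding A_base_def by (rule category_coprod) (simp add: category_catA)
  then show c: "category A_bar"
    by (rule category_cong) (simp_all add: A_bar_def cat.defs)
  show "om (tensor A_bar) \<in> extensional (Ob A_bar \<times> Ob A_bar)"
    "am (tensor A_bar) \<in> extensional (Ar A_bar \<times> Ar A_bar)"
    "asc A_bar \<in> extensional (Ob A_bar \<times> Ob A_bar \<times> Ob A_bar)"
    by (simp_all add: A_bar_def cat.defs mk_fctr_def)
  fix x y assume xy: "x \<in> Ob A_bar" "y \<in> Ob A_bar"
  then show "om (tensor A_bar) (x, y) \<in> Ob A_bar"
    by (auto simp: A_bar_simps A_bar_tensor funU_ob)
  show "am (tensor A_bar) (Idn A_bar x, Idn A_bar y) = Idn A_bar (om (tensor A_bar) (x, y))"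
    using xy by (auto simp: A_bar_simps A_bar_tensor funU_idn cat_idn category_catA)
  fix z assume z: "z \<in> Ob A_bar"
  show "asc A_bar (x, y, z) \<in> hom A_bar (om (tensor A_bar) (x, om (tensor A_bar) (y, z)))
      (om (tensor A_bar) (om (tensor A_bar) (x, y), z))"
    using xy z by (auto simp: A_bar_simps A_bar_asc A_bar_tensor hom_def funV_ar funU_ob cat_idn
        category_catA funV_ob_ends[unfolded One_nat_def] simp flip: add.assoc)
  show "iso A_bar (asc A_bar (x, y, z))"
    using xy z A_bar_asc_inverse by (fastforce simp: A_bar_simps iso_def)
next
  fix f g assume fg: "f \<in> Ar A_bar" "g \<in> Ar A_bar"
  then show "am (tensor A_bar) (f, g) \<in> hom A_bar (om (tensor A_bar) (Dom A_bar f, Dom A_bar g))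
      (om (tensor A_bar) (Cod A_bar f, Cod A_bar g))"
    by (auto simp: A_bar_simps A_bar_tensor hom_def funU_ar cat_ob category_catA)
  show "am (tensor A_bar) (Cmp A_bar f' f, Cmp A_bar g' g) =
      Cmp A_bar (am (tensor A_bar) (f', g')) (am (tensor A_bar) (f, g))"
    if "f' \<in> Ar A_bar" "g' \<in> Ar A_bar" "Cod A_bar f = Dom A_bar f'" "Cod A_bar g = Dom A_bar g'" for f' g'
    using fg that by (auto simp: A_bar_simps A_bar_tensor funU_cmp cat_cmp category_catA)
  fix h assume h: "h \<in> Ar A_bar"
  obtain i j k f' g' h' where [simp]: "f = (i, f')" "g = (j, g')" "h = (k, h')"
    by (metis surj_pair)
  have n: "1 \<le> i" "1 \<le> j" "1 \<le> k" and A: "f' \<in> Ar (catA i)" "g' \<in> Ar (catA j)" "h' \<in> Ar (catA k)"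
    using fg h by (auto simp: A_bar_simps)
  note c = category_catA[OF n(1)] category_catA[OF n(2)] category_catA[OF n(3)]
  note o = cat_ob[OF c(1) A(1)] cat_ob[OF c(2) A(2)] cat_ob[OF c(3) A(3)]
  note V = funV_ar_ends[OF n A]
  \<comment> \<open>Both sides of the naturality square equal V(f, g, h, \<iota>): by functoriality
    of V, moving along f, g, h commutes with moving along \<iota>. The ends (0, 0) and (1, 1) are
    the two bracketed tensors.\<close>
  have "Cmp (catA (i + j + k))
      (am (funV i j k) (Idn (catA i) (Cod (catA i) f'), Idn (catA j) (Cod (catA j) g'),
        Idn (catA k) (Cod (catA k) h'), (0, 1))) (am (funV i j k) (f', g', h', (0, 0))) =
    am (funV i j k) (f', g', h', (0, 1))"
    using n A by (subst funV_cmp) (simp_all add: o cat_idn[OF c(1)] cat_idn[OF c(2)] cat_idn[OF c(3)]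
      cat_unit[OF c(1)] cat_unit[OF c(2)] cat_unit[OF c(3)])
  moreover have "Cmp (catA (i + j + k)) (am (funV i j k) (f', g', h', (1, 1)))
      (am (funV i j k) (Idn (catA i) (Dom (catA i) f'), Idn (catA j) (Dom (catA j) g'),
        Idn (catA k) (Dom (catA k) h'), (0, 1))) =
    am (funV i j k) (f', g', h', (0, 1))"
    using n A by (subst funV_cmp) (simp_all add: o cat_idn[OF c(1)] cat_idn[OF c(2)] cat_idn[OF c(3)]
      cat_unit[OF c(1)] cat_unit[OF c(2)] cat_unit[OF c(3)])
  ultimately show "Cmp A_bar (asc A_bar (Cod A_bar f, Cod A_bar g, Cod A_bar h))
      (am (tensor A_bar) (f, am (tensor A_bar) (g, h))) =
    Cmp A_bar (am (tensor A_bar) (am (tensor A_bar) (f, g), h))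
      (asc A_bar (Dom A_bar f, Dom A_bar g, Dom A_bar h))"
    using n A o V by (simp add: A_bar_simps A_bar_asc A_bar_tensor funU_ar flip: add.assoc)
qed

section \<open>Generation of \<open>A_bar\<close> by its one-leaf object\<close>

lemma catA_ob_cases:
  assumes "1 \<le> n" "n \<noteq> 1" "x \<in> Ob (catA n)"
  obtains a b y z where "1 \<le> a" "1 \<le> b" "n = a + b" "y \<in> Ob (catA a)" "z \<in> Ob (catA b)"
    "x = om (funU a b) (y, z)"
proof -
  interpret pushout_span "span_X catalan n" "span_Y catalan n" "span_Z catalan n"
    "span_I catalan n" "span_W catalan n" by (rule pushout_span_catalan)
  have "Ob (catA n) = Cell ` ob ` (Ob (span_X catalan n) <+> Ob (span_Y catalan n))"
    using catalan_eq_step[OF assms(2)]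
    by (simp add: catalan_pushout_def relabel_simps inj_Cell inj_Word Ob_P)
  then obtain u where u: "u \<in> Ob (span_X catalan n) <+> Ob (span_Y catalan n)" "x = Cell (ob u)"
    using assms(3) by auto
  from u(1) show thesis
  proof (rule PlusE)
    fix w assume w: "w \<in> Ob (span_Y catalan n)" "u = Inr w"
    then obtain a b y z where w': "w = ((a, b), (y, z))" "(a, b) \<in> pairs n" "y \<in> Ob (catA a)" "z \<in> Ob (catA b)"
      by (auto simp: span_simps)
    show thesis
      using that[of a b y z] w' u(2) w funU_eq_inr(1)[OF w'(2-4)] om_inr[OF w(1)]
      by (auto simp: pairs_def)
  next
    \<comment> \<open>The discrete and the indiscrete category have the same objects, so every
      object of this summand is glued to one in the image of some U.\<close>
    fix w assume w: "w \<in> Ob (span_X catalan n)" "u = Inl w"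
    then obtain i j k p q r e where w': "w = ((i, j, k), (p, q, r, e))" "(i, j, k) \<in> triples n"
        "p \<in> Ob (catA i)" "q \<in> Ob (catA j)" "r \<in> Ob (catA k)" "e \<in> {0, 1}"
      by (auto simp: span_simps)
    have n: "1 \<le> i" "1 \<le> j" "1 \<le> k" "n = i + j + k" using w'(2) by (auto simp: triples_def)
    have x: "x = om (funV i j k) (p, q, r, e)"
      using u w funV_eq_inl(1)[OF w'(2-6)] om_inl[OF w(1)] w' by simp
    show thesis
    proof (cases "e = 0")
      case True
      then show thesis
        using that[of i "j + k" p "om (funU j k) (q, r)"] n w' x funV_ob_ends(1)[OF n(1-3) w'(3-5)]
        by (simp add: funU_ob)
    next
      case False
      then have "e = 1" using w'(6) by simp
      then show thesis
        using that[of "i + j" k "om (funU i j) (p, q)" r] n w' x funV_ob_ends(2)[OF n(1-3) w'(3-5)]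
        by (simp add: funU_ob)
    qed
  qed
qed

text \<open>Arrows of the pushout are classes of composable words, so the induction runs over
  \<open>po_path\<close>: the empty word is an identity, and each letter comes from some U or V. The
  arguments of that U or V lie in lower groupoids, hence those two cases carry no hypothesis about
  \<open>Q\<close>.\<close>

lemma catA_ar_induct [consumes 3, case_names idn U V cmp]:
  assumes "1 \<le> n" "n \<noteq> 1" "f \<in> Ar (catA n)"
    and idn: "\<And>x. x \<in> Ob (catA n) \<Longrightarrow> Q (Idn (catA n) x)"
    and U: "\<And>a b g h. 1 \<le> a \<Longrightarrow> 1 \<le> b \<Longrightarrow> n = a + b \<Longrightarrow> g \<in> Ar (catA a) \<Longrightarrow> h \<in> Ar (catA b) \<Longrightarrow>
      Q (am (funU a b) (g, h))"
    and V: "\<And>i j k p q r d. 1 \<le> i \<Longrightarrow> 1 \<le> j \<Longrightarrow> 1 \<le> k \<Longrightarrow> n = i + j + k \<Longrightarrow>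
      p \<in> Ar (catA i) \<Longrightarrow> q \<in> Ar (catA j) \<Longrightarrow> r \<in> Ar (catA k) \<Longrightarrow> d \<in> {0, 1} \<times> {0, 1} \<Longrightarrow>
      Q (am (funV i j k) (p, q, r, d))"
    and cmp: "\<And>g h. g \<in> Ar (catA n) \<Longrightarrow> h \<in> Ar (catA n) \<Longrightarrow> Cod (catA n) g = Dom (catA n) h \<Longrightarrow>
      Q g \<Longrightarrow> Q h \<Longrightarrow> Q (Cmp (catA n) h g)"
  shows "Q f"
proof -
  interpret pushout_span "span_X catalan n" "span_Y catalan n" "span_Z catalan n"
    "span_I catalan n" "span_W catalan n" by (rule pushout_span_catalan)
  have eq: "catA n = relabel_cat Cell Word P"
    using catalan_eq_step[OF assms(2)] by (simp add: catalan_pushout_def)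
  note rs = relabel_simps[OF inj_Cell inj_Word]
  obtain u es v where f: "f = Word (ar (u, es, v))" "path u es v"
    using assms(3) by (auto simp: eq rs Ar_P)
  have "path u es v \<Longrightarrow> Q (Word (ar (u, es, v)))"
  proof (induction rule: po_path.induct)
    case (Nil u)
    then have "Cell (ob u) \<in> Ob (catA n)" by (auto simp: eq rs Ob_P)
    then show ?case using idn[of "Cell (ob u)"] by (simp add: eq rs Idn_P)
  next
    case (ConsX f es v)
    note p = path_inl[OF ConsX(1)]
    have f: "am inl f = ar (ob (Inl (Dom (span_X catalan n) f)), [Inl f], ob (Inl (Cod (span_X catalan n) f)))"
      by (rule am_inl[OF ConsX(1)])
    obtain i j k p' q r d where f': "f = ((i, j, k), (p', q, r, d))" "(i, j, k) \<in> triples n"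
        "p' \<in> Ar (catA i)" "q \<in> Ar (catA j)" "r \<in> Ar (catA k)" "d \<in> {0, 1} \<times> {0, 1}"
      using ConsX(1) by (auto simp: span_simps)
    have "Q (am (funV i j k) (p', q, r, d))"
      using V f' by (auto simp: triples_def)
    then have 1: "Q (Word (am inl f))"
      using funV_eq_inl(2)[OF f'(2-6)] f'(1) by simp
    \<comment> \<open>Words are in diagrammatic order: prepending a letter composes with it on the
      right.\<close>
    show ?case
      using cmp[OF _ _ _ 1 ConsX(3)] ConsX(2) p Cmp_P[OF p ConsX(2)]
      by (auto simp: eq rs Ar_P f Dom_P Cod_P)
  next
    case (ConsY f es v)
    note p = path_inr[OF ConsY(1)]
    have f: "am inr f = ar (ob (Inr (Dom (span_Y catalan n) f)), [Inr f], ob (Inr (Cod (span_Y catalan n) f)))"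
      by (rule am_inr[OF ConsY(1)])
    obtain a b g h where f': "f = ((a, b), (g, h))" "(a, b) \<in> pairs n"
        "g \<in> Ar (catA a)" "h \<in> Ar (catA b)"
      using ConsY(1) by (auto simp: span_simps)
    have "Q (am (funU a b) (g, h))"
      using U f' by (auto simp: pairs_def)
    then have 1: "Q (Word (am inr f))"
      using funU_eq_inr(2)[OF f'(2-4)] f'(1) by simp
    show ?case
      using cmp[OF _ _ _ 1 ConsY(3)] ConsY(2) p Cmp_P[OF p ConsY(2)]
      by (auto simp: eq rs Ar_P f Dom_P Cod_P)
  qed
  then show ?thesis using f by simp
qed

lemma A_bar_generated_ob: "Ob A_bar \<subseteq> gen_ob A_bar (1, star1)"
proof -
  have "1 \<le> n \<Longrightarrow> x \<in> Ob (catA n) \<Longrightarrow> (n, x) \<in> gen_ob A_bar (1, star1)" for n x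
  proof (induction n arbitrary: x rule: less_induct)
    case (less n)
    show ?case
    proof (cases "n = 1")
      case True
      then show ?thesis
        using less.prems catA_1 by (auto simp: star1_def intro: gen_ob.base)
    next
      case False
      then obtain a b y z where x: "1 \<le> a" "1 \<le> b" "n = a + b" "y \<in> Ob (catA a)" "z \<in> Ob (catA b)"
          "x = om (funU a b) (y, z)"
        using catA_ob_cases less.prems by metis
      then show ?thesis
        using gen_ob.tensor[OF less.IH[of a y] less.IH[of b z]] by (simp add: A_bar_tensor)
    qed
  qed
  then show ?thesis by (auto simp: A_bar_simps)
qed

text \<open>Strong induction on n, with an inner induction on words. Only the letters from V need an
  argument, because just V(Id, Id, Id, \<iota>) and its inverse are generators as they
  stand.\<close>

lemma A_bar_generated_ar: "Ar A_bar \<subseteq> gen_ar A_bar (1, star1)"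
proof -
  have ob: "(n, x) \<in> gen_ob A_bar (1, star1)" if "1 \<le> n" "x \<in> Ob (catA n)" for n x
    using A_bar_generated_ob that by (auto simp: A_bar_simps)
  have gen_idn: "(n, Idn (catA n) x) \<in> gen_ar A_bar (1, star1)" if "1 \<le> n" "x \<in> Ob (catA n)" for n x
    using gen_ar.idn[OF ob[OF that]] that by (simp add: A_bar_simps)
  have gen_cmp: "(n, Cmp (catA n) h g) \<in> gen_ar A_bar (1, star1)"
    if "1 \<le> n" "Cod (catA n) g = Dom (catA n) h"
      "(n, g) \<in> gen_ar A_bar (1, star1)" "(n, h) \<in> gen_ar A_bar (1, star1)" for n g h
    using gen_ar.cmp[OF that(3,4)] that by (simp add: A_bar_simps)
  have gen_U: "(a + b, am (funU a b) (g, h)) \<in> gen_ar A_bar (1, star1)"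
    if "1 \<le> a" "1 \<le> b" "g \<in> Ar (catA a)" "h \<in> Ar (catA b)"
      "(a, g) \<in> gen_ar A_bar (1, star1)" "(b, h) \<in> gen_ar A_bar (1, star1)" for a b g h
    using gen_ar.tensor[OF that(5,6)] that by (simp add: A_bar_tensor)
  have "1 \<le> n \<Longrightarrow> f \<in> Ar (catA n) \<Longrightarrow> (n, f) \<in> gen_ar A_bar (1, star1)" for n f
  proof (induction n arbitrary: f rule: less_induct)
    case (less n)
    show ?case
    proof (cases "n = 1")
      case True
      then have "(n, f) = (1, Idn (catA 1) Star)"
        using less.prems catA_1(2,5) by auto
      then show ?thesis
        using gen_idn[of 1 Star] catA_1(1) by simp
    next
      case False
      from less.prems(1) False less.prems(2) show ?thesis
      proof (induction rule: catA_ar_induct)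
        case (idn x)
        then show ?case using \<open>1 \<le> n\<close> by (intro gen_idn)
      next
        case (U a b g h)
        then show ?case
          using gen_U[of a b g h] less.IH[of a g] less.IH[of b h] by simp
      next
        case (cmp g h)
        then show ?case
          using gen_cmp[of n g h] \<open>1 \<le> n\<close> by simp
      next
        case (V i j k p q r d)
        note ijk = V(1-3) and n = V(4) and A = V(5-7)
        note c = category_catA[OF ijk(1)] category_catA[OF ijk(2)] category_catA[OF ijk(3)]
        note o = cat_ob[OF c(1) A(1)] cat_ob[OF c(2) A(2)] cat_ob[OF c(3) A(3)]
        note I = cat_idn[OF c(1) o(2)] cat_idn[OF c(2) o(4)] cat_idn[OF c(3) o(6)]
        have le: "i < n" "j < n" "k < n" "i + j < n" "j + k < n" using ijk n by auto
        have g: "(i, p) \<in> gen_ar A_bar (1, star1)" "(j, q) \<in> gen_ar A_bar (1, star1)"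
          "(k, r) \<in> gen_ar A_bar (1, star1)"
          using less.IH le ijk A by auto
        \<comment> \<open>Over an identity of I the gluing rewrites V as an iterated U, so closure
          under the tensor applies.\<close>
        have 0: "(n, am (funV i j k) (p, q, r, (0, 0))) \<in> gen_ar A_bar (1, star1)"
          unfolding funV_ar_ends(1)[OF ijk A]
          using gen_U[OF ijk(1), of "j + k" p "am (funU j k) (q, r)"] gen_U[OF ijk(2,3) A(2,3)] g ijk A n
          by (simp add: funU_ar add.assoc)
        have 1: "(n, am (funV i j k) (p, q, r, (1, 1))) \<in> gen_ar A_bar (1, star1)"
          unfolding funV_ar_ends(2)[OF ijk A]
          using gen_U[OF _ ijk(3), of "i + j" "am (funU i j) (p, q)" r] gen_U[OF ijk(1,2) A(1,2)] g ijk A n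
          by (simp add: funU_ar)
        have a: "(n, am (funV i j k) (Idn (catA i) (Cod (catA i) p), Idn (catA j) (Cod (catA j) q),
            Idn (catA k) (Cod (catA k) r), (0, 1))) \<in> gen_ar A_bar (1, star1)"
          using gen_ar.asc[OF ob[OF ijk(1) o(2)] ob[OF ijk(2) o(4)] ob[OF ijk(3) o(6)]] n ijk o
          by (simp add: A_bar_asc)
        have b: "(n, am (funV i j k) (Idn (catA i) (Cod (catA i) p), Idn (catA j) (Cod (catA j) q),
            Idn (catA k) (Cod (catA k) r), (1, 0))) \<in> gen_ar A_bar (1, star1)"
          using gen_ar.asc_inv[OF ob[OF ijk(1) o(2)] ob[OF ijk(2) o(4)] ob[OF ijk(3) o(6)]
              A_bar_asc_inverse[OF ijk o(2) o(4) o(6)]] n by simp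
        \<comment> \<open>Move along p, q, r at the end e, then from e to e' over the codomains. The
          second factor is the associator for (0, 1) and its inverse for (1, 0).\<close>
        have d: "am (funV i j k) (p, q, r, (e, e')) = Cmp (catA n)
            (am (funV i j k) (Idn (catA i) (Cod (catA i) p), Idn (catA j) (Cod (catA j) q),
              Idn (catA k) (Cod (catA k) r), (e, e'))) (am (funV i j k) (p, q, r, (e, e)))"
          if "e \<in> {0, 1}" "e' \<in> {0, 1}" for e e'
          unfolding n using funV_cmp[OF ijk A I(1) I(4) I(7), of e e e'] that I
          by (simp add: cat_unit(2)[OF c(1) A(1)] cat_unit(2)[OF c(2) A(2)] cat_unit(2)[OF c(3) A(3)])
        have "(n, am (funV i j k) (p, q, r, (0, 1))) \<in> gen_ar A_bar (1, star1)"
          using gen_cmp[OF \<open>1 \<le> n\<close> _ 0 a] d[of 0 1] n ijk A I by (simp add: funV_ar)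
        moreover have "(n, am (funV i j k) (p, q, r, (1, 0))) \<in> gen_ar A_bar (1, star1)"
          using gen_cmp[OF \<open>1 \<le> n\<close> _ 1 b] d[of 1 0] n ijk A I by (simp add: funV_ar)
        ultimately show ?case using 0 1 V(8) by auto
      qed
    qed
  qed
  then show ?thesis by (auto simp: A_bar_simps)
qed

section \<open>Generated subcategories and uniqueness of strict tensor functors\<close>

lemma gen_ob_subset:
  assumes "associative_category E" "x0 \<in> Ob E"
  shows "gen_ob E x0 \<subseteq> Ob E"
proof
  interpret assoc_cat E by unfold_locales (rule assms(1))
  show "x \<in> Ob E" if "x \<in> gen_ob E x0" for x
    using that by induction (auto intro: assms(2) tensor_ob)
qed

text \<open>The endpoints belong to the claim because the generated arrows must run between
  generated objects. For the inverse of an associator they are the endpoints of the associator,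
  exchanged.\<close>

lemma gen_ar_subset:
  assumes "associative_category E" "x0 \<in> Ob E" "f \<in> gen_ar E x0"
  shows "f \<in> Ar E \<and> Dom E f \<in> gen_ob E x0 \<and> Cod E f \<in> gen_ob E x0"
proof -
  interpret assoc_cat E by unfold_locales (rule assms(1))
  note ob = gen_ob_subset[OF assms(1,2), THEN subsetD]
  show ?thesis
    using assms(3)
    by induction (auto simp: cat_idn[OF cat] cat_cmp[OF cat] tensor_ar ob asc_ar
        inverse_arrows_ar intro: gen_ob.tensor)
qed

text \<open>Each rule of \<open>gen_ob\<close> and \<open>gen_ar\<close> is an operation that strict
  tensor functors preserve. The rule for inverses is the only one that is not an equation; there the
  uniqueness of inverses decides.\<close>

lemma strict_tensor_functor_unique:
  assumes P: "strict_tensor_functor C E P" and Q: "strict_tensor_functor C E Q"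
    and x0: "x0 \<in> Ob C" "om P x0 = om Q x0"
    and gen: "Ob C \<subseteq> gen_ob C x0" "Ar C \<subseteq> gen_ar C x0"
  shows "P = Q"
proof (rule functor_eqI)
  have C: "associative_category C" and E: "associative_category E"
    and FP: "is_functor C E P" and FQ: "is_functor C E Q"
    using P Q by (auto simp: strict_tensor_functor_def)
  show "is_functor C E P" "is_functor C E Q" by (fact FP FQ)+
  interpret C: assoc_cat C by unfold_locales (rule C)
  interpret E: assoc_cat E by unfold_locales (rule E)
  note ob_mem = gen_ob_subset[OF C x0(1), THEN subsetD]
  note ar_mem = gen_ar_subset[OF C x0(1)]
  have ob: "om P x = om Q x" if "x \<in> gen_ob C x0" for x
    using that
  proof induction
    case base show ?case by (fact x0(2))
  next
    case (tensor x y)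
    then show ?case
      using P Q ob_mem unfolding strict_tensor_functor_def by metis
  qed
  then show "om P x = om Q x" if "x \<in> Ob C" for x using that gen(1) by auto
  have agree_asc: "am P (asc C (x, y, z)) = am Q (asc C (x, y, z))"
    if "x \<in> gen_ob C x0" "y \<in> gen_ob C x0" "z \<in> gen_ob C x0" for x y z
    using P Q ob_mem ob that unfolding strict_tensor_functor_def by metis
  have "am P f = am Q f" if "f \<in> gen_ar C x0" for f
    using that
  proof induction
    case (idn x)
    then show ?case using functor_idn[OF FP] functor_idn[OF FQ] ob ob_mem by metis
  next
    case (cmp f g)
    then show ?case using functor_cmp[OF FP] functor_cmp[OF FQ] ar_mem by metis
  next
    case (tensor f g)
    then show ?case using P Q ar_mem unfolding strict_tensor_functor_def by metis
  next
    case (asc x y z)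
    then show ?case using agree_asc by simp
  next
    case (asc_inv x y z g)
    \<comment> \<open>The two images of \<open>g\<close> are inverse to one and the same arrow of E,
      hence equal.\<close>
    have "am P (acat.asc C (x, y, z)) = am Q (acat.asc C (x, y, z))"
      using agree_asc asc_inv by simp
    then show ?case
      using functor_inverse_arrows[OF FP asc_inv(4)] functor_inverse_arrows[OF FQ asc_inv(4)]
        inverse_arrows_unique[OF E.cat] by metis
  qed
  then show "am P f = am Q f" if "f \<in> Ar C" for f using that gen(2) by auto
qed

text \<open>All equations are inherited from E, so the work lies in closure: every object and arrow
  named by the axioms must be generated.\<close>

lemma associative_generated_acat:
  assumes E: "associative_category E" and x0: "x0 \<in> Ob E"
  shows "associative_category (generated_acat E x0)"
proof -
  interpret assoc_cat E by unfold_locales (rule E)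
  let ?G = "generated_acat E x0"
  have s: "Ob ?G = gen_ob E x0" "Ar ?G = gen_ar E x0" "Dom ?G = Dom E" "Cod ?G = Cod E"
    "Idn ?G = Idn E" "Cmp ?G = Cmp E"
    "om (tensor ?G) = restrict (om (tensor E)) (gen_ob E x0 \<times> gen_ob E x0)"
    "am (tensor ?G) = restrict (am (tensor E)) (gen_ar E x0 \<times> gen_ar E x0)"
    "asc ?G = restrict (asc E) (gen_ob E x0 \<times> gen_ob E x0 \<times> gen_ob E x0)"
    by (simp_all add: generated_acat_def)
  note ob = gen_ob_subset[OF E x0, THEN subsetD]
  have ar: "f \<in> Ar E" "Dom E f \<in> gen_ob E x0" "Cod E f \<in> gen_ob E x0" if "f \<in> gen_ar E x0" for f
    using gen_ar_subset[OF E x0 that] by auto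
  show ?thesis
  proof (rule associative_categoryI, unfold s)
    show "category ?G"
      using cat_unit[OF cat] cat_assoc[OF cat] cat_idn[OF cat] cat_cmp[OF cat] ob ar gen_ar.idn gen_ar.cmp
      by (auto simp: category_def hom_def s)
    fix x y assume xy: "x \<in> gen_ob E x0" "y \<in> gen_ob E x0"
    then show "restrict (om (tensor E)) (gen_ob E x0 \<times> gen_ob E x0) (x, y) \<in> gen_ob E x0"
      by (simp add: gen_ob.tensor)
    show "restrict (am (tensor E)) (gen_ar E x0 \<times> gen_ar E x0) (Idn E x, Idn E y) =
        Idn E (restrict (om (tensor E)) (gen_ob E x0 \<times> gen_ob E x0) (x, y))"
      using xy by (simp add: gen_ar.idn tensor_idn ob)
    fix z assume z: "z \<in> gen_ob E x0"
    show "restrict (asc E) (gen_ob E x0 \<times> gen_ob E x0 \<times> gen_ob E x0) (x, y, z) \<in> hom ?G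
        (restrict (om (tensor E)) (gen_ob E x0 \<times> gen_ob E x0)
          (x, restrict (om (tensor E)) (gen_ob E x0 \<times> gen_ob E x0) (y, z)))
        (restrict (om (tensor E)) (gen_ob E x0 \<times> gen_ob E x0)
          (restrict (om (tensor E)) (gen_ob E x0 \<times> gen_ob E x0) (x, y), z))"
      using xy z by (simp add: hom_def s gen_ob.tensor gen_ar.asc asc_ar ob)
    \<comment> \<open>The inverse taken in E is itself generated, so it is also an inverse inside
      the subcategory.\<close>
    obtain g where g: "inverse_arrows E (asc E (x, y, z)) g"
      using asc_ar(4)[OF ob[OF xy(1)] ob[OF xy(2)] ob[OF z]] by (auto simp: iso_def)
    then show "iso ?G (restrict (asc E) (gen_ob E x0 \<times> gen_ob E x0 \<times> gen_ob E x0) (x, y, z))"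
      using xy z gen_ar.asc_inv[OF xy z g] gen_ar.asc[OF xy z]
      by (auto simp: iso_def inverse_arrows_def hom_def s)
  next
    fix f g assume fg: "f \<in> gen_ar E x0" "g \<in> gen_ar E x0"
    then show "restrict (am (tensor E)) (gen_ar E x0 \<times> gen_ar E x0) (f, g) \<in> hom ?G
        (restrict (om (tensor E)) (gen_ob E x0 \<times> gen_ob E x0) (Dom E f, Dom E g))
        (restrict (om (tensor E)) (gen_ob E x0 \<times> gen_ob E x0) (Cod E f, Cod E g))"
      by (simp add: hom_def s gen_ar.tensor tensor_ar ar)
    show "restrict (am (tensor E)) (gen_ar E x0 \<times> gen_ar E x0) (Cmp E f' f, Cmp E g' g) =
        Cmp E (restrict (am (tensor E)) (gen_ar E x0 \<times> gen_ar E x0) (f', g'))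
          (restrict (am (tensor E)) (gen_ar E x0 \<times> gen_ar E x0) (f, g))"
      if "f' \<in> gen_ar E x0" "g' \<in> gen_ar E x0" "Cod E f = Dom E f'" "Cod E g = Dom E g'" for f' g'
      using fg that by (simp add: gen_ar.cmp tensor_cmp ar)
    fix h assume h: "h \<in> gen_ar E x0"
    show "Cmp E (restrict (asc E) (gen_ob E x0 \<times> gen_ob E x0 \<times> gen_ob E x0) (Cod E f, Cod E g, Cod E h))
        (restrict (am (tensor E)) (gen_ar E x0 \<times> gen_ar E x0)
          (f, restrict (am (tensor E)) (gen_ar E x0 \<times> gen_ar E x0) (g, h))) =
      Cmp E (restrict (am (tensor E)) (gen_ar E x0 \<times> gen_ar E x0)
          (restrict (am (tensor E)) (gen_ar E x0 \<times> gen_ar E x0) (f, g), h))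
        (restrict (asc E) (gen_ob E x0 \<times> gen_ob E x0 \<times> gen_ob E x0) (Dom E f, Dom E g, Dom E h))"
      using fg h by (simp add: gen_ar.tensor ar asc_nat)
  qed simp_all
qed

section \<open>The universal property of the Catalan groupoids\<close>

definition inverse_of :: "('o, 'a, 'e) cat_scheme \<Rightarrow> 'a \<Rightarrow> 'a" where
  "inverse_of C f = (SOME g. inverse_arrows C f g)"

lemma inverse_arrows_inverse_of: "iso C f \<Longrightarrow> inverse_arrows C f (inverse_of C f)"
  unfolding iso_def inverse_of_def by (rule someI_ex)

text \<open>A natural isomorphism \<open>F \<Rightarrow> G\<close> as a functor on \<open>C \<times> {0 \<cong> 1}\<close>.\<close>

definition cylinder ::
  "('o, 'a, 'e) cat_scheme \<Rightarrow> ('p, 'b, 'e2) cat_scheme \<Rightarrow> ('o, 'a, 'p, 'b) fctr \<Rightarrow>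
   ('o, 'a, 'p, 'b) fctr \<Rightarrow> ('o \<Rightarrow> 'b) \<Rightarrow> ('o \<times> nat, 'a \<times> nat \<times> nat, 'p, 'b) fctr" where
  "cylinder C D F G t = mk_fctr (prod_cat C (indiscrete {0, 1}))
     (\<lambda>(x, e). if e = 0 then om F x else om G x)
     (\<lambda>(f, d, c). if d = 0 then if c = 0 then am F f else Cmp D (t (Cod C f)) (am F f)
        else if c = 0 then Cmp D (inverse_of D (t (Cod C f))) (am G f) else am G f)"

lemma nat_iso_inverse_of:
  assumes t: "nat_iso C D F G t" and x: "x \<in> Ob C"
  shows "inverse_arrows D (t x) (inverse_of D (t x))"
    "t x \<in> Ar D" "Dom D (t x) = om F x" "Cod D (t x) = om G x"
  using t x by (auto simp: nat_iso_def nat_trans_def hom_def intro: inverse_arrows_inverse_of)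

text \<open>Writing s for the pointwise inverse of t, one has s (G f) = s (G f) t s = s t (F f) s =
  (F f) s. This serves both the cylinder and the inverse of t in the functor category.\<close>

lemma nat_iso_inverse_of_nat:
  assumes t: "nat_iso C D F G t" and f: "f \<in> Ar C"
  shows "Cmp D (inverse_of D (t (Cod C f))) (am G f) = Cmp D (am F f) (inverse_of D (t (Dom C f)))"
proof -
  have F: "is_functor C D F" and G: "is_functor C D G" and C: "category C" and D: "category D"
    using t by (auto simp: nat_iso_def nat_trans_def is_functor_def)
  define s where "s x = inverse_of D (t x)" for x
  note t_ar = nat_iso_inverse_of(2-4)[OF t]
  note s = inverse_arrows_ar(2-6)[OF nat_iso_inverse_of(1)[OF t], folded s_def]
  have nat: "Cmp D (t (Cod C f)) (am F f) = Cmp D (am G f) (t (Dom C f))"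
    using t f by (simp add: nat_iso_def nat_trans_def)
  note ars = functor_ar[OF F f] functor_ar[OF G f] t_ar s cat_ob[OF C f] cat_cmp[OF D]
  have unit: "Cmp D (Idn D y) h = h" if "h \<in> Ar D" "Cod D h = y" for y h
    using cat_unit(2)[OF D that(1)] that(2) by simp
  have unit': "Cmp D h (Idn D y) = h" if "h \<in> Ar D" "Dom D h = y" for y h
    using cat_unit(1)[OF D that(1)] that(2) by simp
  have "Cmp D (s (Cod C f)) (am G f) =
      Cmp D (s (Cod C f)) (Cmp D (am G f) (Cmp D (t (Dom C f)) (s (Dom C f))))"
    by (simp add: ars unit')
  also have "\<dots> = Cmp D (s (Cod C f)) (Cmp D (Cmp D (am G f) (t (Dom C f))) (s (Dom C f)))"
    by (subst cat_assoc[OF D, of "s (Dom C f)" "t (Dom C f)" "am G f"]) (simp_all add: ars)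
  also have "\<dots> = Cmp D (s (Cod C f)) (Cmp D (t (Cod C f)) (Cmp D (am F f) (s (Dom C f))))"
    by (simp add: ars flip: nat) (subst cat_assoc[OF D], simp_all add: ars)
  also have "\<dots> = Cmp D (am F f) (s (Dom C f))"
    by (subst cat_assoc[OF D]) (simp_all add: ars unit)
  finally show ?thesis unfolding s_def .
qed

lemma functor_cylinder:
  assumes t: "nat_iso C D F G t"
  shows "is_functor (prod_cat C (indiscrete {0, 1})) D (cylinder C D F G t)"
proof -
  have F: "is_functor C D F" and G: "is_functor C D G" and C: "category C" and D: "category D"
    using t by (auto simp: nat_iso_def nat_trans_def is_functor_def)
  define s where "s x = inverse_of D (t x)" for x
  note t_ar = nat_iso_inverse_of(2-4)[OF t]
  note s = inverse_arrows_ar(2-6)[OF nat_iso_inverse_of(1)[OF t], folded s_def]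
  have nat: "Cmp D (t (Cod C f)) (am F f) = Cmp D (am G f) (t (Dom C f))" if "f \<in> Ar C" for f
    using t that by (simp add: nat_iso_def nat_trans_def)
  note ars = functor_ar[OF F] functor_ar[OF G] functor_ob[OF F] functor_ob[OF G] t_ar s
    cat_ob[OF C] cat_idn[OF C] cat_cmp[OF C] cat_idn[OF D] cat_cmp[OF D] cat_ob[OF D]
  have unit: "Cmp D (Idn D y) h = h" if "h \<in> Ar D" "Cod D h = y" for y h
    using cat_unit(2)[OF D that(1)] that(2) by simp
  have nat': "Cmp D (s (Cod C f)) (am G f) = Cmp D (am F f) (s (Dom C f))" if "f \<in> Ar C" for f
    unfolding s_def by (rule nat_iso_inverse_of_nat[OF t that])
  \<comment> \<open>Every index other than 0 is read as the end 1, so \<open>comp\<close> can be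
    stated for arbitrary natural numbers d, c, e.\<close>
  let ?a = "\<lambda>f d c. if d = (0::nat) then if c = (0::nat) then am F f else Cmp D (t (Cod C f)) (am F f)
        else if c = 0 then Cmp D (s (Cod C f)) (am G f) else am G f"
  have comp: "?a (Cmp C g f) d e = Cmp D (?a g c e) (?a f d c)"
    if fg: "f \<in> Ar C" "g \<in> Ar C" "Cod C f = Dom C g" for f g d c e
  proof -
    have a: "Cmp D (Cmp D x y) z = Cmp D x (Cmp D y z)"
      if "z \<in> Ar D" "y \<in> Ar D" "x \<in> Ar D" "Cod D z = Dom D y" "Cod D y = Dom D x" for x y z
      using cat_assoc[OF D that] by simp
    have st: "Cmp D (s x) (Cmp D (t x) h) = h" if "h \<in> Ar D" "Cod D h = om F x" "x \<in> Ob C" for h x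
      using that by (subst cat_assoc[OF D]) (simp_all add: ars unit)
    have ts: "Cmp D (t x) (Cmp D (s x) h) = h" if "h \<in> Ar D" "Cod D h = om G x" "x \<in> Ob C" for h x
      using that by (subst cat_assoc[OF D]) (simp_all add: ars unit)
    \<comment> \<open>With composites nested to the right, \<open>n1\<close> and \<open>n2\<close>
      move the components of t and s to the left past the images of g, where \<open>st\<close> and
      \<open>ts\<close> cancel them. The eight cases for (d, c, e) then reduce to functoriality of F
      and G.\<close>
    have n1: "Cmp D (am G g) (Cmp D (t (Dom C g)) h) = Cmp D (t (Cod C g)) (Cmp D (am F g) h)"
      if "h \<in> Ar D" "Cod D h = om F (Dom C g)" for h
      using cat_assoc[OF D, of h "t (Dom C g)" "am G g"] cat_assoc[OF D, of h "am F g" "t (Cod C g)"]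
        that fg nat[OF fg(2)] by (simp add: ars)
    have n2: "Cmp D (am F g) (Cmp D (s (Dom C g)) h) = Cmp D (s (Cod C g)) (Cmp D (am G g) h)"
      if "h \<in> Ar D" "Cod D h = om G (Dom C g)" for h
      using cat_assoc[OF D, of h "s (Dom C g)" "am F g"] cat_assoc[OF D, of h "am G g" "s (Cod C g)"]
        that fg nat'[OF fg(2)] by (simp add: ars)
    show ?thesis
      using fg by (simp add: ars a st ts n1 n2 functor_cmp[OF F] functor_cmp[OF G])
  qed
  show ?thesis
    unfolding cylinder_def s_def[symmetric]
  proof (rule is_functor_mkI, goal_cases)
    case (8 f g)
    obtain f' d c g' c' e where fg: "f = (f', d, c)" "g = (g', c', e)"
      by (metis surj_pair)
    show ?case
      using 8 comp[of f' g' d e c] unfolding fg by simp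
  qed (use C D in \<open>auto intro!: category_prod category_indiscrete
      simp: ars functor_idn[OF F] functor_idn[OF G]\<close>)
qed

section \<open>Functors out of coproducts and relabelled categories\<close>

lemma functor_copair:
  assumes D: "category D" and C: "\<And>i. i \<in> I \<Longrightarrow> is_functor (C i) D (F i)"
  shows "is_functor (coprod_cat I C) D
    (mk_fctr (coprod_cat I C) (\<lambda>(i, x). om (F i) x) (\<lambda>(i, f). am (F i) f))"
proof (rule is_functor_mkI)
  show "category (coprod_cat I C)"
    using C by (intro category_coprod) (simp add: is_functor_def)
qed (use D C in \<open>auto simp: coprod_cat_simps functor_ob[OF C] functor_ar[OF C] functor_idn[OF C] functor_cmp[OF C]\<close>)

lemma functor_relabel_source:
  assumes F: "is_functor C D F" and pq: "inj p" "inj q"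
  shows "is_functor (relabel_cat p q C) D
    (mk_fctr (relabel_cat p q C) (\<lambda>x. om F (inv p x)) (\<lambda>f. am F (inv q f)))"
proof (rule is_functor_mkI)
  show "category (relabel_cat p q C)"
    using F pq by (intro category_relabel) (auto simp: is_functor_def)
qed (use F pq in \<open>auto simp: relabel_simps[OF pq] inj_eq functor_ob[OF F] functor_ar[OF F] functor_idn[OF F]
    functor_cmp[OF F] is_functor_def\<close>)

text \<open>The universal property of the pushout speaks of plain category records, while the target
  here also carries a tensor and an associator. Being a functor depends on the category fields
  alone.\<close>

lemma is_functor_truncate: "is_functor C (cat.truncate D) F \<longleftrightarrow> is_functor C D F"
  by (simp add: is_functor_def category_def hom_def cat.defs)

text \<open>
  The conditions on \<open>K\<close> as the \<open>n\<close>-th component of a strict tensor functor whose components below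
  \<open>n\<close> are given by \<open>H\<close>.
\<close>

definition extends_A ::
  "('o, 'a) acat \<Rightarrow> 'o \<Rightarrow> (nat \<Rightarrow> (ct_ob, ct_ar, 'o, 'a) fctr) \<Rightarrow> nat \<Rightarrow>
   (ct_ob, ct_ar, 'o, 'a) fctr \<Rightarrow> bool" where
  "extends_A E e H n K \<longleftrightarrow>
     (1 \<le> n \<longrightarrow> is_functor (catA n) E K) \<and> (n = 1 \<longrightarrow> om K star1 = e) \<and>
     (\<forall>a b x y. 1 \<le> a \<longrightarrow> 1 \<le> b \<longrightarrow> n = a + b \<longrightarrow> x \<in> Ob (catA a) \<longrightarrow> y \<in> Ob (catA b) \<longrightarrow>
        om K (om (funU a b) (x, y)) = om (tensor E) (om (H a) x, om (H b) y)) \<and>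
     (\<forall>a b f g. 1 \<le> a \<longrightarrow> 1 \<le> b \<longrightarrow> n = a + b \<longrightarrow> f \<in> Ar (catA a) \<longrightarrow> g \<in> Ar (catA b) \<longrightarrow>
        am K (am (funU a b) (f, g)) = am (tensor E) (am (H a) f, am (H b) g)) \<and>
     (\<forall>i j k x y z. 1 \<le> i \<longrightarrow> 1 \<le> j \<longrightarrow> 1 \<le> k \<longrightarrow> n = i + j + k \<longrightarrow>
        x \<in> Ob (catA i) \<longrightarrow> y \<in> Ob (catA j) \<longrightarrow> z \<in> Ob (catA k) \<longrightarrow>
        am K (am (funV i j k) (Idn (catA i) x, Idn (catA j) y, Idn (catA k) z, (0, 1))) =
        asc E (om (H i) x, om (H j) y, om (H k) z))"

section \<open>Recursive construction of the free functor\<close>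

context assoc_cat
begin

abbreviation "assoc_cyl \<equiv> cylinder (prod_cat B (prod_cat B B)) B (tensor_r B) (tensor_l B) (asc B)"

lemma functor_assoc_cyl:
  "is_functor (prod_cat (prod_cat B (prod_cat B B)) (indiscrete {0, 1})) B assoc_cyl"
  by (rule functor_cylinder[OF nat_iso_asc])

text \<open>\<open>G\<close> and \<open>F\<close> are functors on the two corners of the span, and K
  is the functor they induce on the pushout. The recursion hypothesis gives the functors H at
  smaller indices and, through \<open>HU\<close> and \<open>HUa\<close>, their values on the image
  of U.\<close>

lemma extends_A_step:
  assumes e: "e \<in> Ob B" and H: "\<And>m. m < n \<Longrightarrow> extends_A B e H m (H m)"
  shows "\<exists>K. extends_A B e H n K"
proof -
  consider "n = 0" | "n = 1" | "n \<ge> 2" by linarith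
  then show ?thesis
  proof cases
    case 1
    \<comment> \<open>Every clause is vacuous at 0; the case arises because the recursion runs over
      all natural numbers.\<close>
    then show ?thesis by (simp add: extends_A_def)
  next
    case 2
    have "is_functor (catA 1) B (mk_fctr (catA 1) (\<lambda>_. e) (\<lambda>_. Idn B e))"
      using cat_unit(1)[OF cat cat_idn(1)[OF cat e]]
      by (intro is_functor_mkI) (simp_all add: category_catA cat e catA_1[unfolded One_nat_def] cat_idn[OF cat e])
    moreover have "om (mk_fctr (catA 1) (\<lambda>_. e) (\<lambda>_. Idn B e)) star1 = e"
      using catA_1(1) by (simp add: mk_fctr_def star1_def)
    ultimately show ?thesis
      using 2 unfolding extends_A_def by (intro exI[of _ "mk_fctr (catA 1) (\<lambda>_. e) (\<lambda>_. Idn B e)"]) auto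
  next
    case 3
    interpret pushout_span "span_X catalan n" "span_Y catalan n" "span_Z catalan n"
      "span_I catalan n" "span_W catalan n" by (rule pushout_span_catalan)
    have eq: "catA n = relabel_cat Cell Word P"
      using catalan_eq_step[of n] 3 by (simp add: catalan_pushout_def)
    have fH: "is_functor (catA m) B (H m)" if "1 \<le> m" "m < n" for m
      using H[OF that(2)] that(1) by (simp add: extends_A_def)
    have HU: "om (H (a + b)) (om (funU a b) (x, y)) = om (tensor B) (om (H a) x, om (H b) y)"
      if "1 \<le> a" "1 \<le> b" "a + b < n" "x \<in> Ob (catA a)" "y \<in> Ob (catA b)" for a b x y
      using H[OF that(3)] that by (simp add: extends_A_def)
    have HUa: "am (H (a + b)) (am (funU a b) (f, g)) = am (tensor B) (am (H a) f, am (H b) g)"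
      if "1 \<le> a" "1 \<le> b" "a + b < n" "f \<in> Ar (catA a)" "g \<in> Ar (catA b)" for a b f g
      using H[OF that(3)] that by (simp add: extends_A_def)

    define GY where "GY = (\<lambda>(a, b). mk_fctr (prod_cat (catA a) (catA b))
      (\<lambda>(x, y). om (tensor B) (om (H a) x, om (H b) y))
      (\<lambda>(f, g). am (tensor B) (am (H a) f, am (H b) g)))"
    have GY: "is_functor (prod_cat (catA a) (catA b)) B (GY (a, b))" if "(a, b) \<in> pairs n" for a b
    proof -
      have ab: "1 \<le> a" "1 \<le> b" "a < n" "b < n" using that by (auto simp: pairs_def)
      note c = category_catA[OF ab(1)] category_catA[OF ab(2)]
      note F = fH[OF ab(1,3)] fH[OF ab(2,4)]
      note s = functor_ob[OF F(1)] functor_ar[OF F(1)] functor_idn[OF F(1)] functor_cmp[OF F(1)]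
        functor_ob[OF F(2)] functor_ar[OF F(2)] functor_idn[OF F(2)] functor_cmp[OF F(2)]
        tensor_ob tensor_ar tensor_idn tensor_cmp cat category_prod c
      show ?thesis
        unfolding GY_def prod.case by (rule is_functor_mkI) (auto simp: s)
    qed
    define G where "G = mk_fctr (span_Y catalan n) (\<lambda>(i, x). om (GY i) x) (\<lambda>(i, f). am (GY i) f)"
    have FG: "is_functor (span_Y catalan n) B G"
      unfolding G_def span_Y_def
      by (rule functor_copair) (use GY cat in \<open>auto simp flip: catA_def\<close>)
    have G_ob: "om G ((a, b), (x, y)) = om (tensor B) (om (H a) x, om (H b) y)"
      if "(a, b) \<in> pairs n" "x \<in> Ob (catA a)" "y \<in> Ob (catA b)" for a b x y
      using that by (simp add: G_def GY_def mk_fctr_def span_simps)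
    have G_ar: "am G ((a, b), (f, g)) = am (tensor B) (am (H a) f, am (H b) g)"
      if "(a, b) \<in> pairs n" "f \<in> Ar (catA a)" "g \<in> Ar (catA b)" for a b f g
      using that by (simp add: G_def GY_def mk_fctr_def span_simps)

    \<comment> \<open>The cylinder expects the triple bundled apart from the end, so this is
      \<open>H_i \<times> H_j \<times> H_k \<times> I\<close> followed by a rebracketing of tuples
      and \<open>assoc_cyl\<close>.\<close>
    define FX where "FX = (\<lambda>(i, j, k).
      mk_fctr (prod_cat (catA i) (prod_cat (catA j) (prod_cat (catA k) (indiscrete {0, 1}))))
      (\<lambda>(x, y, z, e). om assoc_cyl ((om (H i) x, om (H j) y, om (H k) z), e))
      (\<lambda>(f, g, h, d). am assoc_cyl ((am (H i) f, am (H j) g, am (H k) h), d)))"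
    have FX: "is_functor (prod_cat (catA i) (prod_cat (catA j) (prod_cat (catA k) (indiscrete {0, 1})))) B
        (FX (i, j, k))" if "(i, j, k) \<in> triples n" for i j k
    proof -
      have ijk: "1 \<le> i" "1 \<le> j" "1 \<le> k" "i < n" "j < n" "k < n"
        using that by (auto simp: triples_def)
      note c = category_catA[OF ijk(1)] category_catA[OF ijk(2)] category_catA[OF ijk(3)]
      note F = fH[OF ijk(1,4)] fH[OF ijk(2,5)] fH[OF ijk(3,6)]
      note s = functor_ob[OF F(1)] functor_ar[OF F(1)] functor_idn[OF F(1)] functor_cmp[OF F(1)]
        functor_ob[OF F(2)] functor_ar[OF F(2)] functor_idn[OF F(2)] functor_cmp[OF F(2)]
        functor_ob[OF F(3)] functor_ar[OF F(3)] functor_idn[OF F(3)] functor_cmp[OF F(3)]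
      note C = functor_assoc_cyl
      have C_idn: "am assoc_cyl ((Idn B x, Idn B y, Idn B z), (e, e)) = Idn B (om assoc_cyl ((x, y, z), e))"
        if "x \<in> Ob B" "y \<in> Ob B" "z \<in> Ob B" "e \<in> {0, 1}" for x y z e
        using functor_idn[OF C, of "((x, y, z), e)"] that by simp
      have C_cmp: "am assoc_cyl ((Cmp B f' f, Cmp B g' g, Cmp B h' h), (d, c')) =
          Cmp B (am assoc_cyl ((f', g', h'), (c, c'))) (am assoc_cyl ((f, g, h), (d, c)))"
        if "f \<in> Ar B" "g \<in> Ar B" "h \<in> Ar B" "f' \<in> Ar B" "g' \<in> Ar B" "h' \<in> Ar B"
          "Cod B f = Dom B f'" "Cod B g = Dom B g'" "Cod B h = Dom B h'"
          "d \<in> {0, 1}" "c \<in> {0, 1}" "c' \<in> {0, 1}" for f g h f' g' h' d c c'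
        using functor_cmp[OF C, of "((f, g, h), (d, c))" "((f', g', h'), (c, c'))"] that by auto
      show ?thesis
        unfolding FX_def prod.case
      proof (rule is_functor_mkI, goal_cases)
        case (7 x)
        then show ?case by (auto simp: s C_idn)
      next
        case (8 f g)
        obtain f1 f2 f3 d c where f: "f = (f1, f2, f3, (d, c))" by (metis surj_pair)
        obtain g1 g2 g3 c' d' where g: "g = (g1, g2, g3, (c', d'))" by (metis surj_pair)
        show ?case
          using 8 unfolding f g by (auto simp: s intro!: C_cmp)
      qed (use c in \<open>auto intro!: category_prod category_indiscrete functor_ob[OF C] functor_ar(1)[OF C]
          simp: cat s functor_ar(2,3)[OF C]\<close>)
    qed
    define F where "F = mk_fctr (span_X catalan n) (\<lambda>(i, x). om (FX i) x) (\<lambda>(i, f). am (FX i) f)"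
    have FF: "is_functor (span_X catalan n) B F"
      unfolding F_def span_X_def
      by (rule functor_copair) (use FX cat in \<open>auto simp flip: catA_def\<close>)
    have F_ob: "om F ((i, j, k), (x, y, z, e)) = om assoc_cyl ((om (H i) x, om (H j) y, om (H k) z), e)"
      if "(i, j, k) \<in> triples n" "x \<in> Ob (catA i)" "y \<in> Ob (catA j)" "z \<in> Ob (catA k)" "e \<in> {0, 1}"
      for i j k x y z e
      using that by (auto simp: F_def FX_def mk_fctr_def span_simps)
    have F_ar: "am F ((i, j, k), (f, g, h, d)) = am assoc_cyl ((am (H i) f, am (H j) g, am (H k) h), d)"
      if "(i, j, k) \<in> triples n" "f \<in> Ar (catA i)" "g \<in> Ar (catA j)" "h \<in> Ar (catA k)" "d \<in> {0, 1} \<times> {0, 1}"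
      for i j k f g h d
      using that by (auto simp: F_def FX_def mk_fctr_def span_simps)
    \<comment> \<open>The ends of the cylinder are the two bracketings, in the same order in which W
      attaches them to 0 and 1.\<close>
    have cyl_ob: "om assoc_cyl ((x, y, z), 0) = om (tensor B) (x, om (tensor B) (y, z))"
        "om assoc_cyl ((x, y, z), 1) = om (tensor B) (om (tensor B) (x, y), z)"
      if "x \<in> Ob B" "y \<in> Ob B" "z \<in> Ob B" for x y z
      using that by (simp_all add: cylinder_def mk_fctr_def tensor_r_def tensor_l_def)
    have cyl_ar: "am assoc_cyl ((f, g, h), (0, 0)) = am (tensor B) (f, am (tensor B) (g, h))"
        "am assoc_cyl ((f, g, h), (1, 1)) = am (tensor B) (am (tensor B) (f, g), h)"
        "am assoc_cyl ((f, g, h), (0, 1)) =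
          Cmp B (asc B (Cod B f, Cod B g, Cod B h)) (am (tensor B) (f, am (tensor B) (g, h)))"
      if "f \<in> Ar B" "g \<in> Ar B" "h \<in> Ar B" for f g h
      using that by (simp_all add: cylinder_def mk_fctr_def tensor_r_def tensor_l_def)

    have m: "1 \<le> i" "1 \<le> j" "1 \<le> k" "i < n" "j < n" "k < n" "i + j < n" "j + k < n"
        "(i, j + k) \<in> pairs n" "(i + j, k) \<in> pairs n" if "(i, j, k) \<in> triples n" for i j k
      using that by (auto simp: triples_def pairs_def)
    \<comment> \<open>On the right, G meets H at j + k or at i + j on an object U(_, _). Both sums
      are below n, so \<open>HU\<close> unfolds it to the inner tensor found at the matching end of
      the cylinder.\<close>
    have agree_ob: "om F (om (span_I catalan n) z) = om G (om (span_W catalan n) z)"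
      if z: "z \<in> Ob (span_Z catalan n)" for z
    proof -
      obtain i j k p q r e where z': "z = ((i, j, k), (p, q, r, e))" and t: "(i, j, k) \<in> triples n"
          and o: "p \<in> Ob (catA i)" "q \<in> Ob (catA j)" "r \<in> Ob (catA k)" and e: "e = 0 \<or> e = 1"
        using z by (auto simp: span_simps)
      note m = m[OF t]
      have "om (H i) p \<in> Ob B" "om (H j) q \<in> Ob B" "om (H k) r \<in> Ob B"
        using functor_ob[OF fH] m o by auto
      then show ?thesis
        using z e m o t cyl_ob unfolding z'
        by (auto simp: span_I_simps span_W_simps F_ob G_ob HU funU_ob)
    qed
    have agree_ar: "am F (am (span_I catalan n) z) = am G (am (span_W catalan n) z)"
      if z: "z \<in> Ar (span_Z catalan n)" for z
    proof -
      obtain i j k p q r d where z': "z = ((i, j, k), (p, q, r, d))" and t: "(i, j, k) \<in> triples n"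
          and o: "p \<in> Ar (catA i)" "q \<in> Ar (catA j)" "r \<in> Ar (catA k)" and d: "d = (0, 0) \<or> d = (1, 1)"
        using z by (auto simp: span_simps)
      note m = m[OF t]
      have "am (H i) p \<in> Ar B" "am (H j) q \<in> Ar B" "am (H k) r \<in> Ar B"
        using functor_ar(1)[OF fH] m o by auto
      then show ?thesis
        using z d m o t cyl_ar unfolding z'
        by (auto simp: span_I_simps span_W_simps F_ar G_ar HUa funU_ar)
    qed
    obtain K0 where K0: "is_functor P B K0"
        "\<And>x. x \<in> Ob (span_X catalan n) \<Longrightarrow> om K0 (om inl x) = om F x"
        "\<And>f. f \<in> Ar (span_X catalan n) \<Longrightarrow> am K0 (am inl f) = am F f"
        "\<And>y. y \<in> Ob (span_Y catalan n) \<Longrightarrow> om K0 (om inr y) = om G y"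
        "\<And>g. g \<in> Ar (span_Y catalan n) \<Longrightarrow> am K0 (am inr g) = am G g"
      using universal[of "cat.truncate B" F G] FF FG agree_ob agree_ar
      unfolding is_functor_truncate by blast
    \<comment> \<open>The inverses of the constructors undo the renaming between
      \<open>catA n\<close> and the pushout.\<close>
    define K where "K = mk_fctr (catA n) (\<lambda>x. om K0 (inv Cell x)) (\<lambda>f. am K0 (inv Word f))"
    have FK: "is_functor (catA n) B K"
      unfolding K_def eq by (rule functor_relabel_source[OF K0(1) inj_Cell inj_Word])
    have "om K (om (funU a b) (x, y)) = om (tensor B) (om (H a) x, om (H b) y)"
      if "1 \<le> a" "1 \<le> b" "n = a + b" "x \<in> Ob (catA a)" "y \<in> Ob (catA b)" for a b x y
    proof -
      have p: "(a, b) \<in> pairs n" using that by (simp add: pairs_def)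
      have "om (funU a b) (x, y) \<in> Ob (catA n)" using funU_ob that by simp
      then show ?thesis
        using p that(4,5) K0(4)[of "((a, b), (x, y))"]
        by (simp add: K_def mk_fctr_def funU_eq_inr(1)[OF p] inj_Cell G_ob span_simps)
    qed
    moreover have "am K (am (funU a b) (f, g)) = am (tensor B) (am (H a) f, am (H b) g)"
      if "1 \<le> a" "1 \<le> b" "n = a + b" "f \<in> Ar (catA a)" "g \<in> Ar (catA b)" for a b f g
    proof -
      have p: "(a, b) \<in> pairs n" using that by (simp add: pairs_def)
      have "am (funU a b) (f, g) \<in> Ar (catA n)" using funU_ar that by simp
      then show ?thesis
        using p that(4,5) K0(5)[of "((a, b), (f, g))"]
        by (simp add: K_def mk_fctr_def funU_eq_inr(2)[OF p] inj_Word G_ar span_simps)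
    qed
    moreover have "am K (am (funV i j k) (Idn (catA i) x, Idn (catA j) y, Idn (catA k) z, (0, 1))) =
        asc B (om (H i) x, om (H j) y, om (H k) z)"
      if "1 \<le> i" "1 \<le> j" "1 \<le> k" "n = i + j + k"
        "x \<in> Ob (catA i)" "y \<in> Ob (catA j)" "z \<in> Ob (catA k)" for i j k x y z
    proof -
      have t: "(i, j, k) \<in> triples n" using that by (simp add: triples_def)
      note I = cat_idn(1)[OF category_catA[OF that(1)] that(5)]
        cat_idn(1)[OF category_catA[OF that(2)] that(6)] cat_idn(1)[OF category_catA[OF that(3)] that(7)]
      note m = m[OF t]
      note o = functor_ob[OF fH[OF m(1,4)] that(5)] functor_ob[OF fH[OF m(2,5)] that(6)]
        functor_ob[OF fH[OF m(3,6)] that(7)]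
      have v: "am (funV i j k) (Idn (catA i) x, Idn (catA j) y, Idn (catA k) z, (0, 1)) \<in> Ar (catA n)"
        using funV_ar(1)[OF that(1-3) I, of 0 1] that(4) by simp
      have "am K (am (funV i j k) (Idn (catA i) x, Idn (catA j) y, Idn (catA k) z, (0, 1))) =
          am F ((i, j, k), (Idn (catA i) x, Idn (catA j) y, Idn (catA k) z, (0, 1)))"
        using v t I K0(3)[of "((i, j, k), (Idn (catA i) x, Idn (catA j) y, Idn (catA k) z, (0, 1)))"]
        by (simp add: K_def mk_fctr_def funV_eq_inl(2)[OF t] inj_Word span_simps)
      also have "\<dots> = am assoc_cyl ((Idn B (om (H i) x), Idn B (om (H j) y), Idn B (om (H k) z)), (0, 1))"
        using F_ar[OF t I] functor_idn[OF fH[OF m(1,4)] that(5)] functor_idn[OF fH[OF m(2,5)] that(6)]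
          functor_idn[OF fH[OF m(3,6)] that(7)] by simp
      \<comment> \<open>Over \<iota> the cylinder is the associator after a tensor of arrows; here
        these are identities, so only the associator remains.\<close>
      also have "\<dots> = asc B (om (H i) x, om (H j) y, om (H k) z)"
        using o asc_ar[OF o] cat_unit(1)[OF cat asc_ar(1)[OF o]]
        by (simp add: cyl_ar(3)[unfolded One_nat_def] cat_idn[OF cat] tensor_idn tensor_ob)
      finally show ?thesis .
    qed
    ultimately have "extends_A B e H n K"
      using FK 3 unfolding extends_A_def by auto
    then show ?thesis ..
  qed
qed

text \<open>The clauses at n mention H only at proper summands of n. Well-founded dependent choice
  needs this locality.\<close>

lemma extends_A_cong:
  assumes "\<And>m. m < n \<Longrightarrow> H m = H' m"
  shows "extends_A B e H n K = extends_A B e H' n K"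
proof -
  have "extends_A B e H n K" if "extends_A B e H' n K" "\<And>m. m < n \<Longrightarrow> H m = H' m" for H H'
    using that(1) unfolding extends_A_def by (auto simp: that(2))
  then show ?thesis using assms by metis
qed

theorem A_bar_free:
  assumes e: "e \<in> Ob B"
  shows "\<exists>!P. strict_tensor_functor A_bar B P \<and> om P (1, star1) = e"
proof (rule ex_ex1I)
  have "\<exists>H. \<forall>n. extends_A B e H n (H n)"
  \<comment> \<open>\<open>extends_A_step\<close> asserts only that some K exists, so the sequence H
    is obtained by choice along the order of the natural numbers.\<close>
  proof (rule dependent_wf_choice[OF wf_less_than])
    show "extends_A B e H n K = extends_A B e H' n K"
      if "\<And>m. (m, n) \<in> less_than \<Longrightarrow> H m = H' m" for H H' n K
      using that by (intro extends_A_cong) simp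
    show "\<exists>K. extends_A B e H n K" if "\<And>m. (m, n) \<in> less_than \<Longrightarrow> extends_A B e H m (H m)" for n H
      using that by (intro extends_A_step[OF e]) simp
  qed
  then obtain H where H: "\<And>n. extends_A B e H n (H n)" by blast
  then have fH: "1 \<le> n \<Longrightarrow> is_functor (catA n) B (H n)" for n by (simp add: extends_A_def)
  define P where "P = mk_fctr A_bar (\<lambda>(n, x). om (H n) x) (\<lambda>(n, f). am (H n) f)"
  interpret A: assoc_cat A_bar by unfold_locales (rule associative_A_bar)
  have P: "is_functor A_bar B P"
    unfolding P_def
    by (rule is_functor_mkI) (auto simp: A.cat cat A_bar_simps functor_ob[OF fH] functor_ar[OF fH]
        functor_idn[OF fH] functor_cmp[OF fH])
  have om_P: "om P (n, x) = om (H n) x" if "1 \<le> n" "x \<in> Ob (catA n)" for n x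
    using that by (simp add: P_def mk_fctr_def A_bar_simps)
  have am_P: "am P (n, f) = am (H n) f" if "1 \<le> n" "f \<in> Ar (catA n)" for n f
    using that by (simp add: P_def mk_fctr_def A_bar_simps)
  have "strict_tensor_functor A_bar B P"
    unfolding strict_tensor_functor_def
  proof (intro conjI ballI)
    fix x y assume xy: "x \<in> Ob A_bar" "y \<in> Ob A_bar"
    then obtain i x' j y' where x: "x = (i, x')" "1 \<le> i" "x' \<in> Ob (catA i)"
        and y: "y = (j, y')" "1 \<le> j" "y' \<in> Ob (catA j)" by (auto simp: A_bar_simps)
    show "om P (om (tensor A_bar) (x, y)) = om (tensor B) (om P x, om P y)"
      using H[of "i + j"] x y by (simp add: A_bar_tensor om_P funU_ob extends_A_def)
    fix z assume "z \<in> Ob A_bar"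
    then obtain k z' where z: "z = (k, z')" "1 \<le> k" "z' \<in> Ob (catA k)" by (auto simp: A_bar_simps)
    show "am P (asc A_bar (x, y, z)) = asc B (om P x, om P y, om P z)"
      using H[of "i + j + k"] x y z
      by (simp add: A_bar_asc om_P am_P funV_ar cat_idn category_catA extends_A_def)
  next
    fix f g assume "f \<in> Ar A_bar" "g \<in> Ar A_bar"
    then obtain i f' j g' where f: "f = (i, f')" "1 \<le> i" "f' \<in> Ar (catA i)"
        and g: "g = (j, g')" "1 \<le> j" "g' \<in> Ar (catA j)" by (auto simp: A_bar_simps)
    show "am P (am (tensor A_bar) (f, g)) = am (tensor B) (am P f, am P g)"
      using H[of "i + j"] f g by (simp add: A_bar_tensor am_P funU_ar extends_A_def)
  qed (fact associative_A_bar assoc P)+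
  moreover have "om P (1, star1) = e"
    using H[of 1] om_P[of 1 star1] catA_1(1) by (simp add: extends_A_def star1_def)
  ultimately show "\<exists>P. strict_tensor_functor A_bar B P \<and> om P (1, star1) = e" by blast
next
  fix P Q assume "strict_tensor_functor A_bar B P \<and> om P (1, star1) = e"
    "strict_tensor_functor A_bar B Q \<and> om Q (1, star1) = e"
  moreover have "(1, star1) \<in> Ob A_bar"
    using catA_1(1) by (simp add: A_bar_simps star1_def)
  ultimately show "P = Q"
    using strict_tensor_functor_unique[of A_bar B P Q "(1, star1)"]
      A_bar_generated_ob A_bar_generated_ar by simp
qed

end

section \<open>The associative category of operations\<close>

lemma category_functor_cat:
  assumes C: "category C" and D: "category D"
  shows "category (functor_cat C D)"
proof -
  note d = cat_idn[OF D] cat_cmp[OF D] cat_unit[OF D] cat_assoc[OF D]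
  have unit: "Cmp D (Idn D y) h = h" if "h \<in> Ar D" "Cod D h = y" for y h
    using cat_unit(2)[OF D that(1)] that(2) by simp
  have unit': "Cmp D h (Idn D y) = h" if "h \<in> Ar D" "Dom D h = y" for y h
    using cat_unit(1)[OF D that(1)] that(2) by simp
  have idn: "nat_trans C D F F (\<lambda>x\<in>Ob C. Idn D (om F x))" if F: "is_functor C D F" for F
    using functor_ob[OF F] functor_ar[OF F] cat_ob[OF C] F
    by (auto simp: nat_trans_def hom_def d(1-3) unit unit')
  have cmp: "nat_trans C D F H (\<lambda>x\<in>Ob C. Cmp D (s x) (t x))"
    if t: "nat_trans C D F G t" and s: "nat_trans C D G H s" for F G H s t
  proof -
    have F: "is_functor C D F" "is_functor C D G" "is_functor C D H"
      and t': "\<And>x. x \<in> Ob C \<Longrightarrow> t x \<in> Ar D" "\<And>x. x \<in> Ob C \<Longrightarrow> Dom D (t x) = om F x"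
        "\<And>x. x \<in> Ob C \<Longrightarrow> Cod D (t x) = om G x"
        "\<And>f. f \<in> Ar C \<Longrightarrow> Cmp D (t (Cod C f)) (am F f) = Cmp D (am G f) (t (Dom C f))"
      and s': "\<And>x. x \<in> Ob C \<Longrightarrow> s x \<in> Ar D" "\<And>x. x \<in> Ob C \<Longrightarrow> Dom D (s x) = om G x"
        "\<And>x. x \<in> Ob C \<Longrightarrow> Cod D (s x) = om H x"
        "\<And>f. f \<in> Ar C \<Longrightarrow> Cmp D (s (Cod C f)) (am G f) = Cmp D (am H f) (s (Dom C f))"
      using s t by (auto simp: nat_trans_def hom_def)
    \<comment> \<open>The two naturality squares are pasted along G f.\<close>
    have "Cmp D (Cmp D (s (Cod C f)) (t (Cod C f))) (am F f) =
        Cmp D (am H f) (Cmp D (s (Dom C f)) (t (Dom C f)))" if f: "f \<in> Ar C" for f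
    proof -
      note A = functor_ar[OF F(1) f] functor_ar[OF F(2) f] functor_ar[OF F(3) f] cat_ob[OF C f]
      have "Cmp D (Cmp D (s (Cod C f)) (t (Cod C f))) (am F f) =
          Cmp D (s (Cod C f)) (Cmp D (am G f) (t (Dom C f)))"
        using A t' s' f cat_assoc[OF D, of "am F f" "t (Cod C f)" "s (Cod C f)"] by simp
      also have "\<dots> = Cmp D (am H f) (Cmp D (s (Dom C f)) (t (Dom C f)))"
        using A t' s' f cat_assoc[OF D, of "t (Dom C f)" "am G f" "s (Cod C f)"]
          cat_assoc[OF D, of "t (Dom C f)" "s (Dom C f)" "am H f"] by simp
      finally show ?thesis .
    qed
    then show ?thesis
      using F t' s' cat_ob[OF C] by (auto simp: nat_trans_def hom_def d)
  qed
  have ext: "(\<lambda>x\<in>Ob C. t x) = t" "is_functor C D F" "is_functor C D G"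
    "\<And>x. x \<in> Ob C \<Longrightarrow> t x \<in> Ar D" "\<And>x. x \<in> Ob C \<Longrightarrow> Dom D (t x) = om F x"
    "\<And>x. x \<in> Ob C \<Longrightarrow> Cod D (t x) = om G x" if "nat_trans C D F G t" for F G t
    using that by (auto simp: nat_trans_def hom_def extensional_restrict)
  show ?thesis
    unfolding category_def hom_def
  proof (intro conjI ballI impI, goal_cases)
    case (5 f)
    then obtain F G t where f: "f = (F, G, t)" "nat_trans C D F G t" by (auto simp: functor_cat_def)
    \<comment> \<open>Composition yields a function restricted to the objects; it is t itself
      because transformations are extensional.\<close>
    have "(\<lambda>x\<in>Ob C. Cmp D (t x) (Idn D (om F x))) = (\<lambda>x\<in>Ob C. t x)"
      using ext(4,5)[OF f(2)] by (intro restrict_ext) (simp add: unit')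
    then show ?case using f ext[OF f(2)] by (simp add: functor_cat_def cong: restrict_cong)
  next
    case (6 f)
    then obtain F G t where f: "f = (F, G, t)" "nat_trans C D F G t" by (auto simp: functor_cat_def)
    have "(\<lambda>x\<in>Ob C. Cmp D (Idn D (om G x)) (t x)) = (\<lambda>x\<in>Ob C. t x)"
      using ext(4,6)[OF f(2)] by (intro restrict_ext) (simp add: unit)
    then show ?case using f ext[OF f(2)] by (simp add: functor_cat_def cong: restrict_cong)
  next
    case (7 f g h)
    then obtain F G t G' H s H' K r where fgh: "f = (F, G, t)" "g = (G', H, s)" "h = (H', K, r)"
      "nat_trans C D F G t" "nat_trans C D G' H s" "nat_trans C D H' K r" "G' = G" "H' = H"
      by (auto simp: functor_cat_def)
    show ?case
      using fgh ext[OF fgh(4)] ext[OF fgh(5)] ext[OF fgh(6)]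
      by (auto simp: functor_cat_def d intro!: restrict_ext)
  qed (auto simp: functor_cat_def ext(2,3) intro: idn cmp ext(2,3))
qed

text \<open>Passes from pointwise invertibility, which is what \<beta> provides, to invertibility in
  the functor category, which the associator of \<open>B_bar\<close> needs.\<close>

lemma nat_iso_inverse_arrows:
  assumes t: "nat_iso C D F G t"
  shows "inverse_arrows (functor_cat C D) (F, G, t) (G, F, \<lambda>x\<in>Ob C. inverse_of D (t x))"
proof -
  have F: "is_functor C D F" and G: "is_functor C D G" and C: "category C" and D: "category D"
    and nt: "nat_trans C D F G t"
    using t by (auto simp: nat_iso_def nat_trans_def is_functor_def)
  define s where "s x = inverse_of D (t x)" for x
  note s = inverse_arrows_ar[OF nat_iso_inverse_of(1)[OF t], folded s_def]
  note t_ar = nat_iso_inverse_of(3,4)[OF t]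
  have "Cmp D (s (Cod C f)) (am G f) = Cmp D (am F f) (s (Dom C f))" if "f \<in> Ar C" for f
    unfolding s_def by (rule nat_iso_inverse_of_nat[OF t that])
  then have "nat_trans C D G F (\<lambda>x\<in>Ob C. s x)"
    using F G s t_ar cat_ob[OF C] by (auto simp: nat_trans_def hom_def)
  then show ?thesis
    using nt s t_ar by (auto simp: inverse_arrows_def functor_cat_def hom_def simp flip: s_def intro!: restrict_ext)
qed

section \<open>Powers of a category and splitting of argument lists\<close>

lemma power_cat_simps:
  "Ob (power_cat C n) = {xs. length xs = n \<and> set xs \<subseteq> Ob C}"
  "Ar (power_cat C n) = {fs. length fs = n \<and> set fs \<subseteq> Ar C}"
  "Dom (power_cat C n) = map (Dom C)" "Cod (power_cat C n) = map (Cod C)"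
  "Idn (power_cat C n) = map (Idn C)" "Cmp (power_cat C n) = map2 (Cmp C)"
  by (simp_all add: power_cat_def)

lemma category_power:
  assumes C: "category C"
  shows "category (power_cat C n)"
proof -
  have ar: "\<And>f. f \<in> Ar (power_cat C n) \<longleftrightarrow> length f = n \<and> (\<forall>i<n. f ! i \<in> Ar C)"
    and ob: "\<And>x. x \<in> Ob (power_cat C n) \<longleftrightarrow> length x = n \<and> (\<forall>i<n. x ! i \<in> Ob C)"
    by (auto simp: power_cat_simps set_conv_nth)
  note s = cat_ob[OF C] cat_idn[OF C] cat_unit[OF C] cat_assoc[OF C] cat_cmp[OF C]
  have cod: "map (Cod C) f = map (Dom C) g \<longleftrightarrow> (\<forall>i<n. Cod C (f ! i) = Dom C (g ! i))"
    if "length f = n" "length g = n" for f g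
    using that by (auto simp: list_eq_iff_nth_eq)
  show ?thesis
    unfolding category_def hom_def
    by (auto simp: ar ob power_cat_simps(3-6) s cod list_eq_iff_nth_eq)
qed

lemma power_take_drop:
  "xs \<in> Ob (power_cat C (q + r)) \<Longrightarrow> take q xs \<in> Ob (power_cat C q)"
  "xs \<in> Ob (power_cat C (q + r)) \<Longrightarrow> drop q xs \<in> Ob (power_cat C r)"
  "us \<in> Ar (power_cat C (q + r)) \<Longrightarrow> take q us \<in> Ar (power_cat C q)"
  "us \<in> Ar (power_cat C (q + r)) \<Longrightarrow> drop q us \<in> Ar (power_cat C r)"
  by (auto simp: power_cat_simps dest: in_set_takeD in_set_dropD)

text \<open>The operations of \<open>power_cat\<close> act entrywise on lists and do not depend on
  the length, so the length on the right can be chosen to fit the slice.\<close>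

lemma power_take_ops:
  "take q (Dom (power_cat C n) us) = Dom (power_cat C q) (take q us)"
  "take q (Cod (power_cat C n) us) = Cod (power_cat C q) (take q us)"
  "take q (Idn (power_cat C n) xs) = Idn (power_cat C q) (take q xs)"
  "take q (Cmp (power_cat C n) vs us) = Cmp (power_cat C q) (take q vs) (take q us)"
  by (simp_all add: power_cat_simps take_map take_zip)

lemma power_drop_ops:
  "drop q (Dom (power_cat C (q + r)) us) = Dom (power_cat C r) (drop q us)"
  "drop q (Cod (power_cat C (q + r)) us) = Cod (power_cat C r) (drop q us)"
  "drop q (Idn (power_cat C (q + r)) xs) = Idn (power_cat C r) (drop q xs)"
  "drop q (Cmp (power_cat C (q + r)) vs us) = Cmp (power_cat C r) (drop q vs) (drop q us)"
  by (simp_all add: power_cat_simps drop_map drop_zip)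

section \<open>Tensor and reassociation of operations\<close>

definition opn_ten ::
  "('o, 'a) acat \<Rightarrow> nat \<Rightarrow> ('o, 'a) opn \<Rightarrow> nat \<Rightarrow> ('o, 'a) opn \<Rightarrow> ('o, 'a) opn" where
  "opn_ten B q f r g = snd (opn_tensor B (q, f) (r, g))"

text \<open>Separates the arity from the functor, so that sums of arities can be rearranged on their
  own.\<close>

lemma opn_tensor_eq: "opn_tensor B (q, f) (r, g) = (q + r, opn_ten B q f r g)"
  by (simp add: opn_ten_def opn_tensor_def)

lemma opn_ten_simps:
  "xs \<in> Ob (power_cat B (q + r)) \<Longrightarrow>
    om (opn_ten B q f r g) xs = om (tensor B) (om f (take q xs), om g (drop q xs))"
  "us \<in> Ar (power_cat B (q + r)) \<Longrightarrow>
    am (opn_ten B q f r g) us = am (tensor B) (am f (take q us), am g (drop q us))"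
  by (simp_all add: opn_ten_def opn_tensor_def mk_fctr_def)

definition opn_tr_ten ::
  "('o, 'a) acat \<Rightarrow> nat \<Rightarrow> ('o list \<Rightarrow> 'a) \<Rightarrow> nat \<Rightarrow> ('o list \<Rightarrow> 'a) \<Rightarrow> 'o list \<Rightarrow> 'a" where
  "opn_tr_ten B q s r t = (\<lambda>xs\<in>Ob (power_cat B (q + r)). am (tensor B) (s (take q xs), t (drop q xs)))"

lemma opn_tr_tensor_eq:
  "opn_tr_tensor B (q, (f, f', s)) (r, (g, g', t)) =
    (q + r, (opn_ten B q f r g, opn_ten B q f' r g', opn_tr_ten B q s r t))"
  by (simp add: opn_ten_def opn_tr_tensor_def opn_tr_ten_def)

definition opn_asc_tr ::
  "('o, 'a) acat \<Rightarrow> nat \<Rightarrow> ('o, 'a) opn \<Rightarrow> nat \<Rightarrow> ('o, 'a) opn \<Rightarrow> nat \<Rightarrow> ('o, 'a) opn \<Rightarrow> 'o list \<Rightarrow> 'a" where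
  "opn_asc_tr B q f r g s h = (\<lambda>xs\<in>Ob (power_cat B (q + r + s)).
     asc B (om f (take q xs), om g (take r (drop q xs)), om h (drop (q + r) xs)))"

lemma opn_asc_eq:
  "opn_asc B (q, f) (r, g) (s, h) = (q + r + s,
    (opn_ten B q f (r + s) (opn_ten B r g s h), opn_ten B (q + r) (opn_ten B q f r g) s h,
     opn_asc_tr B q f r g s h))"
  by (simp add: opn_asc_def opn_tensor_eq opn_asc_tr_def)

lemma B_bar_simps:
  "Ob (B_bar B) = (SIGMA n:{1..}. {f. is_functor (power_cat B n) B f})"
  "Ar (B_bar B) = (SIGMA n:{1..}. {(f, g, t). nat_trans (power_cat B n) B f g t})"
  "1 \<le> n \<Longrightarrow> Dom (B_bar B) (n, (f, g, t)) = (n, f)"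
  "1 \<le> n \<Longrightarrow> Cod (B_bar B) (n, (f, g, t)) = (n, g)"
  "1 \<le> n \<Longrightarrow> Idn (B_bar B) (n, f) = (n, (f, f, \<lambda>xs\<in>Ob (power_cat B n). Idn B (om f xs)))"
  "1 \<le> n \<Longrightarrow> Cmp (B_bar B) (n, (g', h, s)) (n, (f, g, t)) =
    (n, (f, h, \<lambda>xs\<in>Ob (power_cat B n). Cmp B (s xs) (t xs)))"
  by (simp_all add: B_bar_def B_bar_base_def cat.defs coprod_cat_simps functor_cat_def)

lemma B_bar_tensor:
  "x \<in> Ob (B_bar B) \<Longrightarrow> y \<in> Ob (B_bar B) \<Longrightarrow> om (tensor (B_bar B)) (x, y) = opn_tensor B x y"
  "f \<in> Ar (B_bar B) \<Longrightarrow> g \<in> Ar (B_bar B) \<Longrightarrow> am (tensor (B_bar B)) (f, g) = opn_tr_tensor B f g"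
  by (simp_all add: B_bar_def cat.defs mk_fctr_def)

lemma B_bar_asc:
  "x \<in> Ob (B_bar B) \<Longrightarrow> y \<in> Ob (B_bar B) \<Longrightarrow> z \<in> Ob (B_bar B) \<Longrightarrow>
    asc (B_bar B) (x, y, z) = opn_asc B x y z"
  by (simp add: B_bar_def cat.defs)

text \<open>Writes the offset as in \<open>opn_asc_tr\<close>; the rule \<open>drop_drop\<close>
  would produce \<open>r + q\<close>.\<close>

lemma drop_drop_add: "drop r (drop q xs) = drop (q + r) xs"
  by (simp add: add.commute)

context assoc_cat
begin

lemma functor_opn_ten:
  assumes f: "is_functor (power_cat B q) B f" and g: "is_functor (power_cat B r) B g"
  shows "is_functor (power_cat B (q + r)) B (opn_ten B q f r g)"
  unfolding opn_ten_def opn_tensor_def prod.case snd_conv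
proof (rule is_functor_mkI, goal_cases)
  case (8 us vs)
  have "Cod (power_cat B q) (take q us) = Dom (power_cat B q) (take q vs)"
    "Cod (power_cat B r) (drop q us) = Dom (power_cat B r) (drop q vs)"
    using 8(3) by (metis power_take_ops(1,2), metis power_drop_ops(1,2))
  then show ?case
    using 8 by (simp add: power_take_drop power_take_ops power_drop_ops functor_ar[OF f] functor_ar[OF g]
        functor_cmp[OF f] functor_cmp[OF g] tensor_cmp)
qed (simp_all add: cat category_power power_take_drop power_take_ops power_drop_ops
    functor_ob[OF f] functor_ob[OF g] functor_ar[OF f] functor_ar[OF g]
    functor_idn[OF f] functor_idn[OF g] tensor_ob tensor_ar tensor_idn)

lemma nat_transD:
  assumes "nat_trans C B f g t"
  shows "is_functor C B f" "is_functor C B g" "t \<in> extensional (Ob C)"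
    "\<And>x. x \<in> Ob C \<Longrightarrow> t x \<in> Ar B" "\<And>x. x \<in> Ob C \<Longrightarrow> Dom B (t x) = om f x"
    "\<And>x. x \<in> Ob C \<Longrightarrow> Cod B (t x) = om g x"
    "\<And>u. u \<in> Ar C \<Longrightarrow> Cmp B (t (Cod C u)) (am f u) = Cmp B (am g u) (t (Dom C u))"
  using assms by (auto simp: nat_trans_def hom_def)

lemma nat_trans_opn_tr_ten:
  assumes s: "nat_trans (power_cat B q) B f f' s" and t: "nat_trans (power_cat B r) B g g' t"
  shows "nat_trans (power_cat B (q + r)) B (opn_ten B q f r g) (opn_ten B q f' r g') (opn_tr_ten B q s r t)"
  unfolding nat_trans_def
proof (intro conjI ballI)
  note s' = nat_transD[OF s] and t' = nat_transD[OF t]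
  note c = category_power[OF cat]
  show "is_functor (power_cat B (q + r)) B (opn_ten B q f r g)"
    "is_functor (power_cat B (q + r)) B (opn_ten B q f' r g')"
    by (intro functor_opn_ten s' t')+
  show "opn_tr_ten B q s r t \<in> extensional (Ob (power_cat B (q + r)))"
    by (simp add: opn_tr_ten_def)
  show "opn_tr_ten B q s r t xs \<in> hom B (om (opn_ten B q f r g) xs) (om (opn_ten B q f' r g') xs)"
    if "xs \<in> Ob (power_cat B (q + r))" for xs
    using that s' t' by (simp add: opn_tr_ten_def opn_ten_simps hom_def tensor_ar power_take_drop)
  fix us assume us: "us \<in> Ar (power_cat B (q + r))"
  note tu = power_take_drop(3,4)[OF us]
  note a = functor_ar[OF s'(1) tu(1)] functor_ar[OF s'(2) tu(1)] functor_ar[OF t'(1) tu(2)]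
    functor_ar[OF t'(2) tu(2)] cat_ob[OF c tu(1)] cat_ob[OF c tu(2)]
  \<comment> \<open>Read from right to left, the interchange law \<open>tensor_cmp\<close> collects
    each side into one tensor of composites, whose factors are the naturality squares of s and
    t.\<close>
  show "Cmp B (opn_tr_ten B q s r t (Cod (power_cat B (q + r)) us)) (am (opn_ten B q f r g) us) =
      Cmp B (am (opn_ten B q f' r g') us) (opn_tr_ten B q s r t (Dom (power_cat B (q + r)) us))"
    using us cat_ob[OF c us] a s' t' tu
    by (simp add: opn_tr_ten_def opn_ten_simps power_take_ops power_drop_ops s'(7) t'(7) flip: tensor_cmp)
qed

text \<open>At a list the transformation is the associator of B at the values of f, g, h on three
  consecutive slices, so naturality and invertibility are those of B at these values.\<close>

lemma nat_iso_opn_asc_tr: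
  assumes f: "is_functor (power_cat B q) B f" and g: "is_functor (power_cat B r) B g"
    and h: "is_functor (power_cat B s) B h"
  shows "nat_iso (power_cat B (q + r + s)) B (opn_ten B q f (r + s) (opn_ten B r g s h))
    (opn_ten B (q + r) (opn_ten B q f r g) s h) (opn_asc_tr B q f r g s h)"
proof -
  note c = category_power[OF cat]
  have sl: "take q xs \<in> Ob (power_cat B q)" "take r (drop q xs) \<in> Ob (power_cat B r)"
    "drop (q + r) xs \<in> Ob (power_cat B s)" "drop q xs \<in> Ob (power_cat B (r + s))"
    "take (q + r) xs \<in> Ob (power_cat B (q + r))" if "xs \<in> Ob (power_cat B (q + r + s))" for xs
    using that by (auto simp: power_cat_simps dest: in_set_takeD in_set_dropD)
  have sla: "take q xs \<in> Ar (power_cat B q)" "take r (drop q xs) \<in> Ar (power_cat B r)"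
    "drop (q + r) xs \<in> Ar (power_cat B s)" "drop q xs \<in> Ar (power_cat B (r + s))"
    "take (q + r) xs \<in> Ar (power_cat B (q + r))" if "xs \<in> Ar (power_cat B (q + r + s))" for xs
    using that by (auto simp: power_cat_simps dest: in_set_takeD in_set_dropD)
  \<comment> \<open>Both bracketings cut the list into the same slices: the first q, the next r and
    the last s entries.\<close>
  have R: "om (opn_ten B q f (r + s) (opn_ten B r g s h)) xs =
      om (tensor B) (om f (take q xs), om (tensor B) (om g (take r (drop q xs)), om h (drop (q + r) xs)))"
    and L: "om (opn_ten B (q + r) (opn_ten B q f r g) s h) xs =
      om (tensor B) (om (tensor B) (om f (take q xs), om g (take r (drop q xs))), om h (drop (q + r) xs))"
    if "xs \<in> Ob (power_cat B (q + r + s))" for xs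
    using that sl[OF that] by (simp_all add: opn_ten_simps drop_drop_add drop_take flip: add.assoc del: drop_drop)
  have Ra: "am (opn_ten B q f (r + s) (opn_ten B r g s h)) xs =
      am (tensor B) (am f (take q xs), am (tensor B) (am g (take r (drop q xs)), am h (drop (q + r) xs)))"
    and La: "am (opn_ten B (q + r) (opn_ten B q f r g) s h) xs =
      am (tensor B) (am (tensor B) (am f (take q xs), am g (take r (drop q xs))), am h (drop (q + r) xs))"
    if "xs \<in> Ar (power_cat B (q + r + s))" for xs
    using that sla[OF that] by (simp_all add: opn_ten_simps drop_drop_add drop_take flip: add.assoc del: drop_drop)
  show ?thesis
    unfolding nat_iso_def nat_trans_def
  proof (intro conjI ballI)
    show "is_functor (power_cat B (q + r + s)) B (opn_ten B q f (r + s) (opn_ten B r g s h))"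
      using functor_opn_ten[OF f functor_opn_ten[OF g h]] by (simp add: add.assoc)
    show "is_functor (power_cat B (q + r + s)) B (opn_ten B (q + r) (opn_ten B q f r g) s h)"
      by (rule functor_opn_ten[OF functor_opn_ten[OF f g] h])
    show "opn_asc_tr B q f r g s h \<in> extensional (Ob (power_cat B (q + r + s)))"
      by (simp add: opn_asc_tr_def)
    fix xs assume xs: "xs \<in> Ob (power_cat B (q + r + s))"
    note o = functor_ob[OF f sl(1)[OF xs]] functor_ob[OF g sl(2)[OF xs]] functor_ob[OF h sl(3)[OF xs]]
    show "opn_asc_tr B q f r g s h xs \<in> hom B (om (opn_ten B q f (r + s) (opn_ten B r g s h)) xs)
        (om (opn_ten B (q + r) (opn_ten B q f r g) s h) xs)"
      using asc_ar[OF o] by (simp add: opn_asc_tr_def xs R L hom_def)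
    show "iso B (opn_asc_tr B q f r g s h xs)"
      using asc_ar[OF o] by (simp add: opn_asc_tr_def xs)
  next
    fix us assume us: "us \<in> Ar (power_cat B (q + r + s))"
    note ar = functor_ar[OF f sla(1)[OF us]] functor_ar[OF g sla(2)[OF us]] functor_ar[OF h sla(3)[OF us]]
    have e: "take q (Dom (power_cat B (q + r + s)) us) = Dom (power_cat B q) (take q us)"
        "take r (drop q (Dom (power_cat B (q + r + s)) us)) = Dom (power_cat B r) (take r (drop q us))"
        "drop (q + r) (Dom (power_cat B (q + r + s)) us) = Dom (power_cat B s) (drop (q + r) us)"
        "take q (Cod (power_cat B (q + r + s)) us) = Cod (power_cat B q) (take q us)"
        "take r (drop q (Cod (power_cat B (q + r + s)) us)) = Cod (power_cat B r) (take r (drop q us))"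
        "drop (q + r) (Cod (power_cat B (q + r + s)) us) = Cod (power_cat B s) (drop (q + r) us)"
      by (simp_all add: power_cat_simps take_map drop_map)
    show "Cmp B (opn_asc_tr B q f r g s h (Cod (power_cat B (q + r + s)) us))
        (am (opn_ten B q f (r + s) (opn_ten B r g s h)) us) =
      Cmp B (am (opn_ten B (q + r) (opn_ten B q f r g) s h) us)
        (opn_asc_tr B q f r g s h (Dom (power_cat B (q + r + s)) us))"
      using asc_nat[OF ar(1) ar(4) ar(7)] cat_ob[OF c us]
      by (simp add: opn_asc_tr_def Ra[OF us] La[OF us] e ar)
  qed
qed

lemma B_bar_mem:
  "(n, f) \<in> Ob (B_bar B) \<longleftrightarrow> 1 \<le> n \<and> is_functor (power_cat B n) B f"
  "(n, (f, g, t)) \<in> Ar (B_bar B) \<longleftrightarrow> 1 \<le> n \<and> nat_trans (power_cat B n) B f g t"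
  by (auto simp: B_bar_simps)

text \<open>Evaluated at a list, each law becomes a law of B at slices of that list. Objects are
  pairs of an arity and a functor, so the two bracketings must have literally equal arities, which
  is associativity of addition.\<close>

lemma associative_B_bar: "associative_category (B_bar B)"
proof (rule associative_categoryI)
  have "category (B_bar_base B)"
    unfolding B_bar_base_def by (intro category_coprod category_functor_cat category_power cat)
  then show c: "category (B_bar B)"
    by (rule category_cong) (simp_all add: B_bar_def cat.defs)
  show "om (tensor (B_bar B)) \<in> extensional (Ob (B_bar B) \<times> Ob (B_bar B))"
    "am (tensor (B_bar B)) \<in> extensional (Ar (B_bar B) \<times> Ar (B_bar B))"
    "asc (B_bar B) \<in> extensional (Ob (B_bar B) \<times> Ob (B_bar B) \<times> Ob (B_bar B))"
    by (simp_all add: B_bar_def cat.defs mk_fctr_def)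
  have ten: "opn_tensor B x y \<in> Ob (B_bar B)" if xy: "x \<in> Ob (B_bar B)" "y \<in> Ob (B_bar B)" for x y
  proof -
    obtain q f r g where "x = (q, f)" "y = (r, g)" by (metis surj_pair)
    then show ?thesis using xy by (simp add: B_bar_mem opn_tensor_eq functor_opn_ten)
  qed
  then show "om (tensor (B_bar B)) (x, y) \<in> Ob (B_bar B)" if "x \<in> Ob (B_bar B)" "y \<in> Ob (B_bar B)" for x y
    using that by (simp add: B_bar_tensor)
  have trten: "opn_tr_tensor B x y \<in> Ar (B_bar B)" if xy: "x \<in> Ar (B_bar B)" "y \<in> Ar (B_bar B)" for x y
  proof -
    obtain q f f' s r g g' t where "x = (q, (f, f', s))" "y = (r, (g, g', t))" by (metis surj_pair)
    then show ?thesis using xy by (simp add: B_bar_mem opn_tr_tensor_eq nat_trans_opn_tr_ten)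
  qed
  {
    fix x y assume xy: "x \<in> Ob (B_bar B)" "y \<in> Ob (B_bar B)"
    obtain q f r g where e: "x = (q, f)" "y = (r, g)" by (metis surj_pair)
    have f: "1 \<le> q" "is_functor (power_cat B q) B f" and g: "1 \<le> r" "is_functor (power_cat B r) B g"
      using xy by (simp_all add: e B_bar_mem)
    show "am (tensor (B_bar B)) (Idn (B_bar B) x, Idn (B_bar B) y) = Idn (B_bar B) (om (tensor (B_bar B)) (x, y))"
      using cat_idn(1)[OF c xy(1)] cat_idn(1)[OF c xy(2)] xy f g unfolding e
      by (auto simp: B_bar_tensor B_bar_simps opn_tr_tensor_eq opn_tensor_eq opn_tr_ten_def power_take_drop
          opn_ten_simps tensor_idn functor_ob[OF f(2)] functor_ob[OF g(2)] intro!: restrict_ext)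
    fix z assume z: "z \<in> Ob (B_bar B)"
    obtain s h where e': "z = (s, h)" by (metis surj_pair)
    have h: "1 \<le> s" "is_functor (power_cat B s) B h"
      using z by (simp_all add: e' B_bar_mem)
    note iso = nat_iso_opn_asc_tr[OF f(2) g(2) h(2)]
    show "asc (B_bar B) (x, y, z) \<in>
        hom (B_bar B) (om (tensor (B_bar B)) (x, om (tensor (B_bar B)) (y, z)))
          (om (tensor (B_bar B)) (om (tensor (B_bar B)) (x, y), z))"
      using xy z ten[OF xy(1) ten[OF xy(2) z]] ten[OF ten[OF xy] z] ten[OF xy] ten[OF xy(2) z] iso f(1) g(1) h(1)
      unfolding e e'
      by (simp add: B_bar_tensor B_bar_asc opn_asc_eq opn_tensor_eq hom_def B_bar_mem B_bar_simps(3,4) nat_iso_def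
          add.assoc)
    \<comment> \<open>An inverse within one summand of the coproduct is an inverse in the
      coproduct.\<close>
    have "inverse_arrows (B_bar B) (q + r + s, (F, G, t)) (q + r + s, u)"
      if "inverse_arrows (functor_cat (power_cat B (q + r + s)) B) (F, G, t) u" for F G t u
      using that f(1) by (cases u) (auto simp: inverse_arrows_def hom_def functor_cat_def B_bar_simps)
    then show "iso (B_bar B) (asc (B_bar B) (x, y, z))"
      using nat_iso_inverse_arrows[OF iso] xy z unfolding e e' iso_def B_bar_asc opn_asc_eq
      by (simp add: B_bar_asc opn_asc_eq) blast
  }
  fix x y assume xy: "x \<in> Ar (B_bar B)" "y \<in> Ar (B_bar B)"
  obtain q f f' s r g g' t where e: "x = (q, (f, f', s))" "y = (r, (g, g', t))" by (metis surj_pair)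
  have q: "1 \<le> q" "nat_trans (power_cat B q) B f f' s" and r: "1 \<le> r" "nat_trans (power_cat B r) B g g' t"
    using xy by (simp_all add: e B_bar_mem)
  note s = nat_transD[OF q(2)] and t = nat_transD[OF r(2)]
  show "am (tensor (B_bar B)) (x, y) \<in> hom (B_bar B) (om (tensor (B_bar B)) (Dom (B_bar B) x, Dom (B_bar B) y))
      (om (tensor (B_bar B)) (Cod (B_bar B) x, Cod (B_bar B) y))"
    using xy trten[OF xy] cat_ob[OF c xy(1)] cat_ob[OF c xy(2)] q(1) r(1) unfolding e
    by (simp add: B_bar_tensor hom_def opn_tr_tensor_eq opn_tensor_eq B_bar_simps(3,4))
  show "am (tensor (B_bar B)) (Cmp (B_bar B) x' x, Cmp (B_bar B) y' y) =
      Cmp (B_bar B) (am (tensor (B_bar B)) (x', y')) (am (tensor (B_bar B)) (x, y))"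
    if xy': "x' \<in> Ar (B_bar B)" "y' \<in> Ar (B_bar B)" and d: "Cod (B_bar B) x = Dom (B_bar B) x'"
      "Cod (B_bar B) y = Dom (B_bar B) y'" for x' y'
  proof -
    obtain q' f1 f'' s' r' g1 g'' t' where e': "x' = (q', (f1, f'', s'))" "y' = (r', (g1, g'', t'))"
      by (metis surj_pair)
    have [simp]: "q' = q" "r' = r" "f1 = f'" "g1 = g'"
      using d xy' q(1) r(1) unfolding e e' by (auto simp: B_bar_mem B_bar_simps(3,4))
    have n: "nat_trans (power_cat B q) B f' f'' s'" "nat_trans (power_cat B r) B g' g'' t'"
      using xy' unfolding e' by (simp_all add: B_bar_mem)
    note s' = nat_transD[OF n(1)] and t' = nat_transD[OF n(2)]
    show ?thesis
      using xy xy' cat_cmp(1)[OF c xy(1) xy'(1) d(1)] cat_cmp(1)[OF c xy(2) xy'(2) d(2)] q(1) r(1) unfolding e e'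
      by (auto simp: B_bar_tensor B_bar_simps(6) opn_tr_tensor_eq opn_tr_ten_def power_take_drop s t s' t' tensor_cmp
          intro!: restrict_ext)
  qed
  fix z assume z: "z \<in> Ar (B_bar B)"
  obtain p h h' u where e': "z = (p, (h, h', u))" by (metis surj_pair)
  have p: "1 \<le> p" "nat_trans (power_cat B p) B h h' u"
    using z by (simp_all add: e' B_bar_mem)
  note u = nat_transD[OF p(2)]
  \<comment> \<open>This is \<open>asc_nat\<close> in B for the components of s, t, u at the three
    slices of xs.\<close>
  have pt: "Cmp B (opn_asc_tr B q f' r g' p h' xs) (opn_tr_ten B q s (r + p) (opn_tr_ten B r t p u) xs) =
      Cmp B (opn_tr_ten B (q + r) (opn_tr_ten B q s r t) p u xs) (opn_asc_tr B q f r g p h xs)"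
    if xs: "xs \<in> Ob (power_cat B (q + r + p))" for xs
  proof -
    have sl: "take q xs \<in> Ob (power_cat B q)" "take r (drop q xs) \<in> Ob (power_cat B r)"
      "drop (q + r) xs \<in> Ob (power_cat B p)" "drop q xs \<in> Ob (power_cat B (r + p))"
      "take (q + r) xs \<in> Ob (power_cat B (q + r))"
      using xs by (auto simp: power_cat_simps dest: in_set_takeD in_set_dropD)
    show ?thesis
      using asc_nat[OF s(4)[OF sl(1)] t(4)[OF sl(2)] u(4)[OF sl(3)]] xs sl
      by (simp add: opn_asc_tr_def opn_tr_ten_def drop_drop_add drop_take s t u flip: add.assoc del: drop_drop)
  qed
  show "Cmp (B_bar B) (asc (B_bar B) (Cod (B_bar B) x, Cod (B_bar B) y, Cod (B_bar B) z))
      (am (tensor (B_bar B)) (x, am (tensor (B_bar B)) (y, z))) =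
    Cmp (B_bar B) (am (tensor (B_bar B)) (am (tensor (B_bar B)) (x, y), z))
      (asc (B_bar B) (Dom (B_bar B) x, Dom (B_bar B) y, Dom (B_bar B) z))"
    using xy z trten[OF xy] trten[OF xy(2) z] cat_ob[OF c xy(1)] cat_ob[OF c xy(2)] cat_ob[OF c z] q(1) r(1) p(1)
    unfolding e e'
    by (auto simp: B_bar_tensor B_bar_asc B_bar_simps(3,4,6) opn_tr_tensor_eq opn_asc_eq pt
        simp flip: add.assoc intro!: restrict_ext)
qed

section \<open>The identity and the tensor as operations\<close>

lemma id_opn_mem: "(1, id_opn B) \<in> Ob (B_bar B)"
proof -
  have "is_functor (power_cat B 1) B (id_opn B)"
    unfolding id_opn_def
    by (rule is_functor_mkI) (auto simp: cat category_power power_cat_simps)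
  then show ?thesis by (simp add: B_bar_mem)
qed

text \<open>A list of length two is \<open>[x, y]\<close>, and its two slices are singletons on
  which the identity operation returns the entry. Strictness at the pair of identities thereby
  becomes the condition on \<otimes>.\<close>

lemma opn_tensor_id_opn: "opn_tensor B (1, id_opn B) (1, id_opn B) = (2, tensor_opn B)"
proof -
  have "opn_ten B 1 (id_opn B) 1 (id_opn B) = tensor_opn B"
    unfolding opn_ten_def opn_tensor_def tensor_opn_def
    by (auto simp: id_opn_def power_cat_simps mk_fctr_def numeral_2_eq_2 length_Suc_conv intro!: restrict_ext)
  then show ?thesis by (simp add: opn_tensor_eq)
qed

end

theorem proposition1:
  fixes B :: "('o, 'a) acat"
  assumes "associative_category B"
  shows "\<exists>!P. strict_tensor_functor A_bar (It_bar B) P \<and>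
    om P (1, star1) = (1, id_opn B) \<and>
    om P (2, star2) = (2, tensor_opn B) \<and>
    am P (3, alpha) = beta B"
proof -
  interpret assoc_cat B by unfold_locales (rule assms)
  let ?e = "(1, id_opn B)"
  have e: "?e \<in> gen_ob (B_bar B) ?e" by (rule gen_ob.base)
  interpret It: assoc_cat "It_bar B"
    unfolding It_bar_def by unfold_locales (rule associative_generated_acat[OF associative_B_bar id_opn_mem])
  \<comment> \<open>The restriction to generated objects does not change the tensor and the
    associator at the generator.\<close>
  have It: "Ob (It_bar B) = gen_ob (B_bar B) ?e"
    "om (tensor (It_bar B)) (?e, ?e) = (2, tensor_opn B)" "asc (It_bar B) (?e, ?e, ?e) = beta B"
    using e id_opn_mem opn_tensor_id_opn
    by (simp_all add: It_bar_def generated_acat_def beta_def B_bar_tensor)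
  have star1: "(1, star1) \<in> Ob A_bar" "star1 \<in> Ob (catA 1)"
    using catA_1(1) by (simp_all add: A_bar_simps star1_def)
  \<comment> \<open>\<open>star2\<close> and \<open>alpha\<close> were defined by U and V at
    \<open>star1\<close>, so they are the tensor square and the associator of the generator of
    \<open>A_bar\<close>.\<close>
  have A: "om (tensor A_bar) ((1, star1), (1, star1)) = (2, star2)"
    "asc A_bar ((1, star1), (1, star1), (1, star1)) = (3, alpha)"
    using A_bar_tensor(1)[of 1 1 star1 star1] A_bar_asc[of 1 1 1 star1 star1 star1] star1(2)
    by (simp_all add: star2_def alpha_def iota_def numeral_3_eq_3)
  have "om P (2, star2) = (2, tensor_opn B) \<and> am P (3, alpha) = beta B"
    if "strict_tensor_functor A_bar (It_bar B) P" "om P (1, star1) = ?e" for P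
    using that star1(1) unfolding strict_tensor_functor_def A[symmetric] It(2,3)[symmetric] by metis
  then show ?thesis
    using It.A_bar_free[of ?e] e unfolding It(1) by metis
qed

end
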